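(* For every quantum channel $\mathcal{N}\colon A\to B$, $$\eta^{\Delta}_D(\mathcal{N})=\eta_{\mathrm{2cqCMI}}(\mathcal{N})=\eta_{\mathrm{cqCMI}}(\mathcal{N})=\eta_{\mathrm{CMI}}(\mathcal{N}).$$
   Context: All systems are finite-dimensional. A channel on $A$ acts as the identity on other systems. $D(\rho\|\sigma)=\operatorname{Tr}[\rho(\log\rho-\log\sigma)]$ if $\operatorname{supp}(\rho)\subseteq\operatorname{supp}(\sigma)$, else $+\infty$; $I(A:B)=D(\rho_{AB}\|\rho_A\otimes\rho_B)$; $I(A:B|C)=I(A:BC)-I(A:C)$. In every ratio optimization, the supremum is over states for which the denominator is strictly positive and finite (and the coefficient is $0$ if there are none). The conditional contraction coefficient is $$\eta^{\Delta}_D(\mathcal{N})=\sup_{R,\ \rho_{RA},\sigma_{RA}}\frac{D(\mathcal{N}(\rho_{RA})\|\mathcal{N}(\sigma_{RA}))-D(\rho_R\|\sigma_R)}{D(\rho_{RA}\|\sigma_{RA})-D(\rho_R\|\sigma_R)},$$ over all finite-dimensional reference systems $R$ and all pairs of states. Further, $$\eta_{\mathrm{CMI}}(\mathcal{N})=\sup_{\rho_{RCA}}\frac{I(C:B|R)}{I(C:A|R)},\qquad \eta_{\mathrm{cqCMI}}(\mathcal{N})=\sup_{\rho_{RUA}}\frac{I(U:B|R)}{I(U:A|R)},\qquad \eta_{\mathrm{2cqCMI}}(\mathcal{N})=\sup_{\rho_{RUA},\,|U|=2}\frac{I(U:B|R)}{I(U:A|R)},$$ where numerators are evaluated on the state after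 applying $\mathcal{N}$ to $A$, denominators on the input state, $R$ and $C$ range over arbitrary quantum systems, and $U$ is classical, i.e. $\rho_{RUA}=\sum_u p(u)|u\rangle\langle u|_U\otimes\rho^u_{RA}$. *)

theory Defs
  imports
    "Jordan_Normal_Form.Schur_Decomposition"
    "Jordan_Normal_Form.Matrix_Kernel"
    "HOL-Library.Extended_Real"
begin

(* A system of dimension d is the space of complex vectors of length d. The basis vector
   e_i (x) e_k of a composite system of dimensions d1, d2 has index i * d2 + k. With this
   convention tensor products of three systems are strictly associative: the bipartitions
   C:(RA) and (CR):A of one and the same matrix need no reindexing. Dimensions range over all
   of nat; dimension 0 never contributes, because it carries no matrix of trace one. *)

definition mat_trace :: "complex mat \<Rightarrow> complex" where
  "mat_trace X = (\<Sum>i<dim_row X. X $$ (i, i))"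

(* The order on the complex numbers is the one of HOL-Library.Complex_Order, so 0 \<le> z says
   that z is real and nonnegative. (The library order on matrices is entrywise and is
   not the Loewner order.) *)
definition psd :: "nat \<Rightarrow> complex mat \<Rightarrow> bool" where
  "psd n X \<longleftrightarrow> X \<in> carrier_mat n n \<and> (\<forall>v \<in> carrier_vec n. 0 \<le> (X *\<^sub>v v) \<bullet>c v)"

definition density :: "nat \<Rightarrow> complex mat \<Rightarrow> bool" where
  "density n X \<longleftrightarrow> psd n X \<and> mat_trace X = 1"

definition unitary :: "nat \<Rightarrow> complex mat \<Rightarrow> bool" where
  "unitary n U \<longleftrightarrow> U \<in> carrier_mat n n \<and>
     U * mat_adjoint U = 1\<^sub>m n \<and> mat_adjoint U * U = 1\<^sub>m n"

definition tensor_mat :: "complex mat \<Rightarrow> complex mat \<Rightarrow> complex mat" where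
  "tensor_mat X Y = mat (dim_row X * dim_row Y) (dim_col X * dim_col Y)
     (\<lambda>(i, j). X $$ (i div dim_row Y, j div dim_col Y) * Y $$ (i mod dim_row Y, j mod dim_col Y))"

(* Partial traces of a matrix on a composite system of dimensions d1, d2. *)
definition tr_snd :: "nat \<Rightarrow> nat \<Rightarrow> complex mat \<Rightarrow> complex mat" where
  "tr_snd d1 d2 X = mat d1 d1 (\<lambda>(i, j). \<Sum>k<d2. X $$ (i * d2 + k, j * d2 + k))"

definition tr_fst :: "nat \<Rightarrow> nat \<Rightarrow> complex mat \<Rightarrow> complex mat" where
  "tr_fst d1 d2 X = mat d2 d2 (\<lambda>(k, l). \<Sum>i<d1. X $$ (i * d2 + k, i * d2 + l))"

(* The d x d block in block position (i, j) of X: if X = (\<Sum>i j. |i><j| (x) X_ij) then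
   mat_block d i j X = X_ij. *)
definition mat_block :: "nat \<Rightarrow> nat \<Rightarrow> nat \<Rightarrow> complex mat \<Rightarrow> complex mat" where
  "mat_block d i j X = mat d d (\<lambda>(k, l). X $$ (i * d + k, j * d + l))"

(* id (x) N, with the identity on a system of dimension d: it maps
   (\<Sum>i j. |i><j| (x) X_ij) to (\<Sum>i j. |i><j| (x) N X_ij). *)
definition id_tensor ::
    "nat \<Rightarrow> nat \<Rightarrow> nat \<Rightarrow> (complex mat \<Rightarrow> complex mat) \<Rightarrow> complex mat \<Rightarrow> complex mat" where
  "id_tensor d dA dB N X = mat (d * dB) (d * dB)
     (\<lambda>(i, j). N (mat_block dA (i div dB) (j div dB) X) $$ (i mod dB, j mod dB))"

definition quantum_channel :: "nat \<Rightarrow> nat \<Rightarrow> (complex mat \<Rightarrow> complex mat) \<Rightarrow> bool" where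
  "quantum_channel dA dB N \<longleftrightarrow>
     (\<forall>X \<in> carrier_mat dA dA. N X \<in> carrier_mat dB dB) \<and>
     (\<forall>X \<in> carrier_mat dA dA. \<forall>Y \<in> carrier_mat dA dA. N (X + Y) = N X + N Y) \<and>
     (\<forall>c. \<forall>X \<in> carrier_mat dA dA. N (c \<cdot>\<^sub>m X) = c \<cdot>\<^sub>m N X) \<and>
     (\<forall>X \<in> carrier_mat dA dA. mat_trace (N X) = mat_trace X) \<and>
     (\<forall>d X. psd (d * dA) X \<longrightarrow> psd (d * dB) (id_tensor d dA dB N X))"

(* Logarithm of a positive semidefinite matrix through a spectral decomposition; the result
   does not depend on the decomposition chosen. Since ln 0 = 0 in HOL, this is the logarithm
   on the support, extended by 0 on the kernel. *)
definition mat_log :: "complex mat \<Rightarrow> complex mat" where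
  "mat_log X = (SOME L. \<exists>U (e :: nat \<Rightarrow> real). unitary (dim_row X) U \<and>
     X = U * mat_diag (dim_row X) (\<lambda>i. complex_of_real (e i)) * mat_adjoint U \<and>
     L = U * mat_diag (dim_row X) (\<lambda>i. complex_of_real (ln (e i))) * mat_adjoint U)"

(* The support of a Hermitian matrix: the orthogonal complement of its kernel. *)
definition supp :: "complex mat \<Rightarrow> complex vec set" where
  "supp X = {v \<in> carrier_vec (dim_row X). \<forall>w \<in> mat_kernel X. v \<bullet>c w = 0}"

(* For density matrices the trace below is real. *)
definition rel_entropy :: "complex mat \<Rightarrow> complex mat \<Rightarrow> ereal" where
  "rel_entropy \<rho> \<sigma> =
     (if supp \<rho> \<subseteq> supp \<sigma> then ereal (Re (mat_trace (\<rho> * (mat_log \<rho> - mat_log \<sigma>)))) else \<infinity>)"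

(* I(X:Y) for a state of the composite system XY of dimensions dX, dY. *)
definition mutual_info :: "nat \<Rightarrow> nat \<Rightarrow> complex mat \<Rightarrow> ereal" where
  "mutual_info dX dY \<rho> = rel_entropy \<rho> (tensor_mat (tr_snd dX dY \<rho>) (tr_fst dX dY \<rho>))"

(* I(X:Y|R) = I(X:RY) - I(X:R) for a state of the composite system XRY (in this order) of
   dimensions dX, dR, dY. *)
definition cond_mutual_info :: "nat \<Rightarrow> nat \<Rightarrow> nat \<Rightarrow> complex mat \<Rightarrow> ereal" where
  "cond_mutual_info dX dR dY \<rho> =
     mutual_info dX (dR * dY) \<rho> - mutual_info dX dR (tr_snd (dX * dR) dY \<rho>)"

(* Supremum of the ratios num / den over those pairs (num, den) in S with 0 < den < \<infinity>, and 0
   if there are none. An undefined difference \<infinity> - \<infinity> has the value \<infinity> in ereal, so such a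
   denominator is discarded. *)
definition sup_ratio :: "(ereal \<times> ereal) set \<Rightarrow> ereal" where
  "sup_ratio S = (let Q = {num / den | num den. (num, den) \<in> S \<and> 0 < den \<and> den < \<infinity>}
                  in if Q = {} then 0 else Sup Q)"

definition eta_Delta :: "nat \<Rightarrow> nat \<Rightarrow> (complex mat \<Rightarrow> complex mat) \<Rightarrow> ereal" where
  "eta_Delta dA dB N = sup_ratio
     {(rel_entropy (id_tensor dR dA dB N \<rho>) (id_tensor dR dA dB N \<sigma>)
         - rel_entropy (tr_snd dR dA \<rho>) (tr_snd dR dA \<sigma>),
       rel_entropy \<rho> \<sigma> - rel_entropy (tr_snd dR dA \<rho>) (tr_snd dR dA \<sigma>))
      | dR \<rho> \<sigma>. density (dR * dA) \<rho> \<and> density (dR * dA) \<sigma>}"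

(* The pair I(C:B|R), I(C:A|R) for a state of CRA, where B is the output of N on A. *)
definition cmi_pair ::
    "nat \<Rightarrow> nat \<Rightarrow> (complex mat \<Rightarrow> complex mat) \<Rightarrow> nat \<Rightarrow> nat \<Rightarrow> complex mat \<Rightarrow> ereal \<times> ereal" where
  "cmi_pair dA dB N dC dR \<rho> =
     (cond_mutual_info dC dR dB (id_tensor (dC * dR) dA dB N \<rho>), cond_mutual_info dC dR dA \<rho>)"

definition eta_CMI :: "nat \<Rightarrow> nat \<Rightarrow> (complex mat \<Rightarrow> complex mat) \<Rightarrow> ereal" where
  "eta_CMI dA dB N = sup_ratio
     {cmi_pair dA dB N dC dR \<rho> | dC dR \<rho>. density (dC * dR * dA) \<rho>}"

(* |u><u| in dimension n *)
definition basis_proj :: "nat \<Rightarrow> nat \<Rightarrow> complex mat" where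
  "basis_proj n u = mat n n (\<lambda>(i, j). if i = u \<and> j = u then 1 else 0)"

(* \<rho> = (\<Sum>u. p(u) |u><u| (x) \<tau>_u), with the sum of matrices written entrywise. *)
definition cq_state :: "nat \<Rightarrow> nat \<Rightarrow> complex mat \<Rightarrow> bool" where
  "cq_state dU d \<rho> \<longleftrightarrow> (\<exists>(p :: nat \<Rightarrow> real) \<tau>.
     (\<forall>u<dU. 0 \<le> p u) \<and> (\<Sum>u<dU. p u) = 1 \<and> (\<forall>u<dU. density d (\<tau> u)) \<and>
     \<rho> = mat (dU * d) (dU * d)
           (\<lambda>ij. \<Sum>u<dU. complex_of_real (p u) * tensor_mat (basis_proj dU u) (\<tau> u) $$ ij))"

definition eta_cqCMI :: "nat \<Rightarrow> nat \<Rightarrow> (complex mat \<Rightarrow> complex mat) \<Rightarrow> ereal" where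
  "eta_cqCMI dA dB N = sup_ratio
     {cmi_pair dA dB N dU dR \<rho> | dU dR \<rho>. cq_state dU (dR * dA) \<rho>}"

definition eta_2cqCMI :: "nat \<Rightarrow> nat \<Rightarrow> (complex mat \<Rightarrow> complex mat) \<Rightarrow> ereal" where
  "eta_2cqCMI dA dB N = sup_ratio
     {cmi_pair dA dB N 2 dR \<rho> | dR \<rho>. cq_state 2 (dR * dA) \<rho>}"

end

(* Conditioning on a classical or quantum register C only moves it into the reference system: with
   sigma = rho_C (x) rho_RA and reference CR, I(C:A|R) is the difference of relative entropies that
   occurs in the conditional contraction coefficient. So the pairs (numerator, denominator) of the
   coefficients form an increasing chain 2cqCMI, cqCMI, CMI, Delta.

   Conversely, let U be a bit that equals 0 with probability p, and give RA the state rho or sigma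
   according to U. With omega = p rho + (1 - p) sigma,
     I(U:RA) = p D(rho||sigma) - D(omega||sigma),   0 <= D(omega||sigma) <= p^2 C,
   where C does not depend on p, so I(U:RA) / p tends to D(rho||sigma) as p tends to 0. The same holds
   for the marginals on R and for the channel outputs; hence the ratio of conditional mutual
   informations converges to the ratio for the pair (rho, sigma). *)
theory Submission
  imports Defs "Jordan_Normal_Form.Spectral_Radius"
begin

section \<open>Unitary matrices and the spectral theorem\<close>

text \<open>The constant C in the bound on D(omega||sigma) must not see the eigenbasis of omega,
  which changes with p in an uncontrolled way. Expanding in the eigenbases of omega and sigma and
  using the scalar bound x ln x - x ln y <= (x - y) + (x - y)^2 / y leaves a quadratic expression
  from which Parseval removes the basis of omega. Since omega - sigma = p (rho - sigma), it equals
  p^2 C with C = Tr((rho - sigma)^2 sigma^(-1)), the inverse taken on the support.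

  Supports are awkward under a channel, so finiteness of D(rho||sigma) is restated as
  \<open>dominated\<close>: c sigma - rho is positive semidefinite for some c. Complete positivity
  carries this to the output, hence a finite positive denominator forces a finite numerator. The
  same bound removes every term in which the default value ln 0 = 0 would be wrong.

  \<open>mat_log\<close> is chosen among all spectral decompositions, so existence (the spectral
  theorem) and independence of the choice come before any computation with it.\<close>

lemma index_mult_mat_sum:
  assumes "A \<in> carrier_mat m n" "B \<in> carrier_mat n k" "i < m" "j < k"
  shows "(A * B) $$ (i, j) = (\<Sum>l<n. A $$ (i, l) * B $$ (l, j))"
  using assms by (auto simp: scalar_prod_def atLeast0LessThan intro!: sum.cong)

lemma index_mat_adjoint:
  fixes A :: "complex mat"
  assumes "A \<in> carrier_mat m n" "i < n" "j < m"
  shows "mat_adjoint A $$ (i, j) = cnj (A $$ (j, i))"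
  using assms by (auto simp: mat_adjoint_def mat_of_rows_def)

lemma dim_mat_adjoint [simp]:
  fixes A :: "complex mat"
  shows "dim_row (mat_adjoint A) = dim_col A" "dim_col (mat_adjoint A) = dim_row A"
  by (auto simp: mat_adjoint_def mat_of_rows_def)

lemma mat_adjoint_carrier:
  fixes A :: "complex mat"
  assumes "A \<in> carrier_mat m n"
  shows "mat_adjoint A \<in> carrier_mat n m"
  using assms by (auto simp: mat_adjoint_def mat_of_rows_def)

lemma mat_adjoint_adjoint:
  fixes A :: "complex mat"
  assumes "A \<in> carrier_mat m n"
  shows "mat_adjoint (mat_adjoint A) = A"
  using assms mat_adjoint_carrier[OF assms]
  by (intro eq_matI) (auto simp: index_mat_adjoint[of _ n m] index_mat_adjoint[of _ m n])

lemma mat_adjoint_mult: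
  fixes A B :: "complex mat"
  assumes "A \<in> carrier_mat m n" "B \<in> carrier_mat n k"
  shows "mat_adjoint (A * B) = mat_adjoint B * mat_adjoint A"
proof (rule eq_matI)
  have AB: "A * B \<in> carrier_mat m k" using assms by simp
  note c = mat_adjoint_carrier[OF assms(1)] mat_adjoint_carrier[OF assms(2)] mat_adjoint_carrier[OF AB]
  show "dim_row (mat_adjoint (A * B)) = dim_row (mat_adjoint B * mat_adjoint A)"
    "dim_col (mat_adjoint (A * B)) = dim_col (mat_adjoint B * mat_adjoint A)"
    using c by auto
  fix i j assume "i < dim_row (mat_adjoint B * mat_adjoint A)" "j < dim_col (mat_adjoint B * mat_adjoint A)"
  then have ij: "i < k" "j < m" using c by auto
  show "mat_adjoint (A * B) $$ (i, j) = (mat_adjoint B * mat_adjoint A) $$ (i, j)"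
    using ij assms
    by (simp add: index_mat_adjoint[OF AB] index_mult_mat_sum[OF assms]
        index_mult_mat_sum[OF c(2,1)] index_mat_adjoint[OF assms(1)] index_mat_adjoint[OF assms(2)]
        mult.commute del: index_mult_mat)
qed

lemma unitaryD:
  assumes "unitary n U"
  shows "U \<in> carrier_mat n n" "mat_adjoint U \<in> carrier_mat n n"
    "U * mat_adjoint U = 1\<^sub>m n" "mat_adjoint U * U = 1\<^sub>m n"
  using assms mat_adjoint_carrier[of U n n] by (auto simp: unitary_def)

lemma unitaryI:
  assumes "U \<in> carrier_mat n n" "mat_adjoint U * U = 1\<^sub>m n"
  shows "unitary n U"
  using assms mat_mult_left_right_inverse[of "mat_adjoint U" n U] mat_adjoint_carrier[OF assms(1)]
  by (auto simp: unitary_def)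

lemma unitary_mult:
  assumes U: "unitary n U" and V: "unitary n V"
  shows "unitary n (U * V)"
proof (rule unitaryI)
  note u = unitaryD[OF U] and v = unitaryD[OF V]
  show "U * V \<in> carrier_mat n n" using u v by simp
  have "mat_adjoint (U * V) * (U * V) = mat_adjoint V * mat_adjoint U * (U * V)"
    using u v by (simp add: mat_adjoint_mult)
  also have "\<dots> = mat_adjoint V * (mat_adjoint U * (U * V))"
    using u v by (intro assoc_mult_mat[of _ n n _ n _ n]) auto
  also have "mat_adjoint U * (U * V) = mat_adjoint U * U * V"
    using u v by (intro assoc_mult_mat[symmetric, of _ n n _ n _ n]) auto
  finally show "mat_adjoint (U * V) * (U * V) = 1\<^sub>m n" using u v by simp
qed

lemma mat_adjoint_four_block_diag:
  fixes A B :: "complex mat"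
  assumes A: "A \<in> carrier_mat m m" and B: "B \<in> carrier_mat n n"
  shows "mat_adjoint (four_block_mat A (0\<^sub>m m n) (0\<^sub>m n m) B) =
    four_block_mat (mat_adjoint A) (0\<^sub>m m n) (0\<^sub>m n m) (mat_adjoint B)"
    (is "mat_adjoint ?L = ?R")
proof (rule eq_matI)
  have L: "?L \<in> carrier_mat (m + n) (m + n)" using assms by auto
  show "dim_row (mat_adjoint ?L) = dim_row ?R" "dim_col (mat_adjoint ?L) = dim_col ?R"
    using assms by auto
  fix i j assume "i < dim_row ?R" "j < dim_col ?R"
  then have "i < m + n" "j < m + n" using assms by auto
  then show "mat_adjoint ?L $$ (i, j) = ?R $$ (i, j)"
    using assms by (auto simp: index_mat_adjoint[OF L] index_mat_adjoint[OF A] index_mat_adjoint[OF B])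
qed

lemma mult_four_block_diag:
  fixes A B :: "complex mat"
  assumes A: "A \<in> carrier_mat m m" and B: "B \<in> carrier_mat n n"
    and C: "C \<in> carrier_mat m m" and D: "D \<in> carrier_mat n n"
  shows "four_block_mat A (0\<^sub>m m n) (0\<^sub>m n m) B * four_block_mat C (0\<^sub>m m n) (0\<^sub>m n m) D =
    four_block_mat (A * C) (0\<^sub>m m n) (0\<^sub>m n m) (B * D)"
  using assms
  by (subst mult_four_block_mat[where ?nr1.0 = m and ?nr2.0 = n and ?n1.0 = m and ?n2.0 = n
        and ?nc1.0 = m and ?nc2.0 = n]) auto

lemma unitary_four_block_diag:
  assumes "unitary m U" "unitary n V"
  shows "unitary (m + n) (four_block_mat U (0\<^sub>m m n) (0\<^sub>m n m) V)"
proof (rule unitaryI)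
  note u = unitaryD[OF assms(1)] and v = unitaryD[OF assms(2)]
  show "four_block_mat U (0\<^sub>m m n) (0\<^sub>m n m) V \<in> carrier_mat (m + n) (m + n)"
    using u v by auto
  show "mat_adjoint (four_block_mat U (0\<^sub>m m n) (0\<^sub>m n m) V) *
      four_block_mat U (0\<^sub>m m n) (0\<^sub>m n m) V = 1\<^sub>m (m + n)"
    using u v by (simp add: mat_adjoint_four_block_diag mult_four_block_diag)
qed

text \<open>\<open>mat_log\<close> quantifies over exactly these data. Keeping \<open>U\<close> and
  \<open>e\<close> as explicit arguments turns traces and quadratic forms into finite sums over
  eigenvalues. The eigenvalues are real but unordered, and \<open>e\<close> is unconstrained from
  index \<open>n\<close> on.\<close>

definition spectral :: "nat \<Rightarrow> complex mat \<Rightarrow> complex mat \<Rightarrow> (nat \<Rightarrow> real) \<Rightarrow> bool" where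
  "spectral n X U e \<longleftrightarrow> unitary n U \<and>
     X = U * mat_diag n (\<lambda>i. complex_of_real (e i)) * mat_adjoint U"

lemma spectral_carrier:
  assumes "spectral n X U e"
  shows "X \<in> carrier_mat n n"
proof -
  have "unitary n U" and X: "X = U * mat_diag n (\<lambda>i. complex_of_real (e i)) * mat_adjoint U"
    using assms by (auto simp: spectral_def)
  note u = unitaryD(1,2)[OF this(1)]
  show ?thesis unfolding X by (intro mult_carrier_mat[of _ n n] u mat_diag_dim)
qed

text \<open>Gram-Schmidt applied to a basis that begins with \<open>v\<close> keeps \<open>v\<close>
  as its first vector; normalising the resulting orthogonal vectors gives the columns of
  \<open>W\<close>. The scalar \<open>c\<close> arises as the inverse norm of
  \<open>v\<close>.\<close>

lemma unitary_with_first_column: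
  assumes v: "v \<in> carrier_vec (Suc m)" and v0: "v \<noteq> 0\<^sub>v (Suc m)"
  obtains W c where "unitary (Suc m) W" "col W 0 = c \<cdot>\<^sub>v (v :: complex vec)"
proof -
  let ?n = "Suc m"
  interpret cof_vec_space ?n "TYPE(complex)" .
  define b where "b = basis_completion v"
  from basis_completion[OF v v0, folded b_def]
  have dist_b: "distinct b" and indep: "\<not> lin_dep (set b)" and b: "set b \<subseteq> carrier_vec ?n"
    and hdb: "hd b = v" and len_b: "length b = ?n" by auto
  from hdb len_b obtain vs where bv: "b = v # vs" by (cases b) auto
  define ws where "ws = gram_schmidt ?n b"
  from gram_schmidt_result[OF b dist_b indep refl, folded ws_def]
  have ws: "set ws \<subseteq> carrier_vec ?n" "corthogonal ws" "length ws = ?n" by (auto simp: len_b)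
  from gram_schmidt_hd[OF v, of vs, folded bv] have hdws: "hd ws = v" unfolding ws_def .
  have wsc: "ws ! i \<in> carrier_vec ?n" if "i < ?n" for i using that ws by auto
  define s where "s i = Re (ws ! i \<bullet>c ws ! i)" for i
  have s: "ws ! i \<bullet>c ws ! i = complex_of_real (s i)" "s i > 0" if "i < ?n" for i
  proof -
    have "ws ! i \<bullet>c ws ! i \<ge> 0" by (rule conjugate_square_ge_0_vec)
    moreover have "ws ! i \<bullet>c ws ! i \<noteq> 0" using corthogonalD[OF ws(2), of i i] that ws(3) by auto
    ultimately show "ws ! i \<bullet>c ws ! i = complex_of_real (s i)" "s i > 0"
      unfolding s_def by (auto simp: less_eq_complex_def complex_eq_iff)
  qed
  define W where "W = mat ?n ?n (\<lambda>(i, j). complex_of_real (1 / sqrt (s j)) * ws ! j $ i)"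
  have W: "W \<in> carrier_mat ?n ?n" unfolding W_def by simp
  have "mat_adjoint W * W = 1\<^sub>m ?n"
  proof (rule eq_matI)
    show "dim_row (mat_adjoint W * W) = dim_row (1\<^sub>m ?n)"
      "dim_col (mat_adjoint W * W) = dim_col (1\<^sub>m ?n)" using W mat_adjoint_carrier[OF W] by auto
    fix i j assume "i < dim_row (1\<^sub>m ?n)" "j < dim_col (1\<^sub>m ?n)"
    then have ij: "i < ?n" "j < ?n" by auto
    have "(mat_adjoint W * W) $$ (i, j) = (\<Sum>l<?n. cnj (W $$ (l, i)) * W $$ (l, j))"
      using ij by (subst index_mult_mat_sum[OF mat_adjoint_carrier[OF W] W ij])
        (intro sum.cong refl, subst index_mat_adjoint[OF W], auto)
    also have "\<dots> = complex_of_real (1 / sqrt (s i)) * complex_of_real (1 / sqrt (s j)) *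
        (\<Sum>l<?n. ws ! j $ l * cnj (ws ! i $ l))"
      unfolding W_def sum_distrib_left using ij
      by (intro sum.cong refl) (simp add: field_simps)
    also have "(\<Sum>l<?n. ws ! j $ l * cnj (ws ! i $ l)) = ws ! j \<bullet>c ws ! i"
      using wsc[OF ij(1)] by (auto simp: scalar_prod_def atLeast0LessThan intro!: sum.cong)
    also have "complex_of_real (1 / sqrt (s i)) * complex_of_real (1 / sqrt (s j)) * \<dots> =
        1\<^sub>m ?n $$ (i, j)"
    proof (cases "i = j")
      case True
      have "sqrt (s j) * sqrt (s j) = s j" using s(2)[OF ij(2)] by simp
      then have "complex_of_real (sqrt (s j)) * complex_of_real (sqrt (s j)) = complex_of_real (s j)"
        by (metis of_real_mult)
      then show ?thesis using True ij s[OF ij(2)] by (simp add: field_simps)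
    next
      case False
      then have "ws ! j \<bullet>c ws ! i = 0" using corthogonalD[OF ws(2), of j i] ij ws(3) by auto
      then show ?thesis using False ij by simp
    qed
    finally show "(mat_adjoint W * W) $$ (i, j) = 1\<^sub>m ?n $$ (i, j)" .
  qed
  then have "unitary ?n W" by (rule unitaryI[OF W])
  moreover have "col W 0 = complex_of_real (1 / sqrt (s 0)) \<cdot>\<^sub>v v"
  proof -
    have "ws ! 0 = v" using hdws ws(3) by (cases ws) auto
    then show ?thesis unfolding W_def using v by (intro eq_vecI) auto
  qed
  ultimately show ?thesis by (rule that)
qed

text \<open>Deflation: conjugation by a unitary whose first column is an eigenvector clears the
  first column below the diagonal, Hermiticity then clears the first row, and the induction
  hypothesis applies to the remaining block.\<close>

lemma hermitian_spectral:
  assumes "X \<in> carrier_mat n n" "mat_adjoint X = X"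
  shows "\<exists>U e. spectral n X U e"
  using assms
proof (induction n arbitrary: X)
  case 0
  then show ?case
    by (intro exI[of _ "1\<^sub>m 0"] exI[of _ "\<lambda>_. 0"])
      (auto simp: spectral_def unitary_def mat_adjoint_def mat_of_rows_def mat_diag_def intro!: eq_matI)
next
  case (Suc m)
  let ?n = "Suc m"
  note X = Suc.prems(1)
  from spectrum_non_empty[OF X] obtain a where "eigenvalue X a" unfolding spectrum_def by auto
  then obtain v where ev: "eigenvector X v a" unfolding eigenvalue_def by auto
  have v: "v \<in> carrier_vec ?n" "v \<noteq> 0\<^sub>v ?n" "X *\<^sub>v v = a \<cdot>\<^sub>v v"
    using ev X unfolding eigenvector_def by auto
  obtain W c where uW: "unitary ?n W" and W0: "col W 0 = c \<cdot>\<^sub>v v"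
    by (rule unitary_with_first_column[OF v(1,2)])
  note w = unitaryD[OF uW]
  define Y where "Y = mat_adjoint W * X * W"
  have Y: "Y \<in> carrier_mat ?n ?n"
    unfolding Y_def by (intro mult_carrier_mat[of _ ?n ?n] w X)
  have Yh: "mat_adjoint Y = Y"
  proof -
    have "mat_adjoint Y = mat_adjoint W * mat_adjoint (mat_adjoint W * X)"
      unfolding Y_def using X w by (subst mat_adjoint_mult[of _ ?n ?n _ ?n]) auto
    also have "mat_adjoint (mat_adjoint W * X) = X * W"
      using X w Suc.prems(2) by (subst mat_adjoint_mult[of _ ?n ?n _ ?n]) (auto simp: mat_adjoint_adjoint)
    also have "mat_adjoint W * (X * W) = Y"
      unfolding Y_def using X w by (intro assoc_mult_mat[symmetric, of _ ?n ?n _ ?n _ ?n]) auto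
    finally show ?thesis .
  qed
  have X_eq: "X = W * Y * mat_adjoint W"
  proof -
    have "W * Y * mat_adjoint W = W * (mat_adjoint W * (X * (W * mat_adjoint W)))"
      unfolding Y_def using X w(1,2) by (simp add: assoc_mult_mat[of _ ?n ?n _ ?n _ ?n])
    also have "\<dots> = W * (mat_adjoint W * X)" using X w(3) by simp
    also have "\<dots> = W * mat_adjoint W * X"
      using X w(1,2) by (intro assoc_mult_mat[symmetric, of _ ?n ?n _ ?n _ ?n]) auto
    finally show ?thesis using X w(3) by simp
  qed
  \<comment> \<open>The first column of \<open>W\<close> is a multiple of \<open>v\<close>, so
    \<open>X\<close> scales it by \<open>a\<close>, and the adjoint of \<open>W\<close> sends it
    back to the first unit vector.\<close>
  have Y0: "Y $$ (i, 0) = (if i = 0 then a else 0)" if i: "i < ?n" for i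
  proof -
    have "col Y 0 = (mat_adjoint W * X) *\<^sub>v col W 0"
      unfolding Y_def using X w by (intro col_mult2[of _ ?n ?n _ ?n]) auto
    also have "\<dots> = mat_adjoint W *\<^sub>v (X *\<^sub>v (c \<cdot>\<^sub>v v))"
      unfolding W0 using X w v by (intro assoc_mult_mat_vec[of _ ?n ?n _ ?n]) auto
    also have "X *\<^sub>v (c \<cdot>\<^sub>v v) = a \<cdot>\<^sub>v col W 0"
      unfolding W0 using X v by (subst mult_mat_vec[of _ ?n ?n]) (auto simp: smult_smult_assoc mult.commute)
    also have "mat_adjoint W *\<^sub>v (a \<cdot>\<^sub>v col W 0) = a \<cdot>\<^sub>v (mat_adjoint W *\<^sub>v col W 0)"
      using w by (intro mult_mat_vec[of _ ?n ?n] carrier_vecI) auto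
    also have "mat_adjoint W *\<^sub>v col W 0 = col (mat_adjoint W * W) 0"
      using w by (intro col_mult2[symmetric, of _ ?n ?n _ ?n]) auto
    finally have "col Y 0 = a \<cdot>\<^sub>v unit_vec ?n 0" using w by simp
    from arg_cong[OF this, of "\<lambda>u. u $ i"] show ?thesis using Y i by auto
  qed
  have sym: "Y $$ (i, j) = cnj (Y $$ (j, i))" if "i < ?n" "j < ?n" for i j
    using index_mat_adjoint[OF Y that] Yh by simp
  have Y0': "Y $$ (0, j) = (if j = 0 then a else 0)" if "j < ?n" for j
    using sym[of 0 j] Y0[of j] Y0[of 0] that by (cases "j = 0") auto
  define Z where "Z = mat m m (\<lambda>(i, j). Y $$ (Suc i, Suc j))"
  have Z: "Z \<in> carrier_mat m m" unfolding Z_def by simp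
  have "mat_adjoint Z = Z"
    using mat_adjoint_carrier[OF Z] Z
    by (intro eq_matI) (simp_all add: index_mat_adjoint[OF Z] sym[symmetric], simp add: Z_def sym[symmetric])
  from Suc.IH[OF Z this] obtain V f where VZ: "spectral m Z V f" by auto
  have uV: "unitary m V" and Z_eq: "Z = V * mat_diag m (\<lambda>i. complex_of_real (f i)) * mat_adjoint V"
    using VZ by (auto simp: spectral_def)
  note vv = unitaryD[OF uV]
  have u1: "unitary 1 (1\<^sub>m 1)"
    by (rule unitaryI) (auto simp: mat_adjoint_def mat_of_rows_def intro!: eq_matI)
  have adj1: "mat_adjoint (1\<^sub>m (Suc 0)) = (1\<^sub>m (Suc 0) :: complex mat)"
    by (auto simp: mat_adjoint_def mat_of_rows_def intro!: eq_matI)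
  define V' where "V' = four_block_mat (1\<^sub>m 1) (0\<^sub>m 1 m) (0\<^sub>m m 1) V"
  have uV': "unitary ?n V'" unfolding V'_def using unitary_four_block_diag[OF u1 uV] by simp
  note v' = unitaryD[OF uV']
  define g where "g i = (case i of 0 \<Rightarrow> Re a | Suc k \<Rightarrow> f k)" for i
  \<comment> \<open>The eigenvalue is a diagonal entry of the Hermitian matrix \<open>Y\<close>, so
    nothing is lost by storing \<open>Re a\<close>.\<close>
  have a_real: "complex_of_real (Re a) = a"
    using sym[of 0 0] Y0[of 0] by (simp add: complex_eq_iff)
  define D where "D = mat_diag ?n (\<lambda>i. complex_of_real (g i))"
  have D: "D \<in> carrier_mat ?n ?n" unfolding D_def by simp
  define E where "E = mat_diag m (\<lambda>i. complex_of_real (f i))"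
  have E: "E \<in> carrier_mat m m" unfolding E_def by simp
  have D_eq: "D = four_block_mat (a \<cdot>\<^sub>m 1\<^sub>m 1) (0\<^sub>m 1 m) (0\<^sub>m m 1) E"
    unfolding D_def E_def mat_diag_def
    by (rule eq_matI) (auto simp: g_def a_real split: nat.splits)
  have "V' * D * mat_adjoint V' = four_block_mat (a \<cdot>\<^sub>m 1\<^sub>m 1) (0\<^sub>m 1 m) (0\<^sub>m m 1) Z"
    unfolding V'_def D_eq Z_eq E_def[symmetric] using vv E
    by (simp add: mat_adjoint_four_block_diag mult_four_block_diag adj1)
  also have "\<dots> = Y"
    using Y Z by (intro eq_matI) (auto simp: Z_def Y0 Y0')
  finally have Y_eq: "V' * D * mat_adjoint V' = Y" .
  have "X = (W * V') * D * mat_adjoint (W * V')"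
  proof -
    have "(W * V') * D * mat_adjoint (W * V') = (W * V') * D * (mat_adjoint V' * mat_adjoint W)"
      using w v' by (simp add: mat_adjoint_mult)
    also have "\<dots> = W * (V' * D * mat_adjoint V') * mat_adjoint W"
      using w v' D by (simp add: assoc_mult_mat[of _ ?n ?n _ ?n _ ?n])
    finally show ?thesis using X_eq Y_eq by simp
  qed
  then show ?case unfolding spectral_def D_def using unitary_mult[OF uW uV'] by blast
qed

section \<open>Positive semidefinite matrices and the logarithm\<close>

lemma complex_of_real_nonneg_iff: "0 \<le> complex_of_real x \<longleftrightarrow> 0 \<le> x"
  by (simp add: less_eq_complex_def)

text \<open>The form f^* X f. Test vectors are functions, not elements of
  \<open>carrier_vec\<close>, so vectors given by case distinctions or by \<open>div\<close> and
  \<open>mod\<close> on indices can be inserted without side conditions.\<close>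

definition quad_form :: "nat \<Rightarrow> complex mat \<Rightarrow> (nat \<Rightarrow> complex) \<Rightarrow> complex" where
  "quad_form n X f = (\<Sum>i<n. \<Sum>j<n. cnj (f i) * X $$ (i, j) * f j)"

lemma inner_mult_vec_eq_quad_form:
  assumes "X \<in> carrier_mat n n" "v \<in> carrier_vec n"
  shows "(X *\<^sub>v v) \<bullet>c v = quad_form n X (\<lambda>i. v $ i)"
  using assms
  by (auto simp: quad_form_def scalar_prod_def atLeast0LessThan sum_distrib_left sum_distrib_right mult_ac
      intro!: sum.cong)

lemma psd_iff_quad_form:
  "psd n X \<longleftrightarrow> X \<in> carrier_mat n n \<and> (\<forall>f. 0 \<le> quad_form n X f)"
proof (cases "X \<in> carrier_mat n n")
  case True
  have "0 \<le> quad_form n X f" if "psd n X" for f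
  proof -
    have "0 \<le> (X *\<^sub>v vec n f) \<bullet>c vec n f" using that by (simp add: psd_def)
    also have "\<dots> = quad_form n X (\<lambda>i. vec n f $ i)"
      by (rule inner_mult_vec_eq_quad_form[OF True]) simp
    also have "\<dots> = quad_form n X f" by (simp add: quad_form_def)
    finally show ?thesis .
  qed
  then show ?thesis using True inner_mult_vec_eq_quad_form[OF True] by (auto simp: psd_def)
qed (simp add: psd_def)

lemma psdI:
  assumes "X \<in> carrier_mat n n" "\<And>f. 0 \<le> quad_form n X f"
  shows "psd n X"
  using assms by (simp add: psd_iff_quad_form)

lemma psd_carrier: "psd n X \<Longrightarrow> X \<in> carrier_mat n n"
  by (simp add: psd_def)

lemma psd_quad_form: "psd n X \<Longrightarrow> 0 \<le> quad_form n X f"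
  by (simp add: psd_iff_quad_form)

lemma quad_form_add:
  assumes "X \<in> carrier_mat n n" "Y \<in> carrier_mat n n"
  shows "quad_form n (X + Y) f = quad_form n X f + quad_form n Y f"
  using assms by (simp add: quad_form_def algebra_simps sum.distrib)

lemma quad_form_minus:
  assumes "X \<in> carrier_mat n n" "Y \<in> carrier_mat n n"
  shows "quad_form n (X - Y) f = quad_form n X f - quad_form n Y f"
  using assms by (simp add: quad_form_def algebra_simps sum_subtractf)

lemma quad_form_smult:
  assumes "X \<in> carrier_mat n n"
  shows "quad_form n (c \<cdot>\<^sub>m X) f = c * quad_form n X f"
  using assms by (simp add: quad_form_def sum_distrib_left algebra_simps)

lemma psd_add:
  assumes "psd n X" "psd n Y"
  shows "psd n (X + Y)"
  using assms psd_carrier[OF assms(1)] psd_carrier[OF assms(2)]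
  by (intro psdI) (auto simp: quad_form_add intro!: add_nonneg_nonneg psd_quad_form)

lemma psd_smult:
  assumes "psd n X" "0 \<le> c"
  shows "psd n (complex_of_real c \<cdot>\<^sub>m X)"
  using assms psd_carrier[OF assms(1)]
  by (intro psdI) (auto simp: quad_form_smult less_eq_complex_def[of 0 "complex_of_real c"] intro!: mult_nonneg_nonneg psd_quad_form)

lemma sum_two_deltas:
  fixes g :: "nat \<Rightarrow> complex"
  assumes "i < n" "j < n"
  shows "(\<Sum>a<n. g a * ((if a = i then 1 else 0) + (if a = j then c else 0))) = g i + g j * c"
proof -
  have "(\<Sum>a<n. g a * ((if a = i then 1 else 0) + (if a = j then c else 0))) =
      (\<Sum>a<n. (if a = i then g i else 0) + (if a = j then g j * c else 0))"
    by (intro sum.cong) (auto simp: distrib_left)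
  then show ?thesis using assms by (simp add: sum.distrib)
qed

text \<open>Polarisation: the values of the form on e_i + c e_j are real, and suitable choices of
  \<open>c\<close> relate the two off-diagonal entries.\<close>

lemma psd_hermitian:
  assumes "psd n X"
  shows "mat_adjoint X = X"
proof -
  note X = psd_carrier[OF assms]
  have two: "quad_form n X (\<lambda>a. (if a = i then 1 else 0) + (if a = j then c else 0)) =
      X $$ (i, i) + X $$ (i, j) * c + (X $$ (j, i) + X $$ (j, j) * c) * cnj c"
    if "i < n" "j < n" for i j c
  proof -
    have "quad_form n X (\<lambda>a. (if a = i then 1 else 0) + (if a = j then c else 0)) =
        (\<Sum>a<n. (\<Sum>b<n. X $$ (a, b) * ((if b = i then 1 else 0) + (if b = j then c else 0))) *
          ((if a = i then 1 else 0) + (if a = j then cnj c else 0)))"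
      unfolding quad_form_def sum_distrib_right by (intro sum.cong refl) auto
    then show ?thesis by (simp only: sum_two_deltas[OF that])
  qed
  \<comment> \<open>This is the vector e_i, obtained from the two-term formula with equal indices
    and \<open>c = 0\<close>.\<close>
  have diag: "Im (X $$ (i, i)) = 0" if "i < n" for i
    using psd_quad_form[OF assms, of "\<lambda>a. (if a = i then 1 else 0) + (if a = i then 0 else 0)"]
      two[OF that that, of 0] by (simp add: less_eq_complex_def)
  have sym: "X $$ (i, j) = cnj (X $$ (j, i))" if "i < n" "j < n" for i j
  proof -
    note t = psd_quad_form[OF assms, of "\<lambda>a. (if a = i then 1 else 0) + (if a = j then c else 0)" for c,
        unfolded two[OF that]]
    \<comment> \<open>\<open>c = 1\<close> shows that the imaginary parts of the two entries are
      opposite, and \<open>c = \<i>\<close> that their real parts are equal.\<close>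
    from t[of 1] t[of \<i>] show ?thesis
      using diag that by (auto simp: less_eq_complex_def complex_eq_iff)
  qed
  show ?thesis using X by (intro eq_matI) (simp_all add: index_mat_adjoint[OF X] sym[symmetric])
qed

lemma index_spectral:
  assumes U: "unitary n U" "i < n" "j < n"
  shows "(U * mat_diag n (\<lambda>k. complex_of_real (e k)) * mat_adjoint U) $$ (i, j) =
    (\<Sum>k<n. complex_of_real (e k) * (U $$ (i, k) * cnj (U $$ (j, k))))"
proof -
  note u = unitaryD(1,2)[OF U(1)]
  have "(U * mat_diag n (\<lambda>k. complex_of_real (e k)) * mat_adjoint U) $$ (i, j) =
      (\<Sum>k<n. U $$ (i, k) * complex_of_real (e k) * cnj (U $$ (j, k)))"
    using u assms(2,3)
    by (subst mat_diag_mult_right[OF u(1)], subst index_mult_mat_sum[of _ n n _ n])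
      (auto simp: index_mat_adjoint[OF u(1)] simp del: index_mult_mat intro!: sum.cong)
  then show ?thesis by (simp add: mult_ac)
qed

lemma spectral_index:
  assumes "spectral n X U e" "i < n" "j < n"
  shows "X $$ (i, j) = (\<Sum>k<n. complex_of_real (e k) * (U $$ (i, k) * cnj (U $$ (j, k))))"
  using index_spectral[of n U i j e] assms by (auto simp: spectral_def simp del: index_mult_mat)

lemma spectral_unitary: "spectral n X U e \<Longrightarrow> unitary n U"
  by (simp add: spectral_def)

lemma unitary_columns:
  assumes "unitary n U" "i < n" "j < n"
  shows "(\<Sum>k<n. cnj (U $$ (k, i)) * U $$ (k, j)) = (if i = j then 1 else 0)"
proof -
  note u = unitaryD[OF assms(1)]
  have "(mat_adjoint U * U) $$ (i, j) = (\<Sum>k<n. cnj (U $$ (k, i)) * U $$ (k, j))"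
    using assms by (subst index_mult_mat_sum[OF u(2,1)]) (auto simp: index_mat_adjoint[OF u(1)] intro!: sum.cong)
  then show ?thesis using u assms by simp
qed

lemma unitary_rows:
  assumes "unitary n U" "i < n" "j < n"
  shows "(\<Sum>k<n. U $$ (i, k) * cnj (U $$ (j, k))) = (if i = j then 1 else 0)"
proof -
  note u = unitaryD[OF assms(1)]
  have "(U * mat_adjoint U) $$ (i, j) = (\<Sum>k<n. U $$ (i, k) * cnj (U $$ (j, k)))"
    using assms by (subst index_mult_mat_sum[OF u(1,2)]) (auto simp: index_mat_adjoint[OF u(1)] intro!: sum.cong)
  then show ?thesis using u assms by simp
qed

text \<open>The coefficient of \<open>f\<close> along the \<open>k\<close>-th column of
  \<open>U\<close>, conjugate-linear in the column.\<close>

definition inner_col :: "nat \<Rightarrow> complex mat \<Rightarrow> nat \<Rightarrow> (nat \<Rightarrow> complex) \<Rightarrow> complex" where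
  "inner_col n U k f = (\<Sum>i<n. cnj (U $$ (i, k)) * f i)"

lemma quad_form_spectral:
  assumes "spectral n X U e"
  shows "quad_form n X f = complex_of_real (\<Sum>k<n. e k * (cmod (inner_col n U k f))\<^sup>2)"
proof -
  have "quad_form n X f = (\<Sum>i<n. \<Sum>j<n. \<Sum>k<n. complex_of_real (e k) *
      ((cnj (f i) * U $$ (i, k)) * (cnj (U $$ (j, k)) * f j)))"
    unfolding quad_form_def
    by (intro sum.cong refl)
      (simp add: spectral_index[OF assms] sum_distrib_left sum_distrib_right mult_ac)
  also have "\<dots> = (\<Sum>i<n. \<Sum>k<n. \<Sum>j<n. complex_of_real (e k) *
      ((cnj (f i) * U $$ (i, k)) * (cnj (U $$ (j, k)) * f j)))"
    by (intro sum.cong refl sum.swap)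
  also have "\<dots> = (\<Sum>k<n. \<Sum>i<n. \<Sum>j<n. complex_of_real (e k) *
      ((cnj (f i) * U $$ (i, k)) * (cnj (U $$ (j, k)) * f j)))"
    by (rule sum.swap)
  also have "\<dots> = (\<Sum>k<n. complex_of_real (e k) *
      (cnj (\<Sum>i<n. cnj (U $$ (i, k)) * f i) * (\<Sum>i<n. cnj (U $$ (i, k)) * f i)))"
    by (simp add: sum_product sum_distrib_left mult_ac)
  also have "\<dots> = (\<Sum>k<n. complex_of_real (e k * (cmod (\<Sum>i<n. cnj (U $$ (i, k)) * f i))\<^sup>2))"
    unfolding of_real_mult complex_norm_square by (simp only: mult.commute)
  finally show ?thesis by (simp only: of_real_sum inner_col_def)
qed

text \<open>Evaluated at the \<open>k\<close>-th column of \<open>U\<close>, the form is the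
  eigenvalue \<open>e k\<close>, because the columns are orthonormal.\<close>

lemma psd_spectral_nonneg:
  assumes "psd n X" "spectral n X U e" "k < n"
  shows "0 \<le> e k"
proof -
  have "quad_form n X (\<lambda>i. U $$ (i, k)) =
      complex_of_real (\<Sum>l<n. e l * (cmod (if l = k then 1 else 0))\<^sup>2)"
    unfolding quad_form_spectral[OF assms(2)]
    by (intro arg_cong[of _ _ complex_of_real] sum.cong refl)
      (simp add: inner_col_def unitary_columns[OF spectral_unitary[OF assms(2)]] assms(3))
  also have "(\<Sum>l<n. e l * (cmod (if l = k then 1 else 0))\<^sup>2) = (\<Sum>l<n. if l = k then e l else 0)"
    by (intro sum.cong) auto
  finally show ?thesis using psd_quad_form[OF assms(1), of "\<lambda>i. U $$ (i, k)"] assms(3)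
    by (simp add: less_eq_complex_def sum.delta)
qed

lemma psd_spectral:
  assumes "psd n X"
  obtains U e where "spectral n X U e" "\<And>k. k < n \<Longrightarrow> 0 \<le> e k"
  using hermitian_spectral[OF psd_carrier[OF assms] psd_hermitian[OF assms]]
    psd_spectral_nonneg[OF assms] by blast

lemma spectral_psd:
  assumes "spectral n X U e" "\<And>k. k < n \<Longrightarrow> 0 \<le> e k"
  shows "psd n X"
proof (rule psdI[OF spectral_carrier[OF assms(1)]])
  fix f
  have "0 \<le> (\<Sum>k<n. e k * (cmod (inner_col n U k f))\<^sup>2)"
    by (intro sum_nonneg mult_nonneg_nonneg assms(2)) auto
  then show "0 \<le> quad_form n X f" unfolding quad_form_spectral[OF assms(1)]
    by (simp only: complex_of_real_nonneg_iff)
qed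

text \<open>If \<open>W = V\<^sup>* U\<close> intertwines two diagonal matrices, \<open>W $$ (i, j) * e j = f i * W $$ (i, j)\<close>,
  then it also intertwines their images under any function.\<close>

lemma spectral_function_unique:
  assumes "spectral n X U e" "spectral n X V f"
  shows "U * mat_diag n (\<lambda>i. complex_of_real (h (e i))) * mat_adjoint U =
    V * mat_diag n (\<lambda>i. complex_of_real (h (f i))) * mat_adjoint V"
proof -
  define D where "D e = mat_diag n (\<lambda>i. complex_of_real (e i))" for e :: "nat \<Rightarrow> real"
  have D: "D e \<in> carrier_mat n n" for e by (simp add: D_def)
  note u = unitaryD[OF spectral_unitary[OF assms(1)]] and v = unitaryD[OF spectral_unitary[OF assms(2)]]
  note assoc = assoc_mult_mat[of _ n n _ n _ n]
  have eq: "U * D e * mat_adjoint U = V * D f * mat_adjoint V"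
    using assms by (simp add: spectral_def D_def)
  define W where "W = mat_adjoint V * U"
  have W: "W \<in> carrier_mat n n" unfolding W_def by (intro mult_carrier_mat[of _ n n] u v)
  have "W * D e = mat_adjoint V * (U * D e * (mat_adjoint U * U))"
    unfolding W_def using u(1,4) v(2) D[of e] by (simp add: assoc)
  also have "\<dots> = mat_adjoint V * (U * D e * mat_adjoint U) * U"
    using u(1,2) v(2) D[of e] by (simp add: assoc)
  also have "\<dots> = mat_adjoint V * V * D f * (mat_adjoint V * U)"
    unfolding eq using u(1) v(1,2) D[of f] by (simp add: assoc)
  also have "\<dots> = D f * W" unfolding v(4) W_def[symmetric] using W D[of f] by simp
  finally have int: "W * D e = D f * W" .
  have "W $$ (i, j) * complex_of_real (e j) = complex_of_real (f i) * W $$ (i, j)"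
    if "i < n" "j < n" for i j
    using arg_cong[OF int, of "\<lambda>M. M $$ (i, j)"] that W
    by (simp add: D_def mat_diag_mult_left[OF W] mat_diag_mult_right[OF W] del: index_mult_mat)
  then have ew: "W $$ (i, j) = 0 \<or> e j = f i" if "i < n" "j < n" for i j
    using that by (metis mult.commute mult_left_cancel of_real_eq_iff)
  have int': "W * D (h \<circ> e) = D (h \<circ> f) * W"
    using W ew unfolding D_def mat_diag_mult_left[OF W] mat_diag_mult_right[OF W]
    by (intro eq_matI) (simp, use ew in fastforce, simp_all)
  have "U * D (h \<circ> e) * mat_adjoint U = V * mat_adjoint V * (U * D (h \<circ> e) * mat_adjoint U)"
    unfolding v(3) by (rule left_mult_one_mat[symmetric, of _ n n]) (intro mult_carrier_mat[of _ n n] u D)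
  also have "\<dots> = V * (W * D (h \<circ> e)) * mat_adjoint U"
    unfolding W_def using u(1,2) v(1,2) D[of "h \<circ> e"] by (simp add: assoc)
  also have "\<dots> = V * (D (h \<circ> f) * (mat_adjoint V * U)) * mat_adjoint U"
    unfolding int' unfolding W_def ..
  also have "\<dots> = V * D (h \<circ> f) * (mat_adjoint V * (U * mat_adjoint U))"
    using u(1,2) v(1,2) D[of "h \<circ> f"] by (simp add: assoc)
  also have "\<dots> = V * D (h \<circ> f) * mat_adjoint V"
    unfolding u(3) right_mult_one_mat[OF v(2)] ..
  finally show ?thesis by (simp add: D_def)
qed

text \<open>Whatever decomposition \<open>SOME\<close> selects,
  \<open>spectral_function_unique\<close> with \<open>h = ln\<close> identifies its logarithm with
  the one built from \<open>U\<close> and \<open>e\<close>. The given decomposition shows that there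
  is something to select.\<close>

lemma mat_log_spectral:
  assumes "spectral n X U e"
  shows "mat_log X = U * mat_diag n (\<lambda>i. complex_of_real (ln (e i))) * mat_adjoint U"
proof -
  have n: "dim_row X = n" using spectral_carrier[OF assms] by simp
  have "\<exists>V f. unitary n V \<and> X = V * mat_diag n (\<lambda>i. complex_of_real (f i)) * mat_adjoint V \<and>
      mat_log X = V * mat_diag n (\<lambda>i. complex_of_real (ln (f i))) * mat_adjoint V"
    unfolding mat_log_def n
    by (rule someI_ex, rule exI, rule exI[of _ U], rule exI[of _ e])
      (use assms in \<open>simp add: spectral_def\<close>)
  then obtain V f where "spectral n X V f"
      "mat_log X = V * mat_diag n (\<lambda>i. complex_of_real (ln (f i))) * mat_adjoint V"
    by (auto simp: spectral_def)
  then show ?thesis using spectral_function_unique[OF assms, of V f ln] by simp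
qed

lemma mat_log_carrier:
  assumes "psd n X"
  shows "mat_log X \<in> carrier_mat n n"
proof -
  obtain U e where s: "spectral n X U e" using psd_spectral[OF assms] by blast
  show ?thesis unfolding mat_log_spectral[OF s]
    by (intro mult_carrier_mat[of _ n n] unitaryD[OF spectral_unitary[OF s]] mat_diag_dim)
qed

section \<open>Relative entropy in a pair of eigenbases\<close>

lemma mat_trace_add:
  assumes "X \<in> carrier_mat n n" "Y \<in> carrier_mat n n"
  shows "mat_trace (X + Y) = mat_trace X + mat_trace Y"
  using assms by (auto simp: mat_trace_def sum.distrib)

lemma mat_trace_minus:
  assumes "X \<in> carrier_mat n n" "Y \<in> carrier_mat n n"
  shows "mat_trace (X - Y) = mat_trace X - mat_trace Y"
  using assms by (auto simp: mat_trace_def sum_subtractf)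

lemma mat_trace_smult:
  assumes "X \<in> carrier_mat n n"
  shows "mat_trace (c \<cdot>\<^sub>m X) = c * mat_trace X"
  using assms by (auto simp: mat_trace_def sum_distrib_left)

text \<open>The numbers |<u_i, v_j>|^2 for columns u_i of \<open>U\<close> and v_j of
  \<open>V\<close>. For unitary matrices they form a doubly stochastic matrix, which couples the two
  spectra in the trace of a product.\<close>

definition overlap :: "nat \<Rightarrow> complex mat \<Rightarrow> complex mat \<Rightarrow> nat \<Rightarrow> nat \<Rightarrow> real" where
  "overlap n U V i j = (cmod (inner_col n U i (\<lambda>k. V $$ (k, j))))\<^sup>2"

lemma overlap_nonneg: "0 \<le> overlap n U V i j"
  by (simp add: overlap_def)

text \<open>Every unitary \<open>U\<close> diagonalises the identity with all eigenvalues 1; the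
  quadratic form of the identity, computed in that basis and in the standard one, gives the two
  sides.\<close>

lemma parseval:
  assumes "unitary n U"
  shows "(\<Sum>k<n. (cmod (inner_col n U k f))\<^sup>2) = (\<Sum>i<n. (cmod (f i))\<^sup>2)"
proof -
  have "spectral n (1\<^sub>m n) U (\<lambda>_. 1)"
    using unitaryD[OF assms] assms by (simp add: spectral_def)
  from quad_form_spectral[OF this, of f]
  have "complex_of_real (\<Sum>k<n. (cmod (inner_col n U k f))\<^sup>2) = quad_form n (1\<^sub>m n) f" by simp
  also have "\<dots> = (\<Sum>i<n. \<Sum>j<n. if j = i then cnj (f i) * f i else 0)"
    unfolding quad_form_def by (intro sum.cong refl) auto
  also have "\<dots> = (\<Sum>i<n. f i * cnj (f i))"
    by (intro sum.cong refl) (simp add: mult.commute)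
  also have "\<dots> = complex_of_real (\<Sum>i<n. (cmod (f i))\<^sup>2)"
    by (simp only: of_real_sum complex_norm_square)
  finally show ?thesis by (simp only: of_real_eq_iff)
qed

lemma overlap_sum_left:
  assumes "unitary n U" "unitary n V" "j < n"
  shows "(\<Sum>i<n. overlap n U V i j) = 1"
proof -
  have "complex_of_real (\<Sum>i<n. (cmod (V $$ (i, j)))\<^sup>2) = (\<Sum>i<n. cnj (V $$ (i, j)) * V $$ (i, j))"
    by (simp only: of_real_sum complex_norm_square mult.commute)
  also have "\<dots> = 1" using unitary_columns[OF assms(2,3,3)] by simp
  finally have "(\<Sum>i<n. (cmod (V $$ (i, j)))\<^sup>2) = 1" by (simp only: of_real_eq_1_iff)
  then show ?thesis unfolding overlap_def parseval[OF assms(1)] .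
qed

lemma overlap_commute: "overlap n U V i j = overlap n V U j i"
proof -
  have "inner_col n U i (\<lambda>k. V $$ (k, j)) = cnj (inner_col n V j (\<lambda>k. U $$ (k, i)))"
    by (simp add: inner_col_def mult.commute)
  then show ?thesis by (simp only: overlap_def complex_mod_cnj)
qed

lemma overlap_sum_right:
  assumes "unitary n U" "unitary n V" "i < n"
  shows "(\<Sum>j<n. overlap n U V i j) = 1"
  using overlap_sum_left[OF assms(2,1,3)] by (simp only: overlap_commute[of n V U])

lemma overlap_self:
  assumes "unitary n U" "i < n" "j < n"
  shows "overlap n U U i j = (if i = j then 1 else 0)"
  using unitary_columns[OF assms] by (simp add: overlap_def inner_col_def)

text \<open>The trace is the sum of \<open>f l\<close> times the quadratic form of \<open>X\<close>
  at the \<open>l\<close>-th column of \<open>V\<close>, and \<open>quad_form_spectral\<close>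
  evaluates that form.\<close>

lemma trace_spectral_mult:
  assumes X: "spectral n X U e" and V: "unitary n V"
  shows "mat_trace (X * (V * mat_diag n (\<lambda>k. complex_of_real (f k)) * mat_adjoint V)) =
    complex_of_real (\<Sum>i<n. \<Sum>j<n. overlap n U V i j * (e i * f j))"
proof -
  let ?Y = "V * mat_diag n (\<lambda>k. complex_of_real (f k)) * mat_adjoint V"
  have Xc: "X \<in> carrier_mat n n" by (rule spectral_carrier[OF X])
  have Yc: "?Y \<in> carrier_mat n n"
    by (intro mult_carrier_mat[of _ n n] unitaryD[OF V] mat_diag_dim)
  have "mat_trace (X * ?Y) = (\<Sum>a<n. \<Sum>b<n. X $$ (a, b) * ?Y $$ (b, a))"
    using Xc unfolding mat_trace_def by (simp add: index_mult_mat_sum[OF Xc Yc] del: index_mult_mat(1))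
  also have "\<dots> = (\<Sum>a<n. \<Sum>b<n. \<Sum>l<n. complex_of_real (f l) *
      (cnj (V $$ (a, l)) * X $$ (a, b) * V $$ (b, l)))"
    by (intro sum.cong refl) (simp add: index_spectral[OF V] sum_distrib_left mult_ac del: index_mult_mat(1))
  also have "\<dots> = (\<Sum>a<n. \<Sum>l<n. \<Sum>b<n. complex_of_real (f l) *
      (cnj (V $$ (a, l)) * X $$ (a, b) * V $$ (b, l)))"
    by (intro sum.cong refl sum.swap)
  also have "\<dots> = (\<Sum>l<n. \<Sum>a<n. \<Sum>b<n. complex_of_real (f l) *
      (cnj (V $$ (a, l)) * X $$ (a, b) * V $$ (b, l)))"
    by (rule sum.swap)
  also have "\<dots> = (\<Sum>l<n. complex_of_real (f l) * quad_form n X (\<lambda>a. V $$ (a, l)))"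
    by (simp add: quad_form_def sum_distrib_left)
  also have "\<dots> = complex_of_real (\<Sum>l<n. \<Sum>k<n. overlap n U V k l * (e k * f l))"
    unfolding quad_form_spectral[OF X] overlap_def
    by (simp add: sum_distrib_left mult_ac)
  also have "(\<Sum>l<n. \<Sum>k<n. overlap n U V k l * (e k * f l)) =
      (\<Sum>k<n. \<Sum>l<n. overlap n U V k l * (e k * f l))" by (rule sum.swap)
  finally show ?thesis .
qed

lemma trace_spectral:
  assumes X: "spectral n X U e"
  shows "mat_trace X = complex_of_real (\<Sum>i<n. e i)"
proof -
  note u = unitaryD[OF spectral_unitary[OF X]]
  \<comment> \<open>With all weights 1 the second factor is the identity, so the formula for
    products yields the plain trace.\<close>
  have "X * (U * mat_diag n (\<lambda>k. complex_of_real 1) * mat_adjoint U) = X"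
    using u spectral_carrier[OF X] by simp
  from trace_spectral_mult[OF X spectral_unitary[OF X], of "\<lambda>_. 1", unfolded this]
  show ?thesis
    using overlap_sum_right[OF spectral_unitary[OF X] spectral_unitary[OF X]]
    by (simp add: sum_distrib_right[symmetric])
qed

text \<open>The cross term Tr(rho log sigma). It is linear in the first argument, which
  \<open>qre\<close> is not; the identity for mixtures rests on that.\<close>

definition trace_log :: "complex mat \<Rightarrow> complex mat \<Rightarrow> real" where
  "trace_log \<rho> \<sigma> = Re (mat_trace (\<rho> * mat_log \<sigma>))"

text \<open>The finite branch of \<open>rel_entropy\<close>, as a real number without the support
  test. By ln 0 = 0 it has a value for all positive semidefinite arguments, but it is their relative
  entropy only under domination.\<close>

definition qre :: "complex mat \<Rightarrow> complex mat \<Rightarrow> real" where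
  "qre \<rho> \<sigma> = Re (mat_trace (\<rho> * (mat_log \<rho> - mat_log \<sigma>)))"

lemma qre_trace_log:
  assumes "psd n \<rho>" "psd n \<sigma>"
  shows "qre \<rho> \<sigma> = trace_log \<rho> \<rho> - trace_log \<rho> \<sigma>"
proof -
  note c = psd_carrier[OF assms(1)] mat_log_carrier[OF assms(1)] mat_log_carrier[OF assms(2)]
  have "\<rho> * (mat_log \<rho> - mat_log \<sigma>) = \<rho> * mat_log \<rho> - \<rho> * mat_log \<sigma>"
    by (rule mult_minus_distrib_mat[OF c])
  then show ?thesis
    using mat_trace_minus[of "\<rho> * mat_log \<rho>" n "\<rho> * mat_log \<sigma>"]
      mult_carrier_mat[OF c(1,2)] mult_carrier_mat[OF c(1,3)]
    by (simp add: qre_def trace_log_def)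
qed

lemma trace_log_spectral:
  assumes "spectral n \<rho> U r" "spectral n \<sigma> V s"
  shows "trace_log \<rho> \<sigma> = (\<Sum>i<n. \<Sum>j<n. overlap n U V i j * (r i * ln (s j)))"
  unfolding trace_log_def mat_log_spectral[OF assms(2)]
    trace_spectral_mult[OF assms(1) spectral_unitary[OF assms(2)]] by (rule Re_complex_of_real)

lemma trace_log_self:
  assumes "spectral n \<rho> U r"
  shows "trace_log \<rho> \<rho> = (\<Sum>i<n. r i * ln (r i))"
proof -
  have "trace_log \<rho> \<rho> = (\<Sum>i<n. \<Sum>j<n. if j = i then r i * ln (r i) else 0)"
    unfolding trace_log_spectral[OF assms assms]
    by (intro sum.cong refl) (auto simp: overlap_self[OF spectral_unitary[OF assms]])
  then show ?thesis by simp
qed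

lemma qre_spectral:
  assumes psd: "psd n \<rho>" "psd n \<sigma>" and sp: "spectral n \<rho> U r" "spectral n \<sigma> V s"
  shows "qre \<rho> \<sigma> = (\<Sum>i<n. \<Sum>j<n. overlap n U V i j * (r i * ln (r i) - r i * ln (s j)))"
proof -
  have "(\<Sum>i<n. r i * ln (r i)) = (\<Sum>i<n. \<Sum>j<n. overlap n U V i j * (r i * ln (r i)))"
    using overlap_sum_right[OF spectral_unitary[OF sp(1)] spectral_unitary[OF sp(2)]]
    by (simp add: sum_distrib_right[symmetric])
  then show ?thesis
    unfolding qre_trace_log[OF psd] trace_log_self[OF sp(1)] trace_log_spectral[OF sp]
    by (simp add: right_diff_distrib sum_subtractf)
qed

section \<open>Support inclusion as an operator inequality\<close>

text \<open>For positive semidefinite matrices this is equivalent to the inclusion of supports, but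
  as an inequality linear in both matrices it passes directly to channel outputs and to
  mixtures.\<close>

definition dominated :: "nat \<Rightarrow> complex mat \<Rightarrow> complex mat \<Rightarrow> bool" where
  "dominated n \<rho> \<sigma> \<longleftrightarrow> (\<exists>c. psd n (complex_of_real c \<cdot>\<^sub>m \<sigma> - \<rho>))"

lemma spectral_eigen:
  assumes X: "spectral n X U e" and "a < n" "j < n"
  shows "(\<Sum>b<n. X $$ (a, b) * U $$ (b, j)) = complex_of_real (e j) * U $$ (a, j)"
proof -
  have "(\<Sum>b<n. X $$ (a, b) * U $$ (b, j)) =
      (\<Sum>b<n. \<Sum>k<n. complex_of_real (e k) * U $$ (a, k) * (cnj (U $$ (b, k)) * U $$ (b, j)))"
    using assms(2) by (intro sum.cong refl) (simp add: spectral_index[OF X] sum_distrib_left sum_distrib_right mult_ac)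
  also have "\<dots> = (\<Sum>k<n. complex_of_real (e k) * U $$ (a, k) * (\<Sum>b<n. cnj (U $$ (b, k)) * U $$ (b, j)))"
    unfolding sum_distrib_left by (rule sum.swap)
  also have "\<dots> = (\<Sum>k<n. if k = j then complex_of_real (e j) * U $$ (a, j) else 0)"
    using assms(3) by (intro sum.cong refl) (simp add: unitary_columns[OF spectral_unitary[OF X]])
  finally show ?thesis using assms(3) by simp
qed

lemma inner_col_mult_spectral:
  assumes X: "spectral n X U e" and "i < n"
  shows "inner_col n U i (\<lambda>a. \<Sum>b<n. X $$ (a, b) * f b) = complex_of_real (e i) * inner_col n U i f"
proof -
  have "inner_col n U i (\<lambda>a. \<Sum>b<n. X $$ (a, b) * f b) =
      (\<Sum>a<n. \<Sum>b<n. \<Sum>k<n. complex_of_real (e k) * (cnj (U $$ (a, i)) * U $$ (a, k)) * (cnj (U $$ (b, k)) * f b))"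
    unfolding inner_col_def sum_distrib_left
    by (intro sum.cong refl)
      (simp add: spectral_index[OF X] sum_distrib_left sum_distrib_right mult_ac)
  also have "\<dots> = (\<Sum>a<n. \<Sum>k<n. \<Sum>b<n. complex_of_real (e k) * (cnj (U $$ (a, i)) * U $$ (a, k)) * (cnj (U $$ (b, k)) * f b))"
    by (intro sum.cong refl sum.swap)
  also have "\<dots> = (\<Sum>k<n. \<Sum>a<n. \<Sum>b<n. complex_of_real (e k) * (cnj (U $$ (a, i)) * U $$ (a, k)) * (cnj (U $$ (b, k)) * f b))"
    by (rule sum.swap)
  also have "\<dots> = (\<Sum>k<n. complex_of_real (e k) * (\<Sum>a<n. cnj (U $$ (a, i)) * U $$ (a, k)) * inner_col n U k f)"
    unfolding inner_col_def sum_distrib_left sum_distrib_right by (intro sum.cong refl sum.swap)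
  also have "\<dots> = (\<Sum>k<n. if k = i then complex_of_real (e i) * inner_col n U i f else 0)"
    using assms(2) by (intro sum.cong refl) (simp add: unitary_columns[OF spectral_unitary[OF X]])
  finally show ?thesis using assms(2) by simp
qed

text \<open>In an eigenbasis the form is a sum of nonnegative terms, so each product of an
  eigenvalue and a coefficient of \<open>f\<close> vanishes. These products are the coefficients of
  \<open>X\<close> applied to \<open>f\<close>, which is zero by Parseval.\<close>

lemma psd_quad_form_eq_0:
  assumes psd: "psd n X" and q: "quad_form n X f = 0" and a: "a < n"
  shows "(\<Sum>b<n. X $$ (a, b) * f b) = 0"
proof -
  obtain U e where s: "spectral n X U e" and e: "\<And>k. k < n \<Longrightarrow> 0 \<le> e k"
    using psd_spectral[OF psd] by blast
  have "(\<Sum>k<n. e k * (cmod (inner_col n U k f))\<^sup>2) = 0"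
    using q unfolding quad_form_spectral[OF s] by (simp only: of_real_eq_0_iff)
  then have "\<forall>k\<in>{..<n}. e k * (cmod (inner_col n U k f))\<^sup>2 = 0"
    using e by (subst (asm) sum_nonneg_eq_0_iff) auto
  then have z: "complex_of_real (e k) * inner_col n U k f = 0" if "k < n" for k
    using that by auto
  have "(\<Sum>i<n. (cmod (\<Sum>b<n. X $$ (i, b) * f b))\<^sup>2) =
      (\<Sum>k<n. (cmod (inner_col n U k (\<lambda>i. \<Sum>b<n. X $$ (i, b) * f b)))\<^sup>2)"
    by (rule parseval[OF spectral_unitary[OF s], symmetric])
  also have "\<dots> = 0"
    by (intro sum.neutral ballI) (simp add: inner_col_mult_spectral[OF s] z del: mult_eq_0_iff)
  finally have "\<forall>i\<in>{..<n}. (cmod (\<Sum>b<n. X $$ (i, b) * f b))\<^sup>2 = 0"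
    by (subst (asm) sum_nonneg_eq_0_iff) auto
  then show ?thesis using a by simp
qed

text \<open>The inequality squeezes the form of \<open>\<rho>\<close> to zero on the kernel of
  \<open>\<sigma>\<close>. Hence the kernel of \<open>\<sigma>\<close> lies in that of
  \<open>\<rho>\<close>, and orthogonal complements reverse the inclusion.\<close>

lemma dominated_imp_supp_subset:
  assumes psd: "psd n \<rho>" "psd n \<sigma>" and dom: "dominated n \<rho> \<sigma>"
  shows "supp \<rho> \<subseteq> supp \<sigma>"
proof -
  note c = psd_carrier[OF psd(1)] psd_carrier[OF psd(2)]
  obtain t where t: "psd n (complex_of_real t \<cdot>\<^sub>m \<sigma> - \<rho>)" using dom by (auto simp: dominated_def)
  have "w \<in> mat_kernel \<rho>" if "w \<in> mat_kernel \<sigma>" for w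
  proof -
    have w: "w \<in> carrier_vec n" "\<sigma> *\<^sub>v w = 0\<^sub>v n" using that c by (auto simp: mat_kernel_def)
    have "quad_form n \<sigma> (\<lambda>i. w $ i) = (\<sigma> *\<^sub>v w) \<bullet>c w"
      by (rule inner_mult_vec_eq_quad_form[OF c(2) w(1), symmetric])
    then have "quad_form n \<sigma> (\<lambda>i. w $ i) = 0" using w by simp
    moreover have "0 \<le> quad_form n (complex_of_real t \<cdot>\<^sub>m \<sigma> - \<rho>) (\<lambda>i. w $ i)"
      by (rule psd_quad_form[OF t])
    ultimately have "quad_form n \<rho> (\<lambda>i. w $ i) \<le> 0"
      using c by (simp add: quad_form_minus quad_form_smult)
    then have "quad_form n \<rho> (\<lambda>i. w $ i) = 0"
      using psd_quad_form[OF psd(1), of "\<lambda>i. w $ i"] by (rule antisym)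
    from psd_quad_form_eq_0[OF psd(1) this] have "\<rho> *\<^sub>v w = 0\<^sub>v n"
      using c w by (intro eq_vecI) (auto simp: scalar_prod_def atLeast0LessThan)
    then show ?thesis using c w by (auto simp: mat_kernel_def)
  qed
  then show ?thesis using c by (auto simp: supp_def)
qed

text \<open>No double orthogonal complement is taken: \<open>\<rho> *\<^sub>v w\<close> lies in the
  support of \<open>\<rho>\<close> because \<open>\<rho>\<close> is Hermitian, hence in that of
  \<open>\<sigma>\<close>, hence it is orthogonal to the kernel vector \<open>w\<close> itself. So
  the form of \<open>\<rho>\<close> vanishes at \<open>w\<close>.\<close>

lemma supp_subset_imp_mult_eq_0:
  assumes psd: "psd n \<rho>" "psd n \<sigma>" and sub: "supp \<rho> \<subseteq> supp \<sigma>"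
    and w: "w \<in> carrier_vec n" "\<sigma> *\<^sub>v w = 0\<^sub>v n" and a: "a < n"
  shows "(\<Sum>b<n. \<rho> $$ (a, b) * w $ b) = 0"
proof -
  note c = psd_carrier[OF psd(1)] psd_carrier[OF psd(2)]
  have idx: "(\<rho> *\<^sub>v u) $ i = (\<Sum>b<n. \<rho> $$ (i, b) * u $ b)" if "i < n" "u \<in> carrier_vec n" for i u
    using that c by (auto simp: scalar_prod_def atLeast0LessThan)
  have herm: "\<rho> $$ (i, j) = cnj (\<rho> $$ (j, i))" if "i < n" "j < n" for i j
    using index_mat_adjoint[OF c(1) that] psd_hermitian[OF psd(1)] by simp
  have "\<rho> *\<^sub>v w \<in> supp \<rho>"
    unfolding supp_def
  proof (intro CollectI conjI ballI)
    show "\<rho> *\<^sub>v w \<in> carrier_vec (dim_row \<rho>)"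
      using c by (intro carrier_vecI) auto
    fix u assume "u \<in> mat_kernel \<rho>"
    then have u: "u \<in> carrier_vec n" "\<rho> *\<^sub>v u = 0\<^sub>v n" using c by (auto simp: mat_kernel_def)
    have u0: "(\<Sum>b<n. \<rho> $$ (i, b) * u $ b) = 0" if "i < n" for i
      using arg_cong[OF u(2), of "\<lambda>x. x $ i"] idx[OF that u(1)] that by simp
    have "(\<rho> *\<^sub>v w) \<bullet>c u = (\<Sum>i<n. (\<rho> *\<^sub>v w) $ i * cnj (u $ i))"
      using u(1) by (auto simp: scalar_prod_def atLeast0LessThan intro!: sum.cong)
    also have "\<dots> = (\<Sum>i<n. \<Sum>b<n. w $ b * (cnj (\<rho> $$ (b, i)) * cnj (u $ i)))"
      using w(1) by (intro sum.cong refl) 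
        (simp only: lessThan_iff idx sum_distrib_right, intro sum.cong refl, simp add: herm[symmetric] mult_ac)
    also have "\<dots> = (\<Sum>b<n. w $ b * cnj (\<Sum>i<n. \<rho> $$ (b, i) * u $ i))"
      by (subst sum.swap) (simp add: sum_distrib_left)
    also have "\<dots> = 0" using u0 by simp
    finally show "(\<rho> *\<^sub>v w) \<bullet>c u = 0" .
  qed
  moreover have "w \<in> mat_kernel \<sigma>" using w c by (auto simp: mat_kernel_def)
  ultimately have "(\<rho> *\<^sub>v w) \<bullet>c w = 0" using sub by (auto simp: supp_def)
  then have "quad_form n \<rho> (\<lambda>i. w $ i) = 0" using inner_mult_vec_eq_quad_form[OF c(1) w(1)] by simp
  from psd_quad_form_eq_0[OF psd(1) this a] show ?thesis .
qed

text \<open>Cauchy-Schwarz against the all-one vector. The slack added by the induction step is the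
  sum of the squares of \<open>x i - x n\<close>.\<close>

lemma sum_power2_le:
  fixes x :: "nat \<Rightarrow> real"
  shows "(\<Sum>i<n. x i)\<^sup>2 \<le> real n * (\<Sum>i<n. (x i)\<^sup>2)"
proof (induction n)
  case (Suc n)
  let ?S = "\<Sum>i<n. x i" and ?Q = "\<Sum>i<n. (x i)\<^sup>2"
  have "0 \<le> (\<Sum>i<n. (x i - x n)\<^sup>2)" by (intro sum_nonneg) simp
  also have "\<dots> = (\<Sum>i<n. (x i)\<^sup>2 + (x n)\<^sup>2 - 2 * x n * x i)"
    by (intro sum.cong refl) (simp add: power2_diff mult_ac)
  also have "\<dots> = ?Q + real n * (x n)\<^sup>2 - 2 * x n * ?S"
    by (simp add: sum.distrib sum_subtractf sum_distrib_left)
  finally show ?case using Suc.IH by (simp add: power2_sum algebra_simps)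
qed simp

text \<open>Each coefficient in the eigenbasis of \<open>\<rho>\<close> is expanded in that of
  \<open>\<sigma>\<close>, and Cauchy-Schwarz bounds the form of \<open>\<rho>\<close> by a multiple
  of the form of \<open>\<sigma>\<close>. Eigenvectors of \<open>\<sigma>\<close> with eigenvalue 0
  drop out because \<open>\<rho>\<close> annihilates them.\<close>

lemma supp_subset_imp_dominated:
  assumes psd: "psd n \<rho>" "psd n \<sigma>" and sub: "supp \<rho> \<subseteq> supp \<sigma>"
  shows "dominated n \<rho> \<sigma>"
proof -
  note car = psd_carrier[OF psd(1)] psd_carrier[OF psd(2)]
  obtain U r where sr: "spectral n \<rho> U r" and r: "\<And>k. k < n \<Longrightarrow> 0 \<le> r k"
    using psd_spectral[OF psd(1)] by blast
  obtain V s where ss: "spectral n \<sigma> V s" and s: "\<And>k. k < n \<Longrightarrow> 0 \<le> s k"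
    using psd_spectral[OF psd(2)] by blast
  note uV = spectral_unitary[OF ss] and uU = spectral_unitary[OF sr]
  define d where "d i j = inner_col n U i (\<lambda>k. V $$ (k, j))" for i j
  have d0: "complex_of_real (r i) * d i j = 0" if ij: "i < n" "j < n" and sj: "s j = 0" for i j
  proof -
    let ?w = "vec n (\<lambda>k. V $$ (k, j))"
    have "\<sigma> *\<^sub>v ?w = 0\<^sub>v n"
      using car spectral_eigen[OF ss _ ij(2)] sj
      by (intro eq_vecI) (auto simp: scalar_prod_def atLeast0LessThan)
    from supp_subset_imp_mult_eq_0[OF psd sub _ this]
    have "(\<Sum>b<n. \<rho> $$ (a, b) * V $$ (b, j)) = 0" if "a < n" for a using that by simp
    then have "inner_col n U i (\<lambda>a. \<Sum>b<n. \<rho> $$ (a, b) * V $$ (b, j)) = 0" by (simp add: inner_col_def)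
    then show ?thesis unfolding inner_col_mult_spectral[OF sr ij(1)] d_def .
  qed
  \<comment> \<open>Dividing by \<open>s j\<close> pays for the factor \<open>s j\<close> that the
    form of \<open>\<sigma>\<close> requires. For \<open>s j = 0\<close> the quotient is 0 by
    convention, in agreement with \<open>d0\<close>: the corresponding summand vanishes
    anyway.\<close>
  define K where "K = (\<Sum>i<n. \<Sum>j<n. r i * ((cmod (d i j))\<^sup>2 / s j))"
  have le: "(\<Sum>i<n. r i * (cmod (inner_col n U i f))\<^sup>2) \<le>
      real n * K * (\<Sum>j<n. s j * (cmod (inner_col n V j f))\<^sup>2)" for f
  proof -
    let ?a = "\<lambda>j. inner_col n V j f"
    have exp: "inner_col n U i f = (\<Sum>j<n. ?a j * d i j)" for i
    proof -
      have "(\<Sum>j<n. ?a j * d i j) = (\<Sum>j<n. \<Sum>k<n. \<Sum>l<n. cnj (U $$ (k, i)) * f l * (V $$ (k, j) * cnj (V $$ (l, j))))"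
        unfolding d_def inner_col_def sum_product
        by (subst sum.swap) (simp add: sum_distrib_left sum_distrib_right mult_ac)
      also have "\<dots> = (\<Sum>k<n. \<Sum>j<n. \<Sum>l<n. cnj (U $$ (k, i)) * f l * (V $$ (k, j) * cnj (V $$ (l, j))))"
        by (rule sum.swap)
      also have "\<dots> = (\<Sum>k<n. \<Sum>l<n. \<Sum>j<n. cnj (U $$ (k, i)) * f l * (V $$ (k, j) * cnj (V $$ (l, j))))"
        by (intro sum.cong refl sum.swap)
      also have "\<dots> = (\<Sum>k<n. \<Sum>l<n. if l = k then cnj (U $$ (k, i)) * f k else 0)"
        unfolding sum_distrib_left[symmetric]
        by (intro sum.cong refl) (auto simp: unitary_rows[OF uV])
      finally show ?thesis by (simp add: inner_col_def)
    qed
    have "r i * (cmod (inner_col n U i f))\<^sup>2 \<le>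
        (\<Sum>j<n. real n * (r i * ((cmod (d i j))\<^sup>2 / s j) * (s j * (cmod (?a j))\<^sup>2)))" if i: "i < n" for i
    proof -
      have "(cmod (inner_col n U i f))\<^sup>2 \<le> (\<Sum>j<n. cmod (?a j) * cmod (d i j))\<^sup>2"
        unfolding exp by (intro power_mono order.trans[OF norm_sum] sum_mono) (auto simp: norm_mult)
      also have "\<dots> \<le> real n * (\<Sum>j<n. (cmod (?a j) * cmod (d i j))\<^sup>2)" by (rule sum_power2_le)
      finally have "r i * (cmod (inner_col n U i f))\<^sup>2 \<le> r i * (real n * (\<Sum>j<n. (cmod (?a j) * cmod (d i j))\<^sup>2))"
        using r[OF i] by (intro mult_left_mono)
      also have "\<dots> = (\<Sum>j<n. real n * (r i * ((cmod (d i j))\<^sup>2 / s j) * (s j * (cmod (?a j))\<^sup>2)))"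
        unfolding sum_distrib_left
      proof (intro sum.cong refl)
        fix j assume j: "j \<in> {..<n}"
        show "r i * (real n * (cmod (?a j) * cmod (d i j))\<^sup>2) =
            real n * (r i * ((cmod (d i j))\<^sup>2 / s j) * (s j * (cmod (?a j))\<^sup>2))"
          using d0[OF i, of j] j by (cases "s j = 0") (auto simp: power_mult_distrib)
      qed
      finally show ?thesis .
    qed
    then have "(\<Sum>i<n. r i * (cmod (inner_col n U i f))\<^sup>2) \<le>
        (\<Sum>i<n. \<Sum>j<n. real n * (r i * ((cmod (d i j))\<^sup>2 / s j) * (s j * (cmod (?a j))\<^sup>2)))"
      by (intro sum_mono) auto
    \<comment> \<open>A single weight is at most the sum of all of them; this decouples the index
      \<open>j\<close> and leaves the constant \<open>K\<close>.\<close>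
    also have "\<dots> \<le> (\<Sum>i<n. \<Sum>j<n. real n * (r i * ((cmod (d i j))\<^sup>2 / s j) *
        (\<Sum>l<n. s l * (cmod (?a l))\<^sup>2)))"
      using r s by (intro sum_mono mult_left_mono member_le_sum mult_nonneg_nonneg) auto
    also have "\<dots> = real n * K * (\<Sum>l<n. s l * (cmod (?a l))\<^sup>2)"
      unfolding K_def sum_distrib_left[of "real n"] sum_distrib_right by (simp add: mult_ac)
    finally show ?thesis .
  qed
  have "psd n (complex_of_real (real n * K) \<cdot>\<^sub>m \<sigma> - \<rho>)"
  proof (rule psdI)
    show "complex_of_real (real n * K) \<cdot>\<^sub>m \<sigma> - \<rho> \<in> carrier_mat n n" using car by auto
    fix f
    have "quad_form n (complex_of_real (real n * K) \<cdot>\<^sub>m \<sigma> - \<rho>) f =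
      complex_of_real (real n * K * (\<Sum>j<n. s j * (cmod (inner_col n V j f))\<^sup>2) -
        (\<Sum>i<n. r i * (cmod (inner_col n U i f))\<^sup>2))"
      using car by (simp only: quad_form_minus[OF smult_carrier_mat] quad_form_smult
          quad_form_spectral[OF sr] quad_form_spectral[OF ss] of_real_mult of_real_diff)
    then show "0 \<le> quad_form n (complex_of_real (real n * K) \<cdot>\<^sub>m \<sigma> - \<rho>) f"
      using le[of f] by (simp only: complex_of_real_nonneg_iff)
  qed
  then show ?thesis unfolding dominated_def by blast
qed

section \<open>Relative entropy along a segment and for direct sums\<close>

text \<open>Domination is tested at the \<open>j\<close>-th eigenvector of \<open>\<sigma>\<close>,
  where the form of \<open>\<sigma>\<close> is zero. This makes the value ln 0 = 0 harmless: every
  term with \<open>s j = 0\<close> has the factor \<open>overlap n U V i j\<close> or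
  \<open>r i\<close> equal to zero.\<close>

lemma spectral_dominated_overlap:
  assumes psd: "psd n \<rho>" and sp: "spectral n \<rho> U r" "spectral n \<sigma> V s"
    and dom: "dominated n \<rho> \<sigma>" and ij: "i < n" "j < n" and sj: "s j = 0"
  shows "overlap n U V i j = 0 \<or> r i = 0"
proof -
  note car = spectral_carrier[OF sp(1)] spectral_carrier[OF sp(2)]
  let ?f = "\<lambda>k. V $$ (k, j)"
  obtain c where c: "psd n (complex_of_real c \<cdot>\<^sub>m \<sigma> - \<rho>)" using dom by (auto simp: dominated_def)
  have "quad_form n \<sigma> ?f = complex_of_real (\<Sum>k<n. s k * overlap n V V k j)"
    unfolding quad_form_spectral[OF sp(2)] overlap_def ..
  also have "(\<Sum>k<n. s k * overlap n V V k j) = 0"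
    using ij sj by (intro sum.neutral) (auto simp: overlap_self[OF spectral_unitary[OF sp(2)]])
  finally have "quad_form n \<rho> ?f \<le> 0"
    using psd_quad_form[OF c, of ?f] car by (simp add: quad_form_minus quad_form_smult)
  then have "complex_of_real (\<Sum>k<n. r k * overlap n U V k j) \<le> complex_of_real 0"
    unfolding quad_form_spectral[OF sp(1)] overlap_def by simp
  then have "(\<Sum>k<n. r k * overlap n U V k j) \<le> 0" by (simp only: less_eq_complex_def Re_complex_of_real)
  moreover have nn: "\<forall>k\<in>{..<n}. 0 \<le> r k * overlap n U V k j"
    using psd_spectral_nonneg[OF psd sp(1)] by (auto intro!: mult_nonneg_nonneg overlap_nonneg)
  moreover from nn have "0 \<le> (\<Sum>k<n. r k * overlap n U V k j)" by (intro sum_nonneg) auto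
  ultimately have "(\<Sum>k<n. r k * overlap n U V k j) = 0" by linarith
  then have "\<forall>k\<in>{..<n}. r k * overlap n U V k j = 0"
    using nn by (subst (asm) sum_nonneg_eq_0_iff) auto
  then show ?thesis using ij by auto
qed

text \<open>Both come from ln t <= t - 1, at t = y / x and at t = x / y. The first yields
  nonnegativity of the relative entropy, the second its chi-square bound.\<close>

lemma mult_ln_bounds:
  fixes x y :: real
  assumes "0 \<le> x" "0 < y"
  shows "x - y \<le> x * ln x - x * ln y" "x * ln x - x * ln y \<le> (x - y) + (x - y)\<^sup>2 / y"
proof -
  show "x - y \<le> x * ln x - x * ln y"
  proof (cases "x = 0")
    case False
    then have x: "x > 0" using assms by simp
    have "x * ln (y / x) \<le> x * (y / x - 1)"
      using x assms by (intro mult_left_mono ln_le_minus_one) auto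
    then show ?thesis using x assms by (simp add: ln_div algebra_simps)
  qed (use assms in simp)
  show "x * ln x - x * ln y \<le> (x - y) + (x - y)\<^sup>2 / y"
  proof (cases "x = 0")
    case False
    then have x: "x > 0" using assms by simp
    have "x * ln (x / y) \<le> x * (x / y - 1)"
      using x assms by (intro mult_left_mono ln_le_minus_one) auto
    also have "\<dots> = (x - y) + (x - y)\<^sup>2 / y"
      using assms by (simp add: field_simps power2_eq_square)
    finally show ?thesis using x assms by (simp add: ln_div algebra_simps)
  qed (use assms in \<open>simp add: power2_eq_square\<close>)
qed

text \<open>Rows and columns of \<open>overlap\<close> sum to one, so the linear terms of both
  scalar bounds add up to a difference of traces and disappear.\<close>

lemma sum_overlap_diff:
  assumes "unitary n U" "unitary n V" "(\<Sum>i<n. r i) = (\<Sum>j<n. s j)"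
  shows "(\<Sum>i<n. \<Sum>j<n. overlap n U V i j * (r i - s j)) = 0"
proof -
  have "(\<Sum>i<n. \<Sum>j<n. overlap n U V i j * r i) = (\<Sum>i<n. r i)"
    by (simp add: sum_distrib_right[symmetric] overlap_sum_right[OF assms(1,2)])
  moreover have "(\<Sum>i<n. \<Sum>j<n. overlap n U V i j * s j) = (\<Sum>j<n. s j)"
    by (subst sum.swap) (simp add: sum_distrib_right[symmetric] overlap_sum_left[OF assms(1,2)])
  ultimately show ?thesis using assms(3) by (simp add: right_diff_distrib sum_subtractf)
qed

lemma spectral_trace_eq:
  assumes "spectral n \<rho> U r" "spectral n \<sigma> V s" "mat_trace \<rho> = mat_trace \<sigma>"
  shows "(\<Sum>i<n. r i) = (\<Sum>j<n. s j)"
  using assms(3) unfolding trace_spectral[OF assms(1)] trace_spectral[OF assms(2)] by (simp only: of_real_eq_iff)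

text \<open>Klein's inequality: the lower scalar bound is summed with the weights
  \<open>overlap\<close>.\<close>

lemma qre_nonneg:
  assumes psd: "psd n \<rho>" "psd n \<sigma>" and dom: "dominated n \<rho> \<sigma>" and tr: "mat_trace \<rho> = mat_trace \<sigma>"
  shows "0 \<le> qre \<rho> \<sigma>"
proof -
  obtain U r where sr: "spectral n \<rho> U r" and r: "\<And>k. k < n \<Longrightarrow> 0 \<le> r k"
    using psd_spectral[OF psd(1)] by blast
  obtain V s where ss: "spectral n \<sigma> V s" and s: "\<And>k. k < n \<Longrightarrow> 0 \<le> s k"
    using psd_spectral[OF psd(2)] by blast
  have "0 = (\<Sum>i<n. \<Sum>j<n. overlap n U V i j * (r i - s j))"
    by (rule sum_overlap_diff[symmetric])
      (rule spectral_unitary[OF sr] spectral_unitary[OF ss] spectral_trace_eq[OF sr ss tr])+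
  also have "\<dots> \<le> (\<Sum>i<n. \<Sum>j<n. overlap n U V i j * (r i * ln (r i) - r i * ln (s j)))"
  proof (intro sum_mono)
    fix i j assume "i \<in> {..<n}" "j \<in> {..<n}"
    then have ij: "i < n" "j < n" by auto
    show "overlap n U V i j * (r i - s j) \<le> overlap n U V i j * (r i * ln (r i) - r i * ln (s j))"
    proof (cases "s j = 0")
      case True
      then show ?thesis using spectral_dominated_overlap[OF psd(1) sr ss dom ij] by auto
    next
      case False
      then show ?thesis
        using mult_ln_bounds(1)[OF r[OF ij(1)], of "s j"] s[OF ij(2)]
        by (intro mult_left_mono overlap_nonneg) auto
    qed
  qed
  also have "\<dots> = qre \<rho> \<sigma>" by (rule qre_spectral[OF psd sr ss, symmetric])
  finally show ?thesis .
qed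

text \<open>In the eigenbases \<open>u i\<close> of \<open>\<rho>\<close> and \<open>v j\<close> of \<open>\<sigma>\<close> the relative entropy is the classical one of the
  weights \<open>r i * |<u i, v j>|\<^sup>2\<close> and \<open>s j * |<u i, v j>|\<^sup>2\<close>, and
  \<open>(r i - s j) * <u i, v j> = <u i, (\<rho> - \<sigma>) (v j)>\<close>. By Parseval the resulting bound does not depend on
  the eigenbasis of \<open>\<rho>\<close>, which makes it uniform along a segment that ends in \<open>\<sigma>\<close>.\<close>

lemma qre_le_chi_square:
  assumes psd: "psd n \<rho>" "psd n \<sigma>" and dom: "dominated n \<rho> \<sigma>" and tr: "mat_trace \<rho> = mat_trace \<sigma>"
    and ss: "spectral n \<sigma> V s"
  shows "qre \<rho> \<sigma> \<le> (\<Sum>j<n. (\<Sum>a<n. (cmod (\<Sum>b<n. (\<rho> $$ (a, b) - \<sigma> $$ (a, b)) * V $$ (b, j)))\<^sup>2) / s j)"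
proof -
  obtain U r where sr: "spectral n \<rho> U r" and r: "\<And>k. k < n \<Longrightarrow> 0 \<le> r k"
    using psd_spectral[OF psd(1)] by blast
  have s: "\<And>k. k < n \<Longrightarrow> 0 \<le> s k" by (rule psd_spectral_nonneg[OF psd(2) ss])
  let ?d = "\<lambda>j a. \<Sum>b<n. (\<rho> $$ (a, b) - \<sigma> $$ (a, b)) * V $$ (b, j)"
  have diff: "overlap n U V i j * (r i - s j)\<^sup>2 = (cmod (inner_col n U i (?d j)))\<^sup>2" if ij: "i < n" "j < n" for i j
  proof -
    have "inner_col n U i (?d j) = inner_col n U i (\<lambda>a. \<Sum>b<n. \<rho> $$ (a, b) * V $$ (b, j)) -
        inner_col n U i (\<lambda>a. \<Sum>b<n. \<sigma> $$ (a, b) * V $$ (b, j))"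
      by (simp add: inner_col_def left_diff_distrib right_diff_distrib sum_subtractf)
    also have "inner_col n U i (\<lambda>a. \<Sum>b<n. \<sigma> $$ (a, b) * V $$ (b, j)) =
        complex_of_real (s j) * inner_col n U i (\<lambda>a. V $$ (a, j))"
      by (simp add: inner_col_def sum_distrib_left[of "complex_of_real (s j)"]
          spectral_eigen[OF ss _ ij(2)] mult.left_commute)
    finally have "inner_col n U i (?d j) =
        complex_of_real (r i - s j) * inner_col n U i (\<lambda>a. V $$ (a, j))"
      by (simp add: inner_col_mult_spectral[OF sr ij(1)] left_diff_distrib)
    then show ?thesis by (simp only: overlap_def norm_mult power_mult_distrib norm_of_real power2_abs mult.commute)
  qed
  have "qre \<rho> \<sigma> = (\<Sum>i<n. \<Sum>j<n. overlap n U V i j * (r i * ln (r i) - r i * ln (s j)))"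
    by (rule qre_spectral[OF psd sr ss])
  also have "\<dots> \<le> (\<Sum>i<n. \<Sum>j<n. overlap n U V i j * (r i - s j) + overlap n U V i j * (r i - s j)\<^sup>2 / s j)"
  proof (intro sum_mono)
    fix i j assume "i \<in> {..<n}" "j \<in> {..<n}"
    then have ij: "i < n" "j < n" by auto
    show "overlap n U V i j * (r i * ln (r i) - r i * ln (s j)) \<le>
        overlap n U V i j * (r i - s j) + overlap n U V i j * (r i - s j)\<^sup>2 / s j"
    proof (cases "s j = 0")
      case True
      then show ?thesis using spectral_dominated_overlap[OF psd(1) sr ss dom ij] by auto
    next
      case False
      then have "overlap n U V i j * (r i * ln (r i) - r i * ln (s j)) \<le>
          overlap n U V i j * ((r i - s j) + (r i - s j)\<^sup>2 / s j)"
        using mult_ln_bounds(2)[OF r[OF ij(1)], of "s j"] s[OF ij(2)]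
        by (intro mult_left_mono overlap_nonneg) auto
      then show ?thesis by (simp add: distrib_left)
    qed
  qed
  \<comment> \<open>Equal traces cancel the linear terms. Only terms of second order in the
    difference of the states remain, which is where the factor p^2 comes from.\<close>
  also have "\<dots> = (\<Sum>i<n. \<Sum>j<n. overlap n U V i j * (r i - s j)\<^sup>2 / s j)"
    using sum_overlap_diff[OF spectral_unitary[OF sr] spectral_unitary[OF ss] spectral_trace_eq[OF sr ss tr]]
    by (simp add: sum.distrib)
  also have "\<dots> = (\<Sum>j<n. \<Sum>i<n. (cmod (inner_col n U i (?d j)))\<^sup>2 / s j)"
    by (subst sum.swap) (simp add: diff)
  also have "\<dots> = (\<Sum>j<n. (\<Sum>a<n. (cmod (?d j a))\<^sup>2) / s j)"
    unfolding sum_divide_distrib[symmetric] parseval[OF spectral_unitary[OF sr]] ..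
  finally show ?thesis .
qed

section \<open>Mixtures and the Holevo information of a binary ensemble\<close>

definition mix :: "real \<Rightarrow> complex mat \<Rightarrow> complex mat \<Rightarrow> complex mat" where
  "mix p \<rho> \<sigma> = complex_of_real p \<cdot>\<^sub>m \<rho> + complex_of_real (1 - p) \<cdot>\<^sub>m \<sigma>"

lemma mix_carrier:
  assumes "\<rho> \<in> carrier_mat n n" "\<sigma> \<in> carrier_mat n n"
  shows "mix p \<rho> \<sigma> \<in> carrier_mat n n"
  using assms by (simp add: mix_def)

lemma index_mix:
  assumes "\<rho> \<in> carrier_mat n n" "\<sigma> \<in> carrier_mat n n" "i < n" "j < n"
  shows "mix p \<rho> \<sigma> $$ (i, j) = complex_of_real p * \<rho> $$ (i, j) + complex_of_real (1 - p) * \<sigma> $$ (i, j)"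
  using assms by (simp add: mix_def)

lemma psd_mix:
  assumes "psd n \<rho>" "psd n \<sigma>" "0 \<le> p" "p \<le> 1"
  shows "psd n (mix p \<rho> \<sigma>)"
  unfolding mix_def using assms by (intro psd_add psd_smult) auto

lemma mat_trace_mix:
  assumes "\<rho> \<in> carrier_mat n n" "\<sigma> \<in> carrier_mat n n"
  shows "mat_trace (mix p \<rho> \<sigma>) = complex_of_real p * mat_trace \<rho> + complex_of_real (1 - p) * mat_trace \<sigma>"
  using assms by (simp add: mix_def mat_trace_add[of _ n] mat_trace_smult[of _ n])

lemma trace_log_mix:
  assumes "\<rho> \<in> carrier_mat n n" "\<sigma> \<in> carrier_mat n n" "psd n \<tau>"
  shows "trace_log (mix p \<rho> \<sigma>) \<tau> = p * trace_log \<rho> \<tau> + (1 - p) * trace_log \<sigma> \<tau>"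
proof -
  note L = mat_log_carrier[OF assms(3)]
  note c = mult_carrier_mat[OF assms(1) L] mult_carrier_mat[OF assms(2) L]
  have "mix p \<rho> \<sigma> * mat_log \<tau> =
      complex_of_real p \<cdot>\<^sub>m (\<rho> * mat_log \<tau>) + complex_of_real (1 - p) \<cdot>\<^sub>m (\<sigma> * mat_log \<tau>)"
    unfolding mix_def using assms(1,2) L
    by (simp add: add_mult_distrib_mat[of _ n n _ _ n] mult_smult_assoc_mat[of _ n n _ n])
  then show ?thesis using c
    by (simp add: trace_log_def mat_trace_add[of _ n] mat_trace_smult[of _ n])
qed

text \<open>The Holevo information of the ensemble with \<open>\<rho>\<close> at probability
  \<open>p\<close> and \<open>\<sigma>\<close> at probability \<open>1 - p\<close>: the mutual
  information between the bit and the system, as a real number.\<close>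

definition mix_info :: "real \<Rightarrow> complex mat \<Rightarrow> complex mat \<Rightarrow> real" where
  "mix_info p \<rho> \<sigma> = p * qre \<rho> (mix p \<rho> \<sigma>) + (1 - p) * qre \<sigma> (mix p \<rho> \<sigma>)"

text \<open>Donald's identity with \<open>\<sigma>\<close> as reference. Linearity of
  \<open>trace_log\<close> in the first argument makes it purely algebraic: the cross terms with the
  mixture combine to \<open>trace_log\<close> of the mixture with itself, and the terms
  \<open>trace_log \<rho> \<sigma>\<close> cancel.\<close>

lemma mix_info_eq:
  assumes "psd n \<rho>" "psd n \<sigma>" "0 \<le> p" "p \<le> 1"
  shows "mix_info p \<rho> \<sigma> = p * qre \<rho> \<sigma> - qre (mix p \<rho> \<sigma>) \<sigma>"
proof -
  note m = psd_mix[OF assms] and c = psd_carrier[OF assms(1)] psd_carrier[OF assms(2)]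
  show ?thesis
    unfolding mix_info_def qre_trace_log[OF assms(1) m] qre_trace_log[OF assms(2) m]
      qre_trace_log[OF assms(1,2)] qre_trace_log[OF m assms(2)]
      trace_log_mix[OF c m] trace_log_mix[OF c assms(2)]
    by (simp add: algebra_simps)
qed

text \<open>After division by \<open>p\<close> the defect in \<open>mix_info_eq\<close> lies between
  0 and \<open>p * C\<close>, by \<open>qre_nonneg\<close> and
  \<open>qre_le_chi_square\<close>.\<close>

lemma mix_info_limit:
  assumes psd: "psd n \<rho>" "psd n \<sigma>" and dom: "dominated n \<rho> \<sigma>" and tr: "mat_trace \<rho> = mat_trace \<sigma>"
  shows "((\<lambda>p. mix_info p \<rho> \<sigma> / p) \<longlongrightarrow> qre \<rho> \<sigma>) (at_right 0)"
proof -
  note c = psd_carrier[OF psd(1)] psd_carrier[OF psd(2)]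
  obtain V s where ss: "spectral n \<sigma> V s" using psd_spectral[OF psd(2)] by blast
  obtain t where t: "psd n (complex_of_real t \<cdot>\<^sub>m \<sigma> - \<rho>)" using dom by (auto simp: dominated_def)
  \<comment> \<open>The chi-square divergence Tr((rho - sigma)^2 sigma^(-1)), written in an
    eigenbasis of \<open>\<sigma>\<close>. Eigenvalues 0 contribute nothing, as division by zero is
    0.\<close>
  define C where "C = (\<Sum>j<n. (\<Sum>a<n. (cmod (\<Sum>b<n. (\<rho> $$ (a, b) - \<sigma> $$ (a, b)) * V $$ (b, j)))\<^sup>2) / s j)"
  have bounds: "qre \<rho> \<sigma> - p * C \<le> mix_info p \<rho> \<sigma> / p \<and> mix_info p \<rho> \<sigma> / p \<le> qre \<rho> \<sigma>"
    if p: "0 < p" "p \<le> 1" for p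
  proof -
    let ?m = "mix p \<rho> \<sigma>"
    have m: "psd n ?m" using p by (intro psd_mix psd) auto
    have trm: "mat_trace ?m = mat_trace \<sigma>" unfolding mat_trace_mix[OF c] tr by (simp add: algebra_simps)
    \<comment> \<open>The constant averages the bound \<open>t\<close> for \<open>\<rho>\<close> and
      the trivial bound 1 for \<open>\<sigma>\<close> itself.\<close>
    have "complex_of_real (p * t + (1 - p)) \<cdot>\<^sub>m \<sigma> - ?m = complex_of_real p \<cdot>\<^sub>m (complex_of_real t \<cdot>\<^sub>m \<sigma> - \<rho>)"
      using c by (intro eq_matI) (auto simp: mix_def algebra_simps)
    then have domm: "dominated n ?m \<sigma>"
      unfolding dominated_def using psd_smult[OF t, of p] p by (metis less_imp_le)
    \<comment> \<open>The mixture differs from \<open>\<sigma>\<close> by \<open>p\<close> times the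
      difference of \<open>\<rho>\<close> and \<open>\<sigma>\<close>, and the norms enter
      squared.\<close>
    have "(cmod (\<Sum>b<n. (?m $$ (a, b) - \<sigma> $$ (a, b)) * V $$ (b, j)))\<^sup>2 =
        p\<^sup>2 * (cmod (\<Sum>b<n. (\<rho> $$ (a, b) - \<sigma> $$ (a, b)) * V $$ (b, j)))\<^sup>2" if "a < n" for a j
    proof -
      have "(\<Sum>b<n. (?m $$ (a, b) - \<sigma> $$ (a, b)) * V $$ (b, j)) =
          complex_of_real p * (\<Sum>b<n. (\<rho> $$ (a, b) - \<sigma> $$ (a, b)) * V $$ (b, j))"
        unfolding sum_distrib_left using that c
        by (intro sum.cong refl) (simp add: index_mix algebra_simps)
      then show ?thesis by (simp add: norm_mult power_mult_distrib)
    qed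
    then have "(\<Sum>j<n. (\<Sum>a<n. (cmod (\<Sum>b<n. (?m $$ (a, b) - \<sigma> $$ (a, b)) * V $$ (b, j)))\<^sup>2) / s j) = p\<^sup>2 * C"
      unfolding C_def sum_distrib_left by (intro sum.cong refl) (simp add: sum_distrib_left)
    then have "qre ?m \<sigma> \<le> p\<^sup>2 * C"
      using qre_le_chi_square[OF m psd(2) domm trm ss] by simp
    moreover have "0 \<le> qre ?m \<sigma>" by (rule qre_nonneg[OF m psd(2) domm trm])
    moreover have "mix_info p \<rho> \<sigma> = p * qre \<rho> \<sigma> - qre ?m \<sigma>" using p by (intro mix_info_eq[OF psd]) auto
    ultimately show ?thesis using p by (simp add: field_simps power2_eq_square)
  qed
  have ev: "\<forall>\<^sub>F p in at_right 0. 0 < p \<and> p \<le> (1 :: real)"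
    unfolding eventually_at_right_field by (intro exI[of _ 1]) auto
  show ?thesis
  proof (rule tendsto_sandwich)
    show "\<forall>\<^sub>F p in at_right 0. qre \<rho> \<sigma> - p * C \<le> mix_info p \<rho> \<sigma> / p"
      using ev by eventually_elim (use bounds in blast)
    show "\<forall>\<^sub>F p in at_right 0. mix_info p \<rho> \<sigma> / p \<le> qre \<rho> \<sigma>"
      using ev by eventually_elim (use bounds in blast)
    have "((\<lambda>p. qre \<rho> \<sigma> - p * C) \<longlongrightarrow> qre \<rho> \<sigma> - 0 * C) (at_right 0)"
      by (intro tendsto_intros)
    then show "((\<lambda>p. qre \<rho> \<sigma> - p * C) \<longlongrightarrow> qre \<rho> \<sigma>) (at_right 0)" by simp
  qed (rule tendsto_const)
qed

section \<open>Positive scaling and direct sums of two blocks\<close>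

lemma spectral_smult:
  assumes "spectral n X U e"
  shows "spectral n (complex_of_real p \<cdot>\<^sub>m X) U (\<lambda>i. p * e i)"
proof -
  have U: "unitary n U" by (rule spectral_unitary[OF assms])
  have "complex_of_real p \<cdot>\<^sub>m X = U * mat_diag n (\<lambda>i. complex_of_real (p * e i)) * mat_adjoint U"
    using spectral_carrier[OF assms] unitaryD(1,2)[OF U]
    by (intro eq_matI)
      (simp_all add: index_spectral[OF U, of _ _ "\<lambda>i. p * e i", unfolded of_real_mult] spectral_index[OF assms] sum_distrib_left mult_ac del: index_mult_mat(1))
  then show ?thesis using U by (simp add: spectral_def)
qed

text \<open>The summand ln p cancels between the two logarithms. Since ln 0 = 0 violates ln (p x) =
  ln p + ln x at x = 0, zero eigenvalues of \<open>\<sigma>\<close> must carry no weight, which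
  domination ensures.\<close>

lemma qre_smult:
  assumes psd: "psd n \<rho>" "psd n \<sigma>" and dom: "dominated n \<rho> \<sigma>" and p: "0 < p"
  shows "qre (complex_of_real p \<cdot>\<^sub>m \<rho>) (complex_of_real p \<cdot>\<^sub>m \<sigma>) = p * qre \<rho> \<sigma>"
proof -
  obtain U r where sr: "spectral n \<rho> U r" and r: "\<And>k. k < n \<Longrightarrow> 0 \<le> r k"
    using psd_spectral[OF psd(1)] by blast
  obtain V s where ss: "spectral n \<sigma> V s" and s: "\<And>k. k < n \<Longrightarrow> 0 \<le> s k"
    using psd_spectral[OF psd(2)] by blast
  have psd': "psd n (complex_of_real p \<cdot>\<^sub>m \<rho>)" "psd n (complex_of_real p \<cdot>\<^sub>m \<sigma>)"
    using p by (auto intro!: psd_smult psd)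
  show ?thesis
    unfolding qre_spectral[OF psd' spectral_smult[OF sr] spectral_smult[OF ss]] qre_spectral[OF psd sr ss]
      sum_distrib_left
  proof (intro sum.cong refl)
    fix i j assume "i \<in> {..<n}" "j \<in> {..<n}"
    then have ij: "i < n" "j < n" by auto
    show "overlap n U V i j * (p * r i * ln (p * r i) - p * r i * ln (p * s j)) =
        p * (overlap n U V i j * (r i * ln (r i) - r i * ln (s j)))"
    proof (cases "overlap n U V i j = 0 \<or> r i = 0")
      case False
      then have "s j \<noteq> 0" using spectral_dominated_overlap[OF psd(1) sr ss dom ij] by auto
      then have "0 < s j" "0 < r i" using s[OF ij(2)] r[OF ij(1)] False by auto
      then show ?thesis using p by (simp add: ln_mult algebra_simps)
    qed auto
  qed
qed

definition block_sum :: "nat \<Rightarrow> complex mat \<Rightarrow> complex mat \<Rightarrow> complex mat" where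
  "block_sum n A B = four_block_mat A (0\<^sub>m n n) (0\<^sub>m n n) B"

lemma block_sum_carrier:
  assumes "A \<in> carrier_mat n n" "B \<in> carrier_mat n n"
  shows "block_sum n A B \<in> carrier_mat (n + n) (n + n)"
  using assms by (simp add: block_sum_def)

lemma index_block_sum:
  assumes "A \<in> carrier_mat n n" "B \<in> carrier_mat n n" "i < n + n" "j < n + n"
  shows "block_sum n A B $$ (i, j) =
    (if i < n then if j < n then A $$ (i, j) else 0
     else if j < n then 0 else B $$ (i - n, j - n))"
  using assms by (auto simp: block_sum_def)

lemma block_sum_mult:
  assumes "A \<in> carrier_mat n n" "B \<in> carrier_mat n n" "C \<in> carrier_mat n n" "D \<in> carrier_mat n n"
  shows "block_sum n A B * block_sum n C D = block_sum n (A * C) (B * D)"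
  using mult_four_block_diag[OF assms] by (simp add: block_sum_def)

lemma block_sum_minus:
  assumes "A \<in> carrier_mat n n" "B \<in> carrier_mat n n" "C \<in> carrier_mat n n" "D \<in> carrier_mat n n"
  shows "block_sum n A B - block_sum n C D = block_sum n (A - C) (B - D)"
  using assms by (intro eq_matI) (auto simp: block_sum_def)

lemma mat_trace_block_sum:
  assumes "A \<in> carrier_mat n n" "B \<in> carrier_mat n n"
  shows "mat_trace (block_sum n A B) = mat_trace A + mat_trace B"
proof -
  have "mat_trace (block_sum n A B) = (\<Sum>i<n + n. block_sum n A B $$ (i, i))"
    using block_sum_carrier[OF assms] by (simp add: mat_trace_def)
  also have "\<dots> = (\<Sum>i<n. block_sum n A B $$ (i, i)) + (\<Sum>i<n. block_sum n A B $$ (n + i, n + i))"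
    using sum.nat_group[of "\<lambda>i. block_sum n A B $$ (i, i)" n 2]
    by (simp add: numeral_2_eq_2 sum.atLeastLessThan_shift_0[of _ n "n + n"] atLeast0LessThan)
  also have "\<dots> = mat_trace A + mat_trace B"
    using assms by (simp add: index_block_sum mat_trace_def)
  finally show ?thesis .
qed

lemma spectral_block_sum:
  assumes "spectral n A U e" "spectral n B V f"
  shows "spectral (n + n) (block_sum n A B) (block_sum n U V) (\<lambda>i. if i < n then e i else f (i - n))"
proof -
  note u = unitaryD[OF spectral_unitary[OF assms(1)]] and v = unitaryD[OF spectral_unitary[OF assms(2)]]
  have D: "mat_diag (n + n) (\<lambda>i. complex_of_real (if i < n then e i else f (i - n))) =
      block_sum n (mat_diag n (\<lambda>i. complex_of_real (e i))) (mat_diag n (\<lambda>i. complex_of_real (f i)))"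
    by (intro eq_matI) (auto simp: mat_diag_def block_sum_def)
  have "block_sum n A B = block_sum n U V *
      mat_diag (n + n) (\<lambda>i. complex_of_real (if i < n then e i else f (i - n))) *
      mat_adjoint (block_sum n U V)"
  proof -
    let ?E = "mat_diag n (\<lambda>i. complex_of_real (e i))" and ?F = "mat_diag n (\<lambda>i. complex_of_real (f i))"
    have "block_sum n U V * block_sum n ?E ?F * mat_adjoint (block_sum n U V) =
        block_sum n (U * ?E) (V * ?F) * block_sum n (mat_adjoint U) (mat_adjoint V)"
      unfolding block_sum_mult[OF u(1) v(1) mat_diag_dim mat_diag_dim]
      using mat_adjoint_four_block_diag[OF u(1) v(1)] by (simp add: block_sum_def)
    also have "\<dots> = block_sum n (U * ?E * mat_adjoint U) (V * ?F * mat_adjoint V)"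
      by (intro block_sum_mult mult_carrier_mat[of _ n n] u v mat_diag_dim)
    also have "\<dots> = block_sum n A B" using assms by (simp only: spectral_def)
    finally show ?thesis unfolding D ..
  qed
  then show ?thesis
    using unitary_four_block_diag[OF spectral_unitary[OF assms(1)] spectral_unitary[OF assms(2)]]
    by (simp add: spectral_def block_sum_def)
qed

lemma psd_block_sum:
  assumes "psd n A" "psd n B"
  shows "psd (n + n) (block_sum n A B)"
proof -
  obtain U e where s: "spectral n A U e" "\<And>k. k < n \<Longrightarrow> 0 \<le> e k" using psd_spectral[OF assms(1)] by blast
  obtain V f where t: "spectral n B V f" "\<And>k. k < n \<Longrightarrow> 0 \<le> f k" using psd_spectral[OF assms(2)] by blast
  show ?thesis by (rule spectral_psd[OF spectral_block_sum[OF s(1) t(1)]]) (use s t in auto)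
qed

lemma mat_log_block_sum:
  assumes "psd n A" "psd n B"
  shows "mat_log (block_sum n A B) = block_sum n (mat_log A) (mat_log B)"
proof -
  obtain U e where s: "spectral n A U e" using psd_spectral[OF assms(1)] by blast
  obtain V f where t: "spectral n B V f" using psd_spectral[OF assms(2)] by blast
  \<comment> \<open>The logarithms are themselves given by spectral data, so the decomposition of a
    direct sum applies to them as well.\<close>
  have "spectral n (mat_log A) U (\<lambda>i. ln (e i))" "spectral n (mat_log B) V (\<lambda>i. ln (f i))"
    using s t mat_log_spectral by (auto simp: spectral_def)
  from spectral_block_sum[OF this]
  have "block_sum n (mat_log A) (mat_log B) = block_sum n U V *
      mat_diag (n + n) (\<lambda>i. complex_of_real (if i < n then ln (e i) else ln (f (i - n)))) *
      mat_adjoint (block_sum n U V)" by (simp add: spectral_def)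
  then show ?thesis unfolding mat_log_spectral[OF spectral_block_sum[OF s t]]
    by (simp add: if_distrib)
qed

lemma qre_block_sum:
  assumes "psd n A" "psd n B" "psd n C" "psd n D"
  shows "qre (block_sum n A B) (block_sum n C D) = qre A C + qre B D"
proof -
  note c = assms[THEN psd_carrier] and l = assms[THEN mat_log_carrier]
  have m: "mat_log A - mat_log C \<in> carrier_mat n n" "mat_log B - mat_log D \<in> carrier_mat n n"
    using l by auto
  show ?thesis
    unfolding qre_def mat_log_block_sum[OF assms(1,2)] mat_log_block_sum[OF assms(3,4)]
      block_sum_minus[OF l(1,2,3,4)] block_sum_mult[OF c(1,2) m]
      mat_trace_block_sum[OF mult_carrier_mat[OF c(1) m(1)] mult_carrier_mat[OF c(2) m(2)]]
    by simp
qed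

text \<open>Each difference is a nonnegative multiple of the other matrix of the pair. The constants
  stay explicit because both bounds are later enlarged to a common one.\<close>

lemma dominated_mix:
  assumes psd: "psd n \<rho>" "psd n \<sigma>" and p: "0 < p" "p < 1"
  shows "psd n (complex_of_real (1 / p) \<cdot>\<^sub>m mix p \<rho> \<sigma> - \<rho>)"
    "psd n (complex_of_real (1 / (1 - p)) \<cdot>\<^sub>m mix p \<rho> \<sigma> - \<sigma>)"
proof -
  note c = psd_carrier[OF psd(1)] psd_carrier[OF psd(2)]
  have inv: "complex_of_real (1 / (1 - p)) * complex_of_real (1 - p) = 1"
    using p by (simp flip: of_real_mult)
  have "complex_of_real (1 / p) \<cdot>\<^sub>m mix p \<rho> \<sigma> - \<rho> = complex_of_real ((1 - p) / p) \<cdot>\<^sub>m \<sigma>"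
  proof (rule eq_matI)
    fix i j assume "i < dim_row (complex_of_real ((1 - p) / p) \<cdot>\<^sub>m \<sigma>)" "j < dim_col (complex_of_real ((1 - p) / p) \<cdot>\<^sub>m \<sigma>)"
    then show "(complex_of_real (1 / p) \<cdot>\<^sub>m mix p \<rho> \<sigma> - \<rho>) $$ (i, j) = (complex_of_real ((1 - p) / p) \<cdot>\<^sub>m \<sigma>) $$ (i, j)"
      using c p mix_carrier[OF c, of p] by (simp add: index_mix[OF c] field_simps)
  qed (use c mix_carrier[OF c, of p] in auto)
  then show "psd n (complex_of_real (1 / p) \<cdot>\<^sub>m mix p \<rho> \<sigma> - \<rho>)"
    using p psd_smult[OF psd(2), of "(1 - p) / p"] by simp
  have "complex_of_real (1 / (1 - p)) \<cdot>\<^sub>m mix p \<rho> \<sigma> - \<sigma> = complex_of_real (p / (1 - p)) \<cdot>\<^sub>m \<rho>"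
  proof (rule eq_matI)
    fix i j assume "i < dim_row (complex_of_real (p / (1 - p)) \<cdot>\<^sub>m \<rho>)" "j < dim_col (complex_of_real (p / (1 - p)) \<cdot>\<^sub>m \<rho>)"
    then show "(complex_of_real (1 / (1 - p)) \<cdot>\<^sub>m mix p \<rho> \<sigma> - \<sigma>) $$ (i, j) = (complex_of_real (p / (1 - p)) \<cdot>\<^sub>m \<rho>) $$ (i, j)"
      using c p inv mix_carrier[OF c, of p]
      by (simp add: index_mix[OF c] distrib_left mult.assoc[symmetric] del: of_real_diff of_real_divide)
         (simp flip: of_real_mult)
  qed (use c mix_carrier[OF c, of p] in auto)
  then show "psd n (complex_of_real (1 / (1 - p)) \<cdot>\<^sub>m mix p \<rho> \<sigma> - \<sigma>)"
    using p psd_smult[OF psd(1), of "p / (1 - p)"] by simp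
qed

section \<open>Composite systems\<close>

lemma prod_index_div_mod:
  fixes i k d :: nat
  assumes "k < d"
  shows "(i * d + k) div d = i" "(i * d + k) mod d = k"
  using assms by auto

lemma prod_index_less:
  fixes i k a d :: nat
  assumes "i < a" "k < d"
  shows "i * d + k < a * d"
proof -
  have "i * d + k < Suc i * d" using assms(2) by simp
  also have "\<dots> \<le> a * d" using assms(1) by (intro mult_le_mono1) simp
  finally show ?thesis .
qed

lemma prod_index_split:
  fixes m a d :: nat
  assumes "m < a * d"
  shows "m div d < a" "m mod d < d"
  using assms by (auto simp: less_mult_imp_div_less intro!: mod_less_divisor gr0I)

lemma sum_prod_index:
  fixes f :: "nat \<Rightarrow> 'a :: comm_monoid_add"
  shows "(\<Sum>m<a * d. f m) = (\<Sum>i<a. \<Sum>k<d. f (i * d + k))"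
  unfolding sum.nat_group[symmetric]
  by (rule sum.cong[OF refl]) (subst sum.atLeastLessThan_shift_0, simp add: atLeast0LessThan)

lemma eq_mat_prod_index:
  assumes "A \<in> carrier_mat (a * d) (a * d)" "B \<in> carrier_mat (a * d) (a * d)"
    and "\<And>i j k l. i < a \<Longrightarrow> j < a \<Longrightarrow> k < d \<Longrightarrow> l < d \<Longrightarrow>
      A $$ (i * d + k, j * d + l) = B $$ (i * d + k, j * d + l)"
  shows "A = B"
proof (rule eq_matI)
  fix m n assume "m < dim_row B" "n < dim_col B"
  then have "m < a * d" "n < a * d" using assms(2) by auto
  then show "A $$ (m, n) = B $$ (m, n)"
    using assms(3)[of "m div d" "n div d" "m mod d" "n mod d"] prod_index_split by simp
qed (use assms in auto)

lemma tensor_mat_carrier: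
  assumes "X \<in> carrier_mat a b" "Y \<in> carrier_mat c d"
  shows "tensor_mat X Y \<in> carrier_mat (a * c) (b * d)"
  using assms by (simp add: tensor_mat_def)

lemma index_tensor_mat:
  assumes "X \<in> carrier_mat a a" "Y \<in> carrier_mat d d" "i < a" "j < a" "k < d" "l < d"
  shows "tensor_mat X Y $$ (i * d + k, j * d + l) = X $$ (i, j) * Y $$ (k, l)"
  using assms prod_index_less[of i a k d] prod_index_less[of j a l d] by (auto simp: tensor_mat_def)

lemma tensor_mat_mult:
  assumes A: "A \<in> carrier_mat a a" and B: "B \<in> carrier_mat d d"
    and C: "C \<in> carrier_mat a a" and D: "D \<in> carrier_mat d d"
  shows "tensor_mat A B * tensor_mat C D = tensor_mat (A * C) (B * D)"
proof -
  have AB: "tensor_mat A B \<in> carrier_mat (a * d) (a * d)" and CD: "tensor_mat C D \<in> carrier_mat (a * d) (a * d)"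
    using assms by (auto intro: tensor_mat_carrier)
  have AC: "A * C \<in> carrier_mat a a" and BD: "B * D \<in> carrier_mat d d"
    by (rule mult_carrier_mat[OF A C], rule mult_carrier_mat[OF B D])
  show ?thesis
  proof (rule eq_mat_prod_index)
    show "tensor_mat A B * tensor_mat C D \<in> carrier_mat (a * d) (a * d)" by (rule mult_carrier_mat[OF AB CD])
    show "tensor_mat (A * C) (B * D) \<in> carrier_mat (a * d) (a * d)" by (rule tensor_mat_carrier[OF AC BD])
    fix i j k l assume ij: "i < a" "j < a" and kl: "k < d" "l < d"
    have "(tensor_mat A B * tensor_mat C D) $$ (i * d + k, j * d + l) =
        (\<Sum>m<a. \<Sum>n<d. (A $$ (i, m) * C $$ (m, j)) * (B $$ (k, n) * D $$ (n, l)))"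
      unfolding index_mult_mat_sum[OF AB CD prod_index_less[OF ij(1) kl(1)] prod_index_less[OF ij(2) kl(2)]] sum_prod_index
      using ij kl by (intro sum.cong refl) (simp add: index_tensor_mat[OF A B] index_tensor_mat[OF C D])
    then show "(tensor_mat A B * tensor_mat C D) $$ (i * d + k, j * d + l) =
        tensor_mat (A * C) (B * D) $$ (i * d + k, j * d + l)"
      unfolding index_tensor_mat[OF AC BD ij kl] index_mult_mat_sum[OF A C ij] index_mult_mat_sum[OF B D kl]
        sum_product .
  qed
qed

lemma tensor_mat_adjoint:
  assumes A: "A \<in> carrier_mat a a" and B: "B \<in> carrier_mat d d"
  shows "mat_adjoint (tensor_mat A B) = tensor_mat (mat_adjoint A) (mat_adjoint B)"
proof (rule eq_mat_prod_index)
  note AB = tensor_mat_carrier[OF A B] and c = mat_adjoint_carrier[OF A] mat_adjoint_carrier[OF B]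
  show "mat_adjoint (tensor_mat A B) \<in> carrier_mat (a * d) (a * d)" by (rule mat_adjoint_carrier[OF AB])
  show "tensor_mat (mat_adjoint A) (mat_adjoint B) \<in> carrier_mat (a * d) (a * d)"
    by (rule tensor_mat_carrier[OF c])
  fix i j k l assume ij: "i < a" "j < a" and kl: "k < d" "l < d"
  show "mat_adjoint (tensor_mat A B) $$ (i * d + k, j * d + l) =
      tensor_mat (mat_adjoint A) (mat_adjoint B) $$ (i * d + k, j * d + l)"
    unfolding index_tensor_mat[OF c ij kl] index_mat_adjoint[OF AB prod_index_less[OF ij(1) kl(1)] prod_index_less[OF ij(2) kl(2)]]
      index_mat_adjoint[OF A ij] index_mat_adjoint[OF B kl] index_tensor_mat[OF A B ij(2,1) kl(2,1)] by simp
qed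

lemma tensor_mat_diag:
  "tensor_mat (mat_diag a f) (mat_diag d g) = mat_diag (a * d) (\<lambda>m. f (m div d) * g (m mod d))"
proof (rule eq_mat_prod_index)
  show "tensor_mat (mat_diag a f) (mat_diag d g) \<in> carrier_mat (a * d) (a * d)"
    by (intro tensor_mat_carrier mat_diag_dim)
  show "mat_diag (a * d) (\<lambda>m. f (m div d) * g (m mod d)) \<in> carrier_mat (a * d) (a * d)"
    by (rule mat_diag_dim)
  fix i j k l assume ij: "i < a" "j < a" and kl: "k < d" "l < d"
  have "i * d + k = j * d + l \<longleftrightarrow> i = j \<and> k = l"
    using prod_index_div_mod[OF kl(1), of i] prod_index_div_mod[OF kl(2), of j] by metis
  then show "tensor_mat (mat_diag a f) (mat_diag d g) $$ (i * d + k, j * d + l) =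
      mat_diag (a * d) (\<lambda>m. f (m div d) * g (m mod d)) $$ (i * d + k, j * d + l)"
    unfolding index_tensor_mat[OF mat_diag_dim mat_diag_dim ij kl]
    using ij kl prod_index_less[OF ij(1) kl(1)] prod_index_less[OF ij(2) kl(2)]
    by (simp add: mat_diag_def)
qed

lemma spectral_tensor_mat:
  assumes X: "spectral a X U e" and Y: "spectral d Y V f"
  shows "spectral (a * d) (tensor_mat X Y) (tensor_mat U V) (\<lambda>m. e (m div d) * f (m mod d))"
proof -
  note u = unitaryD[OF spectral_unitary[OF X]] and v = unitaryD[OF spectral_unitary[OF Y]]
  let ?E = "mat_diag a (\<lambda>i. complex_of_real (e i))" and ?F = "mat_diag d (\<lambda>i. complex_of_real (f i))"
  have "mat_adjoint (tensor_mat U V) * tensor_mat U V = tensor_mat (mat_diag a (\<lambda>_. 1)) (mat_diag d (\<lambda>_. 1))"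
    unfolding tensor_mat_adjoint[OF u(1) v(1)] tensor_mat_mult[OF u(2) v(2) u(1) v(1)] u(4) v(4) by simp
  also have "\<dots> = 1\<^sub>m (a * d)" unfolding tensor_mat_diag by simp
  finally have "unitary (a * d) (tensor_mat U V)"
    by (rule unitaryI[OF tensor_mat_carrier[OF u(1) v(1)]])
  moreover have "tensor_mat U V * mat_diag (a * d) (\<lambda>m. complex_of_real (e (m div d) * f (m mod d))) *
      mat_adjoint (tensor_mat U V) = tensor_mat X Y"
  proof -
    have "tensor_mat U V * tensor_mat ?E ?F * mat_adjoint (tensor_mat U V) =
        tensor_mat (U * ?E * mat_adjoint U) (V * ?F * mat_adjoint V)"
      unfolding tensor_mat_adjoint[OF u(1) v(1)] tensor_mat_mult[OF u(1) v(1) mat_diag_dim mat_diag_dim]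
      by (intro tensor_mat_mult[of _ a _ d] mult_carrier_mat[of _ a a] mult_carrier_mat[of _ d d] u v mat_diag_dim)
    also have "\<dots> = tensor_mat X Y" using X Y by (simp only: spectral_def)
    finally show ?thesis unfolding tensor_mat_diag by (simp only: of_real_mult)
  qed
  ultimately show ?thesis unfolding spectral_def by (simp only: simp_thms)
qed

text \<open>Positivity is read off the spectrum: the eigenvalues of the tensor product are products
  of eigenvalues.\<close>

lemma psd_tensor_mat:
  assumes "psd a X" "psd d Y"
  shows "psd (a * d) (tensor_mat X Y)"
proof -
  obtain U e where s: "spectral a X U e" "\<And>k. k < a \<Longrightarrow> 0 \<le> e k" using psd_spectral[OF assms(1)] by blast
  obtain V f where t: "spectral d Y V f" "\<And>k. k < d \<Longrightarrow> 0 \<le> f k" using psd_spectral[OF assms(2)] by blast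
  show ?thesis
  proof (rule spectral_psd[OF spectral_tensor_mat[OF s(1) t(1)]])
    fix m assume "m < a * d"
    then show "0 \<le> e (m div d) * f (m mod d)"
      using s(2) t(2) prod_index_split by (metis mult_nonneg_nonneg)
  qed
qed

lemma mat_trace_tensor_mat:
  assumes "X \<in> carrier_mat a a" "Y \<in> carrier_mat d d"
  shows "mat_trace (tensor_mat X Y) = mat_trace X * mat_trace Y"
proof -
  have "mat_trace (tensor_mat X Y) = (\<Sum>i<a. \<Sum>k<d. tensor_mat X Y $$ (i * d + k, i * d + k))"
    using tensor_mat_carrier[OF assms] unfolding mat_trace_def by (simp add: sum_prod_index)
  also have "\<dots> = (\<Sum>i<a. \<Sum>k<d. X $$ (i, i) * Y $$ (k, k))"
    by (intro sum.cong refl) (simp add: index_tensor_mat[OF assms])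
  finally show ?thesis using assms by (simp add: mat_trace_def sum_product)
qed

lemma densityD:
  assumes "density n X"
  shows "psd n X" "X \<in> carrier_mat n n" "mat_trace X = 1"
  using assms by (auto simp: density_def psd_def)

lemma density_tensor_mat:
  assumes "density a X" "density d Y"
  shows "density (a * d) (tensor_mat X Y)"
  using densityD[OF assms(1)] densityD[OF assms(2)]
  by (simp add: density_def psd_tensor_mat mat_trace_tensor_mat)

section \<open>Partial traces\<close>

lemma tr_snd_carrier [simp]: "tr_snd d1 d2 X \<in> carrier_mat d1 d1"
  by (simp add: tr_snd_def)

lemma tr_fst_carrier [simp]: "tr_fst d1 d2 X \<in> carrier_mat d2 d2"
  by (simp add: tr_fst_def)

lemma quad_form_prod_index:
  "quad_form (a * d) X f =
    (\<Sum>i<a. \<Sum>k<d. \<Sum>j<a. \<Sum>l<d. cnj (f (i * d + k)) * X $$ (i * d + k, j * d + l) * f (j * d + l))"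
  by (simp add: quad_form_def sum_prod_index)

text \<open>The form of the partial trace at \<open>f\<close> is the sum over \<open>n\<close> of
  the forms of \<open>X\<close> at the product vectors f (x) e_n; \<open>?g n\<close> is such a
  vector in composite indices.\<close>

lemma psd_tr_snd:
  assumes "psd (a * d) X"
  shows "psd a (tr_snd a d X)"
proof (rule psdI)
  fix f :: "nat \<Rightarrow> complex"
  let ?g = "\<lambda>n m. if m mod d = n then f (m div d) else 0"
  have "quad_form (a * d) X (?g n) = (\<Sum>i<a. \<Sum>j<a. cnj (f i) * X $$ (i * d + n, j * d + n) * f j)"
    if n: "n < d" for n
  proof -
    have "quad_form (a * d) X (?g n) = (\<Sum>i<a. \<Sum>k<d. \<Sum>j<a. \<Sum>l<d. if k = n then if l = n then
        cnj (f i) * X $$ (i * d + n, j * d + n) * f j else 0 else 0)"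
      unfolding quad_form_prod_index by (intro sum.cong refl) (auto simp: prod_index_div_mod)
    also have "\<dots> = (\<Sum>i<a. \<Sum>k<d. if k = n then \<Sum>j<a. cnj (f i) * X $$ (i * d + n, j * d + n) * f j else 0)"
      using n by (intro sum.cong refl) auto
    finally show ?thesis using n by simp
  qed
  then have "(\<Sum>n<d. quad_form (a * d) X (?g n)) =
      (\<Sum>n<d. \<Sum>i<a. \<Sum>j<a. cnj (f i) * X $$ (i * d + n, j * d + n) * f j)" by simp
  also have "\<dots> = (\<Sum>i<a. \<Sum>n<d. \<Sum>j<a. cnj (f i) * X $$ (i * d + n, j * d + n) * f j)" by (rule sum.swap)
  also have "\<dots> = (\<Sum>i<a. \<Sum>j<a. \<Sum>n<d. cnj (f i) * X $$ (i * d + n, j * d + n) * f j)"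
    by (intro sum.cong refl sum.swap)
  also have "\<dots> = quad_form a (tr_snd a d X) f"
    by (simp add: quad_form_def tr_snd_def sum_distrib_left sum_distrib_right)
  finally show "0 \<le> quad_form a (tr_snd a d X) f"
    using sum_nonneg[of "{..<d}" "\<lambda>n. quad_form (a * d) X (?g n)"] psd_quad_form[OF assms] by simp
qed simp

lemma psd_tr_fst:
  assumes "psd (a * d) X"
  shows "psd d (tr_fst a d X)"
proof (rule psdI)
  fix f :: "nat \<Rightarrow> complex"
  \<comment> \<open>The product vector e_n (x) f, with the basis vector in the factor that is traced
    out.\<close>
  let ?g = "\<lambda>n m. if m div d = n then f (m mod d) else 0"
  have "quad_form (a * d) X (?g n) = (\<Sum>k<d. \<Sum>l<d. cnj (f k) * X $$ (n * d + k, n * d + l) * f l)"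
    if n: "n < a" for n
  proof -
    have "quad_form (a * d) X (?g n) = (\<Sum>i<a. \<Sum>k<d. \<Sum>j<a. \<Sum>l<d. if i = n then if j = n then
        cnj (f k) * X $$ (n * d + k, n * d + l) * f l else 0 else 0)"
      unfolding quad_form_prod_index by (intro sum.cong refl) (auto simp: prod_index_div_mod)
    also have "\<dots> = (\<Sum>i<a. \<Sum>k<d. \<Sum>j<a. if i = n then if j = n then
        \<Sum>l<d. cnj (f k) * X $$ (n * d + k, n * d + l) * f l else 0 else 0)"
      by (intro sum.cong refl) auto
    also have "\<dots> = (\<Sum>i<a. if i = n then \<Sum>k<d. \<Sum>j<a. if j = n then
        \<Sum>l<d. cnj (f k) * X $$ (n * d + k, n * d + l) * f l else 0 else 0)"
      by (intro sum.cong refl) auto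
    finally show ?thesis using n by simp
  qed
  then have "(\<Sum>n<a. quad_form (a * d) X (?g n)) =
      (\<Sum>n<a. \<Sum>k<d. \<Sum>l<d. cnj (f k) * X $$ (n * d + k, n * d + l) * f l)" by simp
  also have "\<dots> = (\<Sum>k<d. \<Sum>n<a. \<Sum>l<d. cnj (f k) * X $$ (n * d + k, n * d + l) * f l)" by (rule sum.swap)
  also have "\<dots> = (\<Sum>k<d. \<Sum>l<d. \<Sum>n<a. cnj (f k) * X $$ (n * d + k, n * d + l) * f l)"
    by (intro sum.cong refl sum.swap)
  also have "\<dots> = quad_form d (tr_fst a d X) f"
    by (simp add: quad_form_def tr_fst_def sum_distrib_left sum_distrib_right)
  finally show "0 \<le> quad_form d (tr_fst a d X) f"
    using sum_nonneg[of "{..<a}" "\<lambda>n. quad_form (a * d) X (?g n)"] psd_quad_form[OF assms] by simp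
qed simp

lemma mat_trace_tr_snd:
  assumes "X \<in> carrier_mat (a * d) (a * d)"
  shows "mat_trace (tr_snd a d X) = mat_trace X"
  using assms by (simp add: mat_trace_def tr_snd_def sum_prod_index)

lemma mat_trace_tr_fst:
  assumes "X \<in> carrier_mat (a * d) (a * d)"
  shows "mat_trace (tr_fst a d X) = mat_trace X"
proof -
  have "mat_trace (tr_fst a d X) = (\<Sum>k<d. \<Sum>i<a. X $$ (i * d + k, i * d + k))"
    by (simp add: mat_trace_def tr_fst_def)
  also have "\<dots> = (\<Sum>i<a. \<Sum>k<d. X $$ (i * d + k, i * d + k))" by (rule sum.swap)
  finally show ?thesis using assms by (simp add: mat_trace_def sum_prod_index)
qed

lemma density_tr_snd:
  assumes "density (a * d) X"
  shows "density a (tr_snd a d X)"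
  using densityD[OF assms] by (simp add: density_def psd_tr_snd mat_trace_tr_snd)

lemma density_tr_fst:
  assumes "density (a * d) X"
  shows "density d (tr_fst a d X)"
  using densityD[OF assms] by (simp add: density_def psd_tr_fst mat_trace_tr_fst)

lemma tr_snd_tr_snd: "tr_snd a (b * c) X = tr_snd a b (tr_snd (a * b) c X)"
proof (rule eq_matI)
  fix i j assume "i < dim_row (tr_snd a b (tr_snd (a * b) c X))" "j < dim_col (tr_snd a b (tr_snd (a * b) c X))"
  then have ij: "i < a" "j < a" by (auto simp: tr_snd_def)
  have "tr_snd a b (tr_snd (a * b) c X) $$ (i, j) = (\<Sum>k<b. \<Sum>l<c. X $$ ((i * b + k) * c + l, (j * b + k) * c + l))"
    using ij prod_index_less[OF ij(1), of _ b] prod_index_less[OF ij(2), of _ b] by (simp add: tr_snd_def)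
  also have "\<dots> = (\<Sum>k<b. \<Sum>l<c. X $$ (i * (b * c) + (k * c + l), j * (b * c) + (k * c + l)))"
    by (intro sum.cong refl) (simp add: algebra_simps)
  finally show "tr_snd a (b * c) X $$ (i, j) = tr_snd a b (tr_snd (a * b) c X) $$ (i, j)"
    using ij by (simp add: tr_snd_def sum_prod_index)
qed (simp_all add: tr_snd_def)

lemma tr_fst_tr_snd: "tr_fst a b (tr_snd (a * b) c X) = tr_snd b c (tr_fst a (b * c) X)"
proof (rule eq_matI)
  fix k l assume "k < dim_row (tr_snd b c (tr_fst a (b * c) X))" "l < dim_col (tr_snd b c (tr_fst a (b * c) X))"
  then have kl: "k < b" "l < b" by (auto simp: tr_snd_def)
  have "tr_fst a b (tr_snd (a * b) c X) $$ (k, l) = (\<Sum>i<a. \<Sum>n<c. X $$ ((i * b + k) * c + n, (i * b + l) * c + n))"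
    using kl prod_index_less[of _ a k b] prod_index_less[of _ a l b] by (simp add: tr_snd_def tr_fst_def)
  also have "\<dots> = (\<Sum>n<c. \<Sum>i<a. X $$ ((i * b + k) * c + n, (i * b + l) * c + n))" by (rule sum.swap)
  also have "\<dots> = (\<Sum>n<c. \<Sum>i<a. X $$ (i * (b * c) + (k * c + n), i * (b * c) + (l * c + n)))"
    by (intro sum.cong refl) (simp add: algebra_simps)
  also have "\<dots> = tr_snd b c (tr_fst a (b * c) X) $$ (k, l)"
    using kl prod_index_less[of k b _ c] prod_index_less[of l b _ c] by (simp add: tr_snd_def tr_fst_def)
  finally show "tr_fst a b (tr_snd (a * b) c X) $$ (k, l) = tr_snd b c (tr_fst a (b * c) X) $$ (k, l)" .
qed (simp_all add: tr_snd_def tr_fst_def)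

lemma tr_snd_tensor_mat:
  assumes X: "X \<in> carrier_mat a a" and Y: "Y \<in> carrier_mat (b * c) (b * c)"
  shows "tr_snd (a * b) c (tensor_mat X Y) = tensor_mat X (tr_snd b c Y)"
proof (rule eq_mat_prod_index[of _ a b])
  show "tensor_mat X (tr_snd b c Y) \<in> carrier_mat (a * b) (a * b)"
    by (rule tensor_mat_carrier[OF X tr_snd_carrier])
  fix i j k l assume ij: "i < a" "j < a" and kl: "k < b" "l < b"
  have "tr_snd (a * b) c (tensor_mat X Y) $$ (i * b + k, j * b + l) =
      (\<Sum>n<c. tensor_mat X Y $$ ((i * b + k) * c + n, (j * b + l) * c + n))"
    using prod_index_less[OF ij(1) kl(1)] prod_index_less[OF ij(2) kl(2)] by (simp add: tr_snd_def)
  also have "\<dots> = (\<Sum>n<c. X $$ (i, j) * Y $$ (k * c + n, l * c + n))"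
  proof (intro sum.cong refl)
    fix n assume "n \<in> {..<c}"
    then have n: "n < c" by simp
    have eq: "(i * b + k) * c + n = i * (b * c) + (k * c + n)" for i k by (simp add: algebra_simps)
    show "tensor_mat X Y $$ ((i * b + k) * c + n, (j * b + l) * c + n) = X $$ (i, j) * Y $$ (k * c + n, l * c + n)"
      unfolding eq by (rule index_tensor_mat[OF X Y ij prod_index_less[OF kl(1) n] prod_index_less[OF kl(2) n]])
  qed
  also have "\<dots> = tensor_mat X (tr_snd b c Y) $$ (i * b + k, j * b + l)"
    unfolding index_tensor_mat[OF X tr_snd_carrier ij kl] using kl by (simp add: tr_snd_def sum_distrib_left)
  finally show "tr_snd (a * b) c (tensor_mat X Y) $$ (i * b + k, j * b + l) =
    tensor_mat X (tr_snd b c Y) $$ (i * b + k, j * b + l)" .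
qed simp

lemma tr_snd_smult:
  assumes "X \<in> carrier_mat (a * d) (a * d)"
  shows "tr_snd a d (c \<cdot>\<^sub>m X) = c \<cdot>\<^sub>m tr_snd a d X"
proof (rule eq_matI)
  fix i j assume "i < dim_row (c \<cdot>\<^sub>m tr_snd a d X)" "j < dim_col (c \<cdot>\<^sub>m tr_snd a d X)"
  then have "i < a" "j < a" by (auto simp: tr_snd_def)
  then show "tr_snd a d (c \<cdot>\<^sub>m X) $$ (i, j) = (c \<cdot>\<^sub>m tr_snd a d X) $$ (i, j)"
    using assms prod_index_less[of i a _ d] prod_index_less[of j a _ d]
    by (simp add: tr_snd_def sum_distrib_left)
qed (simp_all add: tr_snd_def)

lemma tr_snd_block_sum:
  assumes "X \<in> carrier_mat (d * e) (d * e)" "Y \<in> carrier_mat (d * e) (d * e)"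
  shows "tr_snd (d + d) e (block_sum (d * e) X Y) = block_sum d (tr_snd d e X) (tr_snd d e Y)"
proof (rule eq_matI)
  note bc = block_sum_carrier[OF tr_snd_carrier tr_snd_carrier, of d e X e Y]
  fix i j assume "i < dim_row (block_sum d (tr_snd d e X) (tr_snd d e Y))" "j < dim_col (block_sum d (tr_snd d e X) (tr_snd d e Y))"
  then have ij: "i < d + d" "j < d + d" using bc by auto
  \<comment> \<open>The block boundary \<open>d * e\<close> is a multiple of \<open>e\<close>, so
    the first component of a composite index alone decides in which block it lies.\<close>
  have lt: "m * e + k < d * e \<longleftrightarrow> m < d" if "k < e" for m k
    using that prod_index_less[of m d k e] prod_index_split(1)[of "m * e + k" d e] prod_index_div_mod(1)[OF that] by metis
  have sub: "m * e + k - d * e = (m - d) * e + k" if "\<not> m < d" for m k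
    using that by (simp add: diff_mult_distrib)
  have "tr_snd (d + d) e (block_sum (d * e) X Y) $$ (i, j) =
      (\<Sum>k<e. block_sum (d * e) X Y $$ (i * e + k, j * e + k))"
    using ij by (simp add: tr_snd_def)
  also have "\<dots> = (\<Sum>k<e. if i < d then if j < d then X $$ (i * e + k, j * e + k) else 0
     else if j < d then 0 else Y $$ ((i - d) * e + k, (j - d) * e + k))"
  proof (intro sum.cong refl)
    fix k assume "k \<in> {..<e}"
    then have k: "k < e" by simp
    have b: "i * e + k < d * e + d * e" "j * e + k < d * e + d * e"
      using prod_index_less[OF ij(1) k] prod_index_less[OF ij(2) k] by (simp_all add: distrib_right)
    show "block_sum (d * e) X Y $$ (i * e + k, j * e + k) = (if i < d then if j < d then X $$ (i * e + k, j * e + k) else 0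
     else if j < d then 0 else Y $$ ((i - d) * e + k, (j - d) * e + k))"
      unfolding index_block_sum[OF assms b] lt[OF k] by (simp add: sub)
  qed
  also have "\<dots> = block_sum d (tr_snd d e X) (tr_snd d e Y) $$ (i, j)"
    unfolding index_block_sum[OF tr_snd_carrier tr_snd_carrier ij] using ij by (simp add: tr_snd_def)
  finally show "tr_snd (d + d) e (block_sum (d * e) X Y) $$ (i, j) =
    block_sum d (tr_snd d e X) (tr_snd d e Y) $$ (i, j)" .
qed (use block_sum_carrier[OF tr_snd_carrier tr_snd_carrier, of d e X e Y] in \<open>auto simp: tr_snd_def\<close>)

section \<open>Channels and conditional mutual information\<close>

lemma mat_block_carrier [simp]: "mat_block d i j X \<in> carrier_mat d d"
  by (simp add: mat_block_def)

lemma id_tensor_carrier [simp]: "id_tensor d dA dB N X \<in> carrier_mat (d * dB) (d * dB)"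
  by (simp add: id_tensor_def)

lemma index_id_tensor:
  assumes "i < d" "j < d" "k < dB" "l < dB"
  shows "id_tensor d dA dB N X $$ (i * dB + k, j * dB + l) = N (mat_block dA i j X) $$ (k, l)"
  using assms prod_index_less[of i d k dB] prod_index_less[of j d l dB] by (simp add: id_tensor_def)

lemma index_tr_snd: "i < a \<Longrightarrow> j < a \<Longrightarrow> tr_snd a d X $$ (i, j) = (\<Sum>k<d. X $$ (i * d + k, j * d + k))"
  by (simp add: tr_snd_def)

lemma index_tr_fst: "k < d \<Longrightarrow> l < d \<Longrightarrow> tr_fst a d X $$ (k, l) = (\<Sum>i<a. X $$ (i * d + k, i * d + l))"
  by (simp add: tr_fst_def)

context
  fixes dA dB :: nat and N :: "complex mat \<Rightarrow> complex mat"
  assumes channel: "quantum_channel dA dB N"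
begin

lemma channel_carrier: "X \<in> carrier_mat dA dA \<Longrightarrow> N X \<in> carrier_mat dB dB"
  and channel_add: "X \<in> carrier_mat dA dA \<Longrightarrow> Y \<in> carrier_mat dA dA \<Longrightarrow> N (X + Y) = N X + N Y"
  and channel_smult: "X \<in> carrier_mat dA dA \<Longrightarrow> N (c \<cdot>\<^sub>m X) = c \<cdot>\<^sub>m N X"
  and channel_trace: "X \<in> carrier_mat dA dA \<Longrightarrow> mat_trace (N X) = mat_trace X"
  and channel_psd: "psd (d * dA) Z \<Longrightarrow> psd (d * dB) (id_tensor d dA dB N Z)"
  using channel by (auto simp: quantum_channel_def)

lemma channel_zero: "N (0\<^sub>m dA dA) = 0\<^sub>m dB dB"
proof -
  have z: "0 \<cdot>\<^sub>m X = 0\<^sub>m n n" if "X \<in> carrier_mat n n" for X :: "complex mat" and n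
    using that by (intro eq_matI) auto
  have "N (0 \<cdot>\<^sub>m 0\<^sub>m dA dA) = 0 \<cdot>\<^sub>m N (0\<^sub>m dA dA)" by (rule channel_smult) simp
  then show ?thesis using z[OF channel_carrier[OF zero_carrier_mat]] z[of "0\<^sub>m dA dA" dA] by simp
qed

lemma channel_sum:
  assumes "\<And>c. F c \<in> carrier_mat dA dA" "k < dB" "l < dB"
  shows "N (mat dA dA (\<lambda>ij. \<Sum>c<n. F c $$ ij)) $$ (k, l) = (\<Sum>c<(n :: nat). N (F c) $$ (k, l))"
proof (induction n)
  case 0
  have "mat dA dA (\<lambda>ij. \<Sum>c<(0::nat). F c $$ ij) = 0\<^sub>m dA dA" by (intro eq_matI) auto
  then show ?case using assms(2,3) by (simp add: channel_zero)
next
  case (Suc n)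
  have "mat dA dA (\<lambda>ij. \<Sum>c<Suc n. F c $$ ij) = mat dA dA (\<lambda>ij. \<Sum>c<n. F c $$ ij) + F n"
    using assms(1)[of n] by (intro eq_matI) auto
  then have "N (mat dA dA (\<lambda>ij. \<Sum>c<Suc n. F c $$ ij)) = N (mat dA dA (\<lambda>ij. \<Sum>c<n. F c $$ ij)) + N (F n)"
    using assms(1)[of n] by (simp add: channel_add)
  then show ?case using Suc.IH assms(2,3) channel_carrier[OF assms(1)[of n]] by simp
qed

text \<open>Trace preservation, applied to each block. It is the reason why the conditional mutual
  informations before and after the channel subtract the same term.\<close>

lemma tr_snd_id_tensor: "tr_snd d dB (id_tensor d dA dB N X) = tr_snd d dA X"
proof (rule eq_matI)
  fix i j assume "i < dim_row (tr_snd d dA X)" "j < dim_col (tr_snd d dA X)"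
  then have ij: "i < d" "j < d" by (auto simp: tr_snd_def)
  have "tr_snd d dB (id_tensor d dA dB N X) $$ (i, j) = (\<Sum>k<dB. N (mat_block dA i j X) $$ (k, k))"
    unfolding index_tr_snd[OF ij] using ij by (intro sum.cong refl) (simp add: index_id_tensor)
  also have "\<dots> = mat_trace (N (mat_block dA i j X))"
    using channel_carrier[OF mat_block_carrier, of i j X] by (simp add: mat_trace_def)
  also have "\<dots> = mat_trace (mat_block dA i j X)" by (rule channel_trace[OF mat_block_carrier])
  also have "\<dots> = tr_snd d dA X $$ (i, j)"
    unfolding index_tr_snd[OF ij] by (simp add: mat_trace_def mat_block_def)
  finally show "tr_snd d dB (id_tensor d dA dB N X) $$ (i, j) = tr_snd d dA X $$ (i, j)" .
qed (simp_all add: tr_snd_def)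

lemma density_id_tensor:
  assumes "density (d * dA) X"
  shows "density (d * dB) (id_tensor d dA dB N X)"
proof -
  have "mat_trace (id_tensor d dA dB N X) = mat_trace (tr_snd d dB (id_tensor d dA dB N X))"
    by (rule mat_trace_tr_snd[symmetric]) simp
  also have "\<dots> = 1" unfolding tr_snd_id_tensor using density_tr_snd[OF assms] densityD(3) by blast
  finally show ?thesis using channel_psd densityD[OF assms] by (simp add: density_def)
qed

lemma id_tensor_smult:
  assumes "X \<in> carrier_mat (d * dA) (d * dA)"
  shows "id_tensor d dA dB N (c \<cdot>\<^sub>m X) = c \<cdot>\<^sub>m id_tensor d dA dB N X"
proof (rule eq_mat_prod_index)
  fix i j k l assume ij: "i < d" "j < d" and kl: "k < dB" "l < dB"
  have "mat_block dA i j (c \<cdot>\<^sub>m X) = c \<cdot>\<^sub>m mat_block dA i j X"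
    using assms prod_index_less[OF ij(1), of _ dA] prod_index_less[OF ij(2), of _ dA]
    by (intro eq_matI) (simp_all add: mat_block_def)
  then have "N (mat_block dA i j (c \<cdot>\<^sub>m X)) $$ (k, l) = c * N (mat_block dA i j X) $$ (k, l)"
    using channel_carrier[OF mat_block_carrier, of i j X] kl by (simp add: channel_smult)
  moreover have "(c \<cdot>\<^sub>m id_tensor d dA dB N X) $$ (i * dB + k, j * dB + l) =
      c * id_tensor d dA dB N X $$ (i * dB + k, j * dB + l)"
    using id_tensor_carrier[of d dA dB N X] prod_index_less[OF ij(1) kl(1)] prod_index_less[OF ij(2) kl(2)]
    by (intro index_smult_mat) (simp_all add: id_tensor_def)
  ultimately show "id_tensor d dA dB N (c \<cdot>\<^sub>m X) $$ (i * dB + k, j * dB + l) =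
      (c \<cdot>\<^sub>m id_tensor d dA dB N X) $$ (i * dB + k, j * dB + l)"
    by (simp only: index_id_tensor[OF ij kl])
qed simp_all

lemma id_tensor_minus:
  assumes "X \<in> carrier_mat (d * dA) (d * dA)" "Y \<in> carrier_mat (d * dA) (d * dA)"
  shows "id_tensor d dA dB N (X - Y) = id_tensor d dA dB N X - id_tensor d dA dB N Y"
proof (rule eq_mat_prod_index)
  show "id_tensor d dA dB N X - id_tensor d dA dB N Y \<in> carrier_mat (d * dB) (d * dB)"
    by (rule minus_carrier_mat) simp
  fix i j k l assume ij: "i < d" "j < d" and kl: "k < dB" "l < dB"
  have "mat_block dA i j (X - Y) = mat_block dA i j X + (- 1) \<cdot>\<^sub>m mat_block dA i j Y"
    using assms prod_index_less[OF ij(1), of _ dA] prod_index_less[OF ij(2), of _ dA]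
    by (intro eq_matI) (simp_all add: mat_block_def)
  then have "N (mat_block dA i j (X - Y)) $$ (k, l) = N (mat_block dA i j X) $$ (k, l) - N (mat_block dA i j Y) $$ (k, l)"
    using channel_carrier[OF mat_block_carrier, of i j X] channel_carrier[OF mat_block_carrier, of i j Y] kl
    by (simp add: channel_smult channel_add)
  moreover have "(id_tensor d dA dB N X - id_tensor d dA dB N Y) $$ (i * dB + k, j * dB + l) =
      id_tensor d dA dB N X $$ (i * dB + k, j * dB + l) - id_tensor d dA dB N Y $$ (i * dB + k, j * dB + l)"
    using id_tensor_carrier[of d dA dB N Y] prod_index_less[OF ij(1) kl(1)] prod_index_less[OF ij(2) kl(2)]
    by (intro index_minus_mat) (simp_all add: id_tensor_def)
  ultimately show "id_tensor d dA dB N (X - Y) $$ (i * dB + k, j * dB + l) =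
      (id_tensor d dA dB N X - id_tensor d dA dB N Y) $$ (i * dB + k, j * dB + l)"
    by (simp only: index_id_tensor[OF ij kl])
qed simp

text \<open>Complete positivity, applied to the positive semidefinite matrix c sigma - rho, keeps
  the same constant. A finite relative entropy of the inputs thus gives a finite one of the
  outputs.\<close>

lemma dominated_id_tensor:
  assumes car: "\<rho> \<in> carrier_mat (d * dA) (d * dA)" "\<sigma> \<in> carrier_mat (d * dA) (d * dA)"
    and "dominated (d * dA) \<rho> \<sigma>"
  shows "dominated (d * dB) (id_tensor d dA dB N \<rho>) (id_tensor d dA dB N \<sigma>)"
proof -
  obtain c where "psd (d * dA) (complex_of_real c \<cdot>\<^sub>m \<sigma> - \<rho>)" using assms(3) by (auto simp: dominated_def)
  from channel_psd[OF this] show ?thesis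
    unfolding dominated_def id_tensor_minus[OF smult_carrier_mat[OF car(2)] car(1)] id_tensor_smult[OF car(2)] by blast
qed

lemma id_tensor_block_sum:
  assumes X: "X \<in> carrier_mat (d * dA) (d * dA)" and Y: "Y \<in> carrier_mat (d * dA) (d * dA)"
  shows "id_tensor (d + d) dA dB N (block_sum (d * dA) X Y) =
    block_sum (d * dB) (id_tensor d dA dB N X) (id_tensor d dA dB N Y)"
proof (rule eq_mat_prod_index)
  show "block_sum (d * dB) (id_tensor d dA dB N X) (id_tensor d dA dB N Y)
      \<in> carrier_mat ((d + d) * dB) ((d + d) * dB)"
    using block_sum_carrier[OF id_tensor_carrier id_tensor_carrier] by (simp add: distrib_right)
  have lt: "m * e + k < d * e \<longleftrightarrow> m < d" if "k < e" for m k e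
    using that prod_index_less[of m d k e] prod_index_split(1)[of "m * e + k" d e] prod_index_div_mod(1)[OF that] by metis
  have sub: "m * e + k - d * e = (m - d) * e + k" if "\<not> m < d" for m k e
    using that by (simp add: diff_mult_distrib)
  fix i j k l assume ij: "i < d + d" "j < d + d" and kl: "k < dB" "l < dB"
  have bd: "i * e + k < d * e + d * e" if "i < d + d" "k < e" for i e k
    using prod_index_less[OF that] by (simp add: distrib_right)
  \<comment> \<open>No block on which the channel acts straddles the two summands; a block off the
    diagonal of the direct sum is zero and goes to zero by linearity.\<close>
  have "mat_block dA i j (block_sum (d * dA) X Y) = (if i < d then if j < d then mat_block dA i j X else 0\<^sub>m dA dA
     else if j < d then 0\<^sub>m dA dA else mat_block dA (i - d) (j - d) Y)"
    by (intro eq_matI) (auto simp: mat_block_def index_block_sum[OF X Y] bd ij lt sub)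
  then have "N (mat_block dA i j (block_sum (d * dA) X Y)) $$ (k, l) =
     (if i < d then if j < d then N (mat_block dA i j X) $$ (k, l) else 0
     else if j < d then 0 else N (mat_block dA (i - d) (j - d) Y) $$ (k, l))"
    using kl by (simp add: channel_zero)
  also have "\<dots> = block_sum (d * dB) (id_tensor d dA dB N X) (id_tensor d dA dB N Y) $$ (i * dB + k, j * dB + l)"
    unfolding index_block_sum[OF id_tensor_carrier id_tensor_carrier bd[OF ij(1) kl(1)] bd[OF ij(2) kl(2)]]
      lt[OF kl(1)] lt[OF kl(2)]
    using ij kl by (auto simp: sub index_id_tensor)
  finally show "id_tensor (d + d) dA dB N (block_sum (d * dA) X Y) $$ (i * dB + k, j * dB + l) =
    block_sum (d * dB) (id_tensor d dA dB N X) (id_tensor d dA dB N Y) $$ (i * dB + k, j * dB + l)"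
    unfolding index_id_tensor[OF ij kl] .
qed simp

text \<open>The partial trace over the first system adds up blocks, and linearity moves this sum
  inside \<open>N\<close>.\<close>

lemma tr_fst_id_tensor:
  "tr_fst dC (dR * dB) (id_tensor (dC * dR) dA dB N X) = id_tensor dR dA dB N (tr_fst dC (dR * dA) X)"
proof (rule eq_mat_prod_index[of _ dR dB])
  fix i j k l assume ij: "i < dR" "j < dR" and kl: "k < dB" "l < dB"
  have "tr_fst dC (dR * dB) (id_tensor (dC * dR) dA dB N X) $$ (i * dB + k, j * dB + l) =
      (\<Sum>c<dC. N (mat_block dA (c * dR + i) (c * dR + j) X) $$ (k, l))"
    unfolding index_tr_fst[OF prod_index_less[OF ij(1) kl(1)] prod_index_less[OF ij(2) kl(2)]]
  proof (intro sum.cong refl)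
    fix c assume "c \<in> {..<dC}"
    then have c: "c < dC" by simp
    have eq: "c * (dR * dB) + (i * dB + k) = (c * dR + i) * dB + k" for i k by (simp add: algebra_simps)
    show "id_tensor (dC * dR) dA dB N X $$ (c * (dR * dB) + (i * dB + k), c * (dR * dB) + (j * dB + l)) =
        N (mat_block dA (c * dR + i) (c * dR + j) X) $$ (k, l)"
      unfolding eq by (rule index_id_tensor[OF prod_index_less[OF c ij(1)] prod_index_less[OF c ij(2)] kl])
  qed
  also have "\<dots> = N (mat dA dA (\<lambda>ab. \<Sum>c<dC. mat_block dA (c * dR + i) (c * dR + j) X $$ ab)) $$ (k, l)"
    by (rule channel_sum[symmetric, OF mat_block_carrier kl])
  also have "mat dA dA (\<lambda>ab. \<Sum>c<dC. mat_block dA (c * dR + i) (c * dR + j) X $$ ab) =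
      mat_block dA i j (tr_fst dC (dR * dA) X)"
  proof (rule eq_matI)
    fix a b assume "a < dim_row (mat_block dA i j (tr_fst dC (dR * dA) X))" "b < dim_col (mat_block dA i j (tr_fst dC (dR * dA) X))"
    then have ab: "a < dA" "b < dA" by (auto simp: mat_block_def)
    show "mat dA dA (\<lambda>ab. \<Sum>c<dC. mat_block dA (c * dR + i) (c * dR + j) X $$ ab) $$ (a, b) =
      mat_block dA i j (tr_fst dC (dR * dA) X) $$ (a, b)"
      using ab ij prod_index_less[OF ij(1) ab(1)] prod_index_less[OF ij(2) ab(2)]
      by (simp add: mat_block_def index_tr_fst algebra_simps)
  qed (simp_all add: mat_block_def)
  finally show "tr_fst dC (dR * dB) (id_tensor (dC * dR) dA dB N X) $$ (i * dB + k, j * dB + l) =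
      id_tensor dR dA dB N (tr_fst dC (dR * dA) X) $$ (i * dB + k, j * dB + l)"
    unfolding index_id_tensor[OF ij kl] .
qed simp_all

text \<open>\<open>tensor_mat X Y\<close> groups the three systems as C(RA),
  \<open>id_tensor\<close> as (CR)A. After regrouping the index, each block on which
  \<open>N\<close> acts is an entry of \<open>X\<close> times a block of \<open>Y\<close>, so
  homogeneity of \<open>N\<close> suffices.\<close>

lemma id_tensor_tensor_mat:
  assumes X: "X \<in> carrier_mat dC dC" and Y: "Y \<in> carrier_mat (dR * dA) (dR * dA)"
  shows "id_tensor (dC * dR) dA dB N (tensor_mat X Y) = tensor_mat X (id_tensor dR dA dB N Y)"
proof (rule eq_mat_prod_index[of _ dC "dR * dB"])
  show "id_tensor (dC * dR) dA dB N (tensor_mat X Y) \<in> carrier_mat (dC * (dR * dB)) (dC * (dR * dB))"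
    using id_tensor_carrier[of "dC * dR" dA dB N "tensor_mat X Y"] by (simp add: mult.assoc)
  show "tensor_mat X (id_tensor dR dA dB N Y) \<in> carrier_mat (dC * (dR * dB)) (dC * (dR * dB))"
    by (rule tensor_mat_carrier[OF X id_tensor_carrier])
  fix c c' m m' assume cc: "c < dC" "c' < dC" and mm: "m < dR * dB" "m' < dR * dB"
  define i k i' k' where "i = m div dB" and "k = m mod dB" and "i' = m' div dB" and "k' = m' mod dB"
  have m: "m = i * dB + k" "m' = i' * dB + k'" by (simp_all add: i_def k_def i'_def k'_def)
  have ij: "i < dR" "i' < dR" and kl: "k < dB" "k' < dB"
    using prod_index_split[OF mm(1)] prod_index_split[OF mm(2)] by (simp_all add: i_def k_def i'_def k'_def)
  have eq: "c * (dR * e) + (i * e + k) = (c * dR + i) * e + k" for c i k e by (simp add: algebra_simps)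
  note lt = prod_index_less[OF cc(1) ij(1)] prod_index_less[OF cc(2) ij(2)]
  have "mat_block dA (c * dR + i) (c' * dR + i') (tensor_mat X Y) = X $$ (c, c') \<cdot>\<^sub>m mat_block dA i i' Y"
  proof (rule eq_matI)
    fix a b assume "a < dim_row (X $$ (c, c') \<cdot>\<^sub>m mat_block dA i i' Y)" "b < dim_col (X $$ (c, c') \<cdot>\<^sub>m mat_block dA i i' Y)"
    then have ab: "a < dA" "b < dA" by (auto simp: mat_block_def)
    show "mat_block dA (c * dR + i) (c' * dR + i') (tensor_mat X Y) $$ (a, b) = (X $$ (c, c') \<cdot>\<^sub>m mat_block dA i i' Y) $$ (a, b)"
      using ab index_tensor_mat[OF X Y cc prod_index_less[OF ij(1) ab(1)] prod_index_less[OF ij(2) ab(2)]]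
      by (simp add: mat_block_def eq)
  qed (simp_all add: mat_block_def)
  then have "N (mat_block dA (c * dR + i) (c' * dR + i') (tensor_mat X Y)) $$ (k, k') =
      X $$ (c, c') * N (mat_block dA i i' Y) $$ (k, k')"
    using channel_carrier[OF mat_block_carrier, of i i' Y] kl by (simp add: channel_smult)
  then have "id_tensor (dC * dR) dA dB N (tensor_mat X Y) $$ (c * (dR * dB) + m, c' * (dR * dB) + m') =
      X $$ (c, c') * id_tensor dR dA dB N Y $$ (m, m')"
    unfolding m eq index_id_tensor[OF lt kl] index_id_tensor[OF ij kl] .
  then show "id_tensor (dC * dR) dA dB N (tensor_mat X Y) $$ (c * (dR * dB) + m, c' * (dR * dB) + m') =
      tensor_mat X (id_tensor dR dA dB N Y) $$ (c * (dR * dB) + m, c' * (dR * dB) + m')"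
    unfolding index_tensor_mat[OF X id_tensor_carrier cc mm] .
qed

text \<open>The relative entropies on the two sides agree term by term, so the equality of pairs
  also covers infinite values.\<close>

lemma cmi_pair_eq:
  fixes dC dR :: nat and \<rho> :: "complex mat"
  assumes \<rho>: "density (dC * dR * dA) \<rho>"
  defines "\<sigma> \<equiv> tensor_mat (tr_snd dC (dR * dA) \<rho>) (tr_fst dC (dR * dA) \<rho>)"
  shows "density (dC * dR * dA) \<sigma>"
    "cmi_pair dA dB N dC dR \<rho> =
      (rel_entropy (id_tensor (dC * dR) dA dB N \<rho>) (id_tensor (dC * dR) dA dB N \<sigma>)
         - rel_entropy (tr_snd (dC * dR) dA \<rho>) (tr_snd (dC * dR) dA \<sigma>),
       rel_entropy \<rho> \<sigma> - rel_entropy (tr_snd (dC * dR) dA \<rho>) (tr_snd (dC * dR) dA \<sigma>))"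
proof -
  have d: "density (dC * (dR * dA)) \<rho>" using \<rho> by (simp add: mult.assoc)
  from density_tensor_mat[OF density_tr_snd[OF d] density_tr_fst[OF d]]
  show "density (dC * dR * dA) \<sigma>" unfolding \<sigma>_def by (simp add: mult.assoc)
  let ?M = "id_tensor (dC * dR) dA dB N \<rho>"
  \<comment> \<open>The product of the output marginals is the output of the product state.\<close>
  have 1: "tensor_mat (tr_snd dC (dR * dB) ?M) (tr_fst dC (dR * dB) ?M) = id_tensor (dC * dR) dA dB N \<sigma>"
    unfolding \<sigma>_def id_tensor_tensor_mat[OF tr_snd_carrier tr_fst_carrier] tr_fst_id_tensor
    by (simp only: tr_snd_tr_snd tr_snd_id_tensor)
  \<comment> \<open>Likewise, the product of the marginals on C and R is what remains of the product
    state when A is traced out.\<close>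
  have 2: "tensor_mat (tr_snd dC dR (tr_snd (dC * dR) dA \<rho>)) (tr_fst dC dR (tr_snd (dC * dR) dA \<rho>)) =
      tr_snd (dC * dR) dA \<sigma>"
    unfolding \<sigma>_def tr_snd_tensor_mat[OF tr_snd_carrier tr_fst_carrier] tr_fst_tr_snd
    by (simp only: tr_snd_tr_snd)
  show "cmi_pair dA dB N dC dR \<rho> =
      (rel_entropy (id_tensor (dC * dR) dA dB N \<rho>) (id_tensor (dC * dR) dA dB N \<sigma>)
         - rel_entropy (tr_snd (dC * dR) dA \<rho>) (tr_snd (dC * dR) dA \<sigma>),
       rel_entropy \<rho> \<sigma> - rel_entropy (tr_snd (dC * dR) dA \<rho>) (tr_snd (dC * dR) dA \<sigma>))"
    unfolding cmi_pair_def cond_mutual_info_def mutual_info_def tr_snd_id_tensor 1 2 \<sigma>_def[symmetric] ..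
qed

end

section \<open>Classical-quantum states and the binary ensemble\<close>

lemma psd_basis_proj: "psd n (basis_proj n u)"
proof (rule psdI)
  fix f :: "nat \<Rightarrow> complex"
  have "quad_form n (basis_proj n u) f = (\<Sum>i<n. \<Sum>j<n. if i = u then if j = u then cnj (f u) * f u else 0 else 0)"
    unfolding quad_form_def by (intro sum.cong refl) (auto simp: basis_proj_def)
  also have "\<dots> = (\<Sum>i<n. if i = u then \<Sum>j<n. if j = u then cnj (f u) * f u else 0 else 0)"
    by (intro sum.cong refl) auto
  also have "\<dots> = (if u < n then f u * cnj (f u) else 0)" by (simp add: mult.commute)
  also have "\<dots> = complex_of_real (if u < n then (cmod (f u))\<^sup>2 else 0)"
    by (simp only: complex_norm_square of_real_0 split: if_splits) simp
  finally show "0 \<le> quad_form n (basis_proj n u) f" by (simp only: complex_of_real_nonneg_iff) simp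
qed (simp add: basis_proj_def)

lemma density_basis_proj:
  assumes "u < n"
  shows "density n (basis_proj n u)"
proof -
  have "mat_trace (basis_proj n u) = (\<Sum>i<n. if i = u then 1 else 0)"
    unfolding mat_trace_def by (intro sum.cong) (auto simp: basis_proj_def)
  then show ?thesis using assms psd_basis_proj by (simp add: density_def)
qed

lemma cq_state_density:
  assumes "cq_state dU d \<rho>"
  shows "density (dU * d) \<rho>"
proof -
  obtain p \<tau> where p: "\<And>u. u < dU \<Longrightarrow> 0 \<le> p u" "(\<Sum>u<dU. p u) = 1" and \<tau>: "\<And>u. u < dU \<Longrightarrow> density d (\<tau> u)"
    and \<rho>: "\<rho> = mat (dU * d) (dU * d)
      (\<lambda>ij. \<Sum>u<dU. complex_of_real (p u) * tensor_mat (basis_proj dU u) (\<tau> u) $$ ij)"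
    using assms unfolding cq_state_def by blast
  let ?T = "\<lambda>u. tensor_mat (basis_proj dU u) (\<tau> u)"
  have T: "density (dU * d) (?T u)" if "u < dU" for u
    using that by (intro density_tensor_mat density_basis_proj \<tau>)
  have car: "\<rho> \<in> carrier_mat (dU * d) (dU * d)" unfolding \<rho> by simp
  have "0 \<le> quad_form (dU * d) \<rho> f" for f
  proof -
    have "quad_form (dU * d) \<rho> f = (\<Sum>i<dU * d. \<Sum>j<dU * d. \<Sum>u<dU. complex_of_real (p u) * (cnj (f i) * ?T u $$ (i, j) * f j))"
      unfolding quad_form_def \<rho>
      by (intro sum.cong refl) (simp add: sum_distrib_left sum_distrib_right mult_ac)
    also have "\<dots> = (\<Sum>i<dU * d. \<Sum>u<dU. \<Sum>j<dU * d. complex_of_real (p u) * (cnj (f i) * ?T u $$ (i, j) * f j))"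
      by (intro sum.cong refl sum.swap)
    also have "\<dots> = (\<Sum>u<dU. \<Sum>i<dU * d. \<Sum>j<dU * d. complex_of_real (p u) * (cnj (f i) * ?T u $$ (i, j) * f j))"
      by (rule sum.swap)
    also have "\<dots> = (\<Sum>u<dU. complex_of_real (p u) * quad_form (dU * d) (?T u) f)"
      by (simp add: quad_form_def sum_distrib_left)
    also have "\<dots> \<ge> 0"
    proof (rule sum_nonneg)
      fix u assume "u \<in> {..<dU}"
      then have u: "u < dU" by simp
      have "0 \<le> complex_of_real (p u)" using p(1)[OF u] by (simp only: complex_of_real_nonneg_iff)
      then show "0 \<le> complex_of_real (p u) * quad_form (dU * d) (?T u) f"
        by (intro mult_nonneg_nonneg psd_quad_form[OF densityD(1)[OF T[OF u]]])
    qed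
    finally show ?thesis .
  qed
  moreover have "mat_trace \<rho> = 1"
  proof -
    have "mat_trace \<rho> = (\<Sum>i<dU * d. \<Sum>u<dU. complex_of_real (p u) * ?T u $$ (i, i))"
      unfolding mat_trace_def \<rho> by simp
    also have "\<dots> = (\<Sum>u<dU. \<Sum>i<dU * d. complex_of_real (p u) * ?T u $$ (i, i))" by (rule sum.swap)
    also have "\<dots> = (\<Sum>u<dU. complex_of_real (p u) * mat_trace (?T u))"
      using carrier_matD(1)[OF densityD(2)[OF T]]
      by (intro sum.cong refl) (simp add: mat_trace_def sum_distrib_left)
    also have "\<dots> = complex_of_real (\<Sum>u<dU. p u)" using densityD(3)[OF T] by simp
    finally show ?thesis using p(2) by simp
  qed
  ultimately show ?thesis using car by (simp add: density_def psdI)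
qed

text \<open>The state p |0><0| (x) rho + (1 - p) |1><1| (x) sigma, written as a block-diagonal
  matrix because logarithm and relative entropy split over the blocks;
  \<open>cq_state_binary_cq\<close> connects it with \<open>cq_state\<close>.\<close>

definition binary_cq :: "nat \<Rightarrow> real \<Rightarrow> complex mat \<Rightarrow> complex mat \<Rightarrow> complex mat" where
  "binary_cq d p \<rho> \<sigma> = block_sum d (complex_of_real p \<cdot>\<^sub>m \<rho>) (complex_of_real (1 - p) \<cdot>\<^sub>m \<sigma>)"

lemma binary_cq_carrier:
  assumes "\<rho> \<in> carrier_mat d d" "\<sigma> \<in> carrier_mat d d"
  shows "binary_cq d p \<rho> \<sigma> \<in> carrier_mat (d + d) (d + d)"
  unfolding binary_cq_def by (intro block_sum_carrier smult_carrier_mat assms)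

lemma index_binary_cq:
  assumes "\<rho> \<in> carrier_mat d d" "\<sigma> \<in> carrier_mat d d" "u < 2" "v < 2" "k < d" "l < d"
  shows "binary_cq d p \<rho> \<sigma> $$ (u * d + k, v * d + l) =
    (if u = v then if u = 0 then complex_of_real p * \<rho> $$ (k, l) else complex_of_real (1 - p) * \<sigma> $$ (k, l) else 0)"
  using assms unfolding binary_cq_def
  by (subst index_block_sum) (auto simp: less_2_cases_iff)

text \<open>The product of the marginals of a binary state is diag(p, 1 - p) (x) omega. Reading it
  as a binary state with the same weights makes both arguments of the relative entropy block sums of
  equal scaling.\<close>

lemma binary_cq_tensor_mat:
  assumes "\<omega> \<in> carrier_mat d d"
  shows "binary_cq d p \<omega> \<omega> =
    tensor_mat (mat 2 2 (\<lambda>(u, v). if u = v then if u = 0 then complex_of_real p else complex_of_real (1 - p) else 0)) \<omega>"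
proof (rule eq_mat_prod_index[of _ 2 d])
  show "binary_cq d p \<omega> \<omega> \<in> carrier_mat (2 * d) (2 * d)"
    using binary_cq_carrier[OF assms assms] by (simp add: mult_2)
  fix i j k l :: nat assume ij: "i < 2" "j < 2" and kl: "k < d" "l < d"
  show "binary_cq d p \<omega> \<omega> $$ (i * d + k, j * d + l) =
    tensor_mat (mat 2 2 (\<lambda>(u, v). if u = v then if u = 0 then complex_of_real p else complex_of_real (1 - p) else 0)) \<omega> $$ (i * d + k, j * d + l)"
    unfolding index_binary_cq[OF assms assms ij kl] index_tensor_mat[OF mat_carrier assms ij kl]
    using ij by simp
qed (rule tensor_mat_carrier[OF mat_carrier assms])

lemma tr_snd_binary_cq:
  assumes "density d \<rho>" "density d \<sigma>"
  shows "tr_snd 2 d (binary_cq d p \<rho> \<sigma>) =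
    mat 2 2 (\<lambda>(u, v). if u = v then if u = 0 then complex_of_real p else complex_of_real (1 - p) else 0)"
proof (rule eq_matI)
  note r = densityD[OF assms(1)] and s = densityD[OF assms(2)]
  have tr: "(\<Sum>k<d. \<rho> $$ (k, k)) = 1" "(\<Sum>k<d. \<sigma> $$ (k, k)) = 1"
    using r s by (simp_all add: mat_trace_def)
  fix u v assume "u < dim_row (mat 2 2 (\<lambda>(u, v). if u = v then if u = 0 then complex_of_real p else complex_of_real (1 - p) else 0))"
    "v < dim_col (mat 2 2 (\<lambda>(u, v). if u = v then if u = 0 then complex_of_real p else complex_of_real (1 - p) else 0))"
  then have uv: "u < 2" "v < 2" by auto
  have "tr_snd 2 d (binary_cq d p \<rho> \<sigma>) $$ (u, v) = (\<Sum>k<d. if u = v then if u = 0 then complex_of_real p * \<rho> $$ (k, k)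
      else complex_of_real (1 - p) * \<sigma> $$ (k, k) else 0)"
    unfolding index_tr_snd[OF uv] using uv by (intro sum.cong refl) (simp add: index_binary_cq[OF r(2) s(2)])
  also have "\<dots> = (if u = v then if u = 0 then complex_of_real p else complex_of_real (1 - p) else 0)"
    by (simp add: sum_distrib_left[symmetric] tr)
  finally show "tr_snd 2 d (binary_cq d p \<rho> \<sigma>) $$ (u, v) =
    mat 2 2 (\<lambda>(u, v). if u = v then if u = 0 then complex_of_real p else complex_of_real (1 - p) else 0) $$ (u, v)"
    using uv by simp
qed (simp_all add: tr_snd_def)

lemma tr_fst_binary_cq:
  assumes "\<rho> \<in> carrier_mat d d" "\<sigma> \<in> carrier_mat d d"
  shows "tr_fst 2 d (binary_cq d p \<rho> \<sigma>) = mix p \<rho> \<sigma>"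
proof (rule eq_matI)
  fix k l assume "k < dim_row (mix p \<rho> \<sigma>)" "l < dim_col (mix p \<rho> \<sigma>)"
  then have kl: "k < d" "l < d" using mix_carrier[OF assms, of p] by auto
  show "tr_fst 2 d (binary_cq d p \<rho> \<sigma>) $$ (k, l) = mix p \<rho> \<sigma> $$ (k, l)"
    unfolding index_tr_fst[OF kl] index_mix[OF assms kl] numeral_2_eq_2
    using index_binary_cq[OF assms, of 0 0 k l p] index_binary_cq[OF assms, of 1 1 k l p] kl by simp
qed (use mix_carrier[OF assms, of p] in \<open>auto simp: tr_fst_def\<close>)

lemma psd_dominating_mono:
  assumes "psd n (complex_of_real c \<cdot>\<^sub>m \<sigma> - \<rho>)" "psd n \<sigma>" "\<rho> \<in> carrier_mat n n" "c \<le> c'"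
  shows "psd n (complex_of_real c' \<cdot>\<^sub>m \<sigma> - \<rho>)"
proof -
  have "complex_of_real c' \<cdot>\<^sub>m \<sigma> - \<rho> = (complex_of_real c \<cdot>\<^sub>m \<sigma> - \<rho>) + complex_of_real (c' - c) \<cdot>\<^sub>m \<sigma>"
    using assms(3) psd_carrier[OF assms(2)] by (intro eq_matI) (auto simp: algebra_simps)
  then show ?thesis using psd_add[OF assms(1) psd_smult[OF assms(2), of "c' - c"]] assms(4) by simp
qed

lemma dominated_binary_cq:
  assumes psd: "psd n \<rho>" "psd n \<sigma>" and p: "0 < p" "p < 1"
  shows "dominated (n + n) (binary_cq n p \<rho> \<sigma>) (binary_cq n p (mix p \<rho> \<sigma>) (mix p \<rho> \<sigma>))"
proof -
  \<comment> \<open>One constant must serve both blocks: the sum of the two constants of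
    \<open>dominated_mix\<close> is at least each of them.\<close>
  let ?m = "mix p \<rho> \<sigma>" and ?c = "1 / p + 1 / (1 - p)"
  note c = psd_carrier[OF psd(1)] psd_carrier[OF psd(2)]
  have m: "psd n ?m" using p by (intro psd_mix psd) auto
  note mc = psd_carrier[OF m]
  have d: "psd n (complex_of_real ?c \<cdot>\<^sub>m ?m - \<rho>)" "psd n (complex_of_real ?c \<cdot>\<^sub>m ?m - \<sigma>)"
    by (rule psd_dominating_mono[OF dominated_mix(1)[OF psd p] m c(1)], use p in simp,
        rule psd_dominating_mono[OF dominated_mix(2)[OF psd p] m c(2)], use p in simp)
  have "complex_of_real ?c \<cdot>\<^sub>m binary_cq n p ?m ?m - binary_cq n p \<rho> \<sigma> =
      binary_cq n p (complex_of_real ?c \<cdot>\<^sub>m ?m - \<rho>) (complex_of_real ?c \<cdot>\<^sub>m ?m - \<sigma>)"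
  proof (rule eq_mat_prod_index[of _ 2 n])
    have car: "binary_cq n p X Y \<in> carrier_mat (2 * n) (2 * n)"
      if "X \<in> carrier_mat n n" "Y \<in> carrier_mat n n" for X Y
      using binary_cq_carrier[OF that] by (simp add: mult_2)
    show "complex_of_real ?c \<cdot>\<^sub>m binary_cq n p ?m ?m - binary_cq n p \<rho> \<sigma> \<in> carrier_mat (2 * n) (2 * n)"
      by (intro minus_carrier_mat car c)
    show "binary_cq n p (complex_of_real ?c \<cdot>\<^sub>m ?m - \<rho>) (complex_of_real ?c \<cdot>\<^sub>m ?m - \<sigma>) \<in> carrier_mat (2 * n) (2 * n)"
      by (intro car minus_carrier_mat c)
    fix i j k l :: nat assume ij: "i < 2" "j < 2" and kl: "k < n" "l < n"
    note lt = prod_index_less[OF ij(1) kl(1)] prod_index_less[OF ij(2) kl(2)]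
    define C where "C = complex_of_real ?c"
    have "(C \<cdot>\<^sub>m binary_cq n p ?m ?m - binary_cq n p \<rho> \<sigma>) $$ (i * n + k, j * n + l) =
       C * binary_cq n p ?m ?m $$ (i * n + k, j * n + l) - binary_cq n p \<rho> \<sigma> $$ (i * n + k, j * n + l)"
      using lt car[OF c] car[OF mc mc] by simp
    also have "\<dots> = binary_cq n p (C \<cdot>\<^sub>m ?m - \<rho>) (C \<cdot>\<^sub>m ?m - \<sigma>) $$ (i * n + k, j * n + l)"
      unfolding index_binary_cq[OF mc mc ij kl] index_binary_cq[OF c ij kl]
        index_binary_cq[OF minus_carrier_mat[OF c(1)] minus_carrier_mat[OF c(2)] ij kl]
      using c mc kl by (simp add: algebra_simps)
    finally show "(complex_of_real ?c \<cdot>\<^sub>m binary_cq n p ?m ?m - binary_cq n p \<rho> \<sigma>) $$ (i * n + k, j * n + l) =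
      binary_cq n p (complex_of_real ?c \<cdot>\<^sub>m ?m - \<rho>) (complex_of_real ?c \<cdot>\<^sub>m ?m - \<sigma>) $$ (i * n + k, j * n + l)"
      unfolding C_def .
  qed
  moreover have "psd (n + n) (binary_cq n p (complex_of_real ?c \<cdot>\<^sub>m ?m - \<rho>) (complex_of_real ?c \<cdot>\<^sub>m ?m - \<sigma>))"
    unfolding binary_cq_def using p by (intro psd_block_sum psd_smult d) auto
  ultimately show ?thesis unfolding dominated_def by metis
qed

lemma rel_entropy_dominated:
  assumes "psd n \<rho>" "psd n \<sigma>" "dominated n \<rho> \<sigma>"
  shows "rel_entropy \<rho> \<sigma> = ereal (qre \<rho> \<sigma>)"
  using dominated_imp_supp_subset[OF assms] by (simp add: rel_entropy_def qre_def)

lemma rel_entropy_finite_imp_dominated: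
  assumes "psd n \<rho>" "psd n \<sigma>" "rel_entropy \<rho> \<sigma> \<noteq> \<infinity>"
  shows "dominated n \<rho> \<sigma>"
  using assms supp_subset_imp_dominated[OF assms(1,2)] by (auto simp: rel_entropy_def split: if_splits)

text \<open>The relative entropy splits over the blocks, and \<open>qre_smult\<close> pulls the
  weights \<open>p\<close> and \<open>1 - p\<close> out of them; it asks for positive weights, hence
  both strict bounds on \<open>p\<close>.\<close>

lemma mutual_info_binary_cq:
  assumes d: "density n \<rho>" "density n \<sigma>" and p: "0 < p" "p < 1"
  shows "mutual_info 2 n (binary_cq n p \<rho> \<sigma>) = ereal (mix_info p \<rho> \<sigma>)"
proof -
  note r = densityD[OF d(1)] and s = densityD[OF d(2)]
  let ?m = "mix p \<rho> \<sigma>"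
  have m: "psd n ?m" using p by (intro psd_mix r s) auto
  have dom: "dominated n \<rho> ?m" "dominated n \<sigma> ?m"
    using dominated_mix[OF r(1) s(1) p] unfolding dominated_def by blast+
  have ps: "psd n (complex_of_real p \<cdot>\<^sub>m X)" "psd n (complex_of_real (1 - p) \<cdot>\<^sub>m X)" if "psd n X" for X
    using p by (auto intro!: psd_smult that simp del: of_real_diff)
  have "mutual_info 2 n (binary_cq n p \<rho> \<sigma>) = rel_entropy (binary_cq n p \<rho> \<sigma>) (binary_cq n p ?m ?m)"
    unfolding mutual_info_def tr_snd_binary_cq[OF d] tr_fst_binary_cq[OF r(2) s(2)]
      binary_cq_tensor_mat[OF psd_carrier[OF m]] ..
  also have "\<dots> = ereal (qre (binary_cq n p \<rho> \<sigma>) (binary_cq n p ?m ?m))"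
    by (rule rel_entropy_dominated[OF _ _ dominated_binary_cq[OF r(1) s(1) p]])
      (auto simp: binary_cq_def simp del: of_real_diff intro!: psd_block_sum ps r s m)
  also have "qre (binary_cq n p \<rho> \<sigma>) (binary_cq n p ?m ?m) = mix_info p \<rho> \<sigma>"
    unfolding binary_cq_def qre_block_sum[OF ps(1)[OF r(1)] ps(2)[OF s(1)] ps(1)[OF m] ps(2)[OF m]]
      qre_smult[OF r(1) m dom(1) p(1)] mix_info_def
    using qre_smult[OF s(1) m dom(2), of "1 - p"] p by simp
  finally show ?thesis .
qed

lemma cond_mutual_info_binary_cq:
  assumes d: "density (n * e) \<rho>" "density (n * e) \<sigma>" and p: "0 < p" "p < 1"
  shows "cond_mutual_info 2 n e (binary_cq (n * e) p \<rho> \<sigma>) =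
    ereal (mix_info p \<rho> \<sigma> - mix_info p (tr_snd n e \<rho>) (tr_snd n e \<sigma>))"
proof -
  note r = densityD[OF d(1)] and s = densityD[OF d(2)]
  have "tr_snd (2 * n) e (binary_cq (n * e) p \<rho> \<sigma>) = binary_cq n p (tr_snd n e \<rho>) (tr_snd n e \<sigma>)"
    unfolding binary_cq_def mult_2 tr_snd_block_sum[OF smult_carrier_mat[OF r(2)] smult_carrier_mat[OF s(2)]]
      tr_snd_smult[OF r(2)] tr_snd_smult[OF s(2)] ..
  then show ?thesis
    unfolding cond_mutual_info_def mutual_info_binary_cq[OF d p]
    by (simp add: mutual_info_binary_cq[OF density_tr_snd[OF d(1)] density_tr_snd[OF d(2)] p])
qed

lemma cq_state_binary_cq:
  assumes d: "density n \<rho>" "density n \<sigma>" and p: "0 \<le> p" "p \<le> 1"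
  shows "cq_state 2 n (binary_cq n p \<rho> \<sigma>)"
proof -
  note r = densityD[OF d(1)] and s = densityD[OF d(2)]
  define q where "q u = (if u = 0 then p else 1 - p)" for u :: nat
  define \<tau> where "\<tau> u = (if u = 0 then \<rho> else \<sigma>)" for u :: nat
  have \<tau>: "\<tau> u \<in> carrier_mat n n" for u using r s by (simp add: \<tau>_def)
  let ?M = "mat (2 * n) (2 * n) (\<lambda>ij. \<Sum>u<2. complex_of_real (q u) * tensor_mat (basis_proj 2 u) (\<tau> u) $$ ij)"
  have "binary_cq n p \<rho> \<sigma> = ?M"
  proof (rule eq_mat_prod_index[of _ 2 n])
    show "binary_cq n p \<rho> \<sigma> \<in> carrier_mat (2 * n) (2 * n)"
      using binary_cq_carrier[OF r(2) s(2)] by (simp add: mult_2)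
    fix i j k l :: nat assume ij: "i < 2" "j < 2" and kl: "k < n" "l < n"
    have b: "basis_proj 2 u \<in> carrier_mat 2 2" for u by (simp add: basis_proj_def)
    have "?M $$ (i * n + k, j * n + l) = (\<Sum>u<2. complex_of_real (q u) * (basis_proj 2 u $$ (i, j) * \<tau> u $$ (k, l)))"
      using prod_index_less[OF ij(1) kl(1)] prod_index_less[OF ij(2) kl(2)]
      by (simp add: index_tensor_mat[OF b \<tau> ij kl])
    also have "\<dots> = binary_cq n p \<rho> \<sigma> $$ (i * n + k, j * n + l)"
      unfolding index_binary_cq[OF r(2) s(2) ij kl] using ij
      by (auto simp: numeral_2_eq_2 q_def \<tau>_def basis_proj_def less_Suc_eq)
    finally show "binary_cq n p \<rho> \<sigma> $$ (i * n + k, j * n + l) = ?M $$ (i * n + k, j * n + l)" ..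
  qed simp
  moreover have "\<forall>u<2. 0 \<le> q u" "(\<Sum>u<2. q u) = 1" "\<forall>u<2. density n (\<tau> u)"
    using p d by (auto simp: q_def \<tau>_def numeral_2_eq_2)
  ultimately show ?thesis unfolding cq_state_def by blast
qed

lemma cmi_pair_binary_cq:
  assumes ch: "quantum_channel dA dB N" and d: "density (dR * dA) \<rho>" "density (dR * dA) \<sigma>" and p: "0 < p" "p < 1"
  shows "cmi_pair dA dB N 2 dR (binary_cq (dR * dA) p \<rho> \<sigma>) =
    (ereal (mix_info p (id_tensor dR dA dB N \<rho>) (id_tensor dR dA dB N \<sigma>) -
        mix_info p (tr_snd dR dA \<rho>) (tr_snd dR dA \<sigma>)),
     ereal (mix_info p \<rho> \<sigma> - mix_info p (tr_snd dR dA \<rho>) (tr_snd dR dA \<sigma>)))"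
proof -
  note r = densityD[OF d(1)] and s = densityD[OF d(2)]
  have "id_tensor (2 * dR) dA dB N (binary_cq (dR * dA) p \<rho> \<sigma>) =
      binary_cq (dR * dB) p (id_tensor dR dA dB N \<rho>) (id_tensor dR dA dB N \<sigma>)"
    unfolding binary_cq_def mult_2
      id_tensor_block_sum[OF ch smult_carrier_mat[OF r(2)] smult_carrier_mat[OF s(2)]]
      id_tensor_smult[OF ch r(2)] id_tensor_smult[OF ch s(2)] ..
  then show ?thesis
    unfolding cmi_pair_def
    using cond_mutual_info_binary_cq[OF density_id_tensor[OF ch d(1)] density_id_tensor[OF ch d(2)] p]
      cond_mutual_info_binary_cq[OF d p] by (simp add: tr_snd_id_tensor[OF ch])
qed

section \<open>Comparison of the suprema\<close>

text \<open>A sandwich: when every admissible ratio of \<open>T\<close> is finite and approximated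
  from below by admissible ratios of \<open>S\<close>, all sets between \<open>S\<close> and
  \<open>T\<close> share one supremum. An admissible pair in \<open>T\<close> forces one in
  \<open>S\<close>, so the default value 0 also occurs for both sides at once.\<close>

lemma sup_ratio_eqI:
  assumes sub: "S \<subseteq> X" "X \<subseteq> T"
    and approx: "\<And>num den. (num, den) \<in> T \<Longrightarrow> 0 < den \<Longrightarrow> den < \<infinity> \<Longrightarrow>
      \<exists>x. num / den = ereal x \<and> (\<forall>c<x. \<exists>num' den'. (num', den') \<in> S \<and> 0 < den' \<and> den' < \<infinity> \<and> ereal c \<le> num' / den')"
  shows "sup_ratio X = sup_ratio T"
proof -
  define Q where "Q S = {num / den | num den. (num, den) \<in> S \<and> 0 < den \<and> den < \<infinity>}" for S :: "(ereal \<times> ereal) set"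
  have QX: "Q S \<subseteq> Q X" "Q X \<subseteq> Q T" using sub unfolding Q_def by blast+
  have Qapprox: "\<exists>x. y = ereal x \<and> (\<forall>c<x. \<exists>z\<in>Q S. ereal c \<le> z)" if y_in: "y \<in> Q T" for y
  proof -
    obtain num den where y: "y = num / den" "(num, den) \<in> T" "0 < den" "den < \<infinity>"
      using y_in unfolding Q_def by blast
    show ?thesis using approx[OF y(2-4)] unfolding y(1) Q_def by blast
  qed
  have "Q X = {} \<longleftrightarrow> Q T = {}"
  proof -
    have "Q S \<noteq> {}" if y_in: "y \<in> Q T" for y
    proof -
      obtain x where "\<forall>c<x. \<exists>z\<in>Q S. ereal c \<le> z" using Qapprox[OF y_in] by blast
      \<comment> \<open>Any real number below \<open>x\<close> would do; only the existence of an
        admissible ratio matters.\<close>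
      then have "\<exists>z\<in>Q S. ereal (x - 1) \<le> z" by simp
      then show ?thesis by blast
    qed
    then show ?thesis using QX by blast
  qed
  moreover have "Sup (Q X) = Sup (Q T)"
  proof (rule antisym)
    show "Sup (Q X) \<le> Sup (Q T)" by (rule Sup_subset_mono[OF QX(2)])
    show "Sup (Q T) \<le> Sup (Q X)"
    proof (rule Sup_least)
      fix y assume "y \<in> Q T"
      then obtain x where x: "y = ereal x" "\<forall>c<x. \<exists>z\<in>Q S. ereal c \<le> z" using Qapprox by blast
      have c: "ereal c \<le> Sup (Q X)" if "c < x" for c
        using x(2) that QX(1) by (meson Sup_upper2 subsetD)
      show "y \<le> Sup (Q X)" unfolding x(1)
      \<comment> \<open>An extended real below \<open>ereal x\<close> is real, where
        \<open>c\<close> applies, or minus infinity.\<close>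
      proof (rule dense_le)
        fix t assume "t < ereal x"
        then show "t \<le> Sup (Q X)" using c by (cases t) auto
      qed
    qed
  qed
  ultimately show ?thesis unfolding sup_ratio_def Q_def[symmetric] Let_def by simp
qed

text \<open>Numerator and denominator of the binary ensemble converge only after division by
  \<open>p\<close>, which cancels in the ratio. The positive limit of the denominators makes the
  binary states admissible for all small \<open>p\<close>.\<close>

lemma eta_Delta_ratio_approx:
  fixes dR :: nat and \<rho> \<sigma> :: "complex mat"
  defines "num \<equiv> \<lambda>dA dB N. rel_entropy (id_tensor dR dA dB N \<rho>) (id_tensor dR dA dB N \<sigma>)
      - rel_entropy (tr_snd dR dA \<rho>) (tr_snd dR dA \<sigma>)"
    and "den \<equiv> \<lambda>dA. rel_entropy \<rho> \<sigma> - rel_entropy (tr_snd dR dA \<rho>) (tr_snd dR dA \<sigma>)"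
  assumes ch: "quantum_channel dA dB N"
    and d: "density (dR * dA) \<rho>" "density (dR * dA) \<sigma>" and den: "0 < den dA" "den dA < \<infinity>"
  shows "\<exists>x. num dA dB N / den dA = ereal x \<and> (\<forall>c<x. \<exists>p num' den'. 0 < p \<and> p < 1 \<and>
    (num', den') = cmi_pair dA dB N 2 dR (binary_cq (dR * dA) p \<rho> \<sigma>) \<and>
    0 < den' \<and> den' < \<infinity> \<and> ereal c \<le> num' / den')"
proof -
  note r = densityD[OF d(1)] and s = densityD[OF d(2)]
  let ?T = "tr_snd dR dA" and ?M = "id_tensor dR dA dB N"
  note dT = density_tr_snd[OF d(1)] density_tr_snd[OF d(2)]
  note dM = density_id_tensor[OF ch d(1)] density_id_tensor[OF ch d(2)]
  note rT = densityD[OF dT(1)] and sT = densityD[OF dT(2)]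
  note rM = densityD[OF dM(1)] and sM = densityD[OF dM(2)]
  \<comment> \<open>In \<open>ereal\<close> an infinite first term makes the difference infinite
    whatever is subtracted, contrary to \<open>den(2)\<close>.\<close>
  have "rel_entropy \<rho> \<sigma> \<noteq> \<infinity>" using den(2) by (auto simp: den_def)
  then have dom: "dominated (dR * dA) \<rho> \<sigma>" by (rule rel_entropy_finite_imp_dominated[OF r(1) s(1)])
  note rel = rel_entropy_dominated[OF r(1) s(1) dom]
  \<comment> \<open>With a finite first term, an infinite marginal term would make the difference
    minus infinity, contrary to \<open>den(1)\<close>.\<close>
  have "rel_entropy (?T \<rho>) (?T \<sigma>) \<noteq> \<infinity>" using den(1) by (auto simp: den_def rel)
  then have domT: "dominated dR (?T \<rho>) (?T \<sigma>)" by (rule rel_entropy_finite_imp_dominated[OF rT(1) sT(1)])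
  note relT = rel_entropy_dominated[OF rT(1) sT(1) domT]
  \<comment> \<open>This makes the numerator finite, so that the ratio is a real number.\<close>
  have domM: "dominated (dR * dB) (?M \<rho>) (?M \<sigma>)" by (rule dominated_id_tensor[OF ch r(2) s(2) dom])
  note relM = rel_entropy_dominated[OF rM(1) sM(1) domM]
  define a where "a p = mix_info p (?M \<rho>) (?M \<sigma>) - mix_info p (?T \<rho>) (?T \<sigma>)" for p
  define b where "b p = mix_info p \<rho> \<sigma> - mix_info p (?T \<rho>) (?T \<sigma>)" for p
  define a0 where "a0 = qre (?M \<rho>) (?M \<sigma>) - qre (?T \<rho>) (?T \<sigma>)"
  define b0 where "b0 = qre \<rho> \<sigma> - qre (?T \<rho>) (?T \<sigma>)"
  have num_eq: "num dA dB N = ereal a0" and den_eq: "den dA = ereal b0"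
    by (simp_all add: num_def den_def a0_def b0_def rel relT relM)
  then have b0: "0 < b0" using den(1) by simp
  have lim: "((\<lambda>p. mix_info p \<rho> \<sigma> / p) \<longlongrightarrow> qre \<rho> \<sigma>) (at_right 0)"
    "((\<lambda>p. mix_info p (?T \<rho>) (?T \<sigma>) / p) \<longlongrightarrow> qre (?T \<rho>) (?T \<sigma>)) (at_right 0)"
    "((\<lambda>p. mix_info p (?M \<rho>) (?M \<sigma>) / p) \<longlongrightarrow> qre (?M \<rho>) (?M \<sigma>)) (at_right 0)"
    by (rule mix_info_limit[OF r(1) s(1) dom], simp add: r s,
        rule mix_info_limit[OF rT(1) sT(1) domT], simp add: rT sT,
        rule mix_info_limit[OF rM(1) sM(1) domM], simp add: rM sM)
  have la: "((\<lambda>p. a p / p) \<longlongrightarrow> a0) (at_right 0)" and lb: "((\<lambda>p. b p / p) \<longlongrightarrow> b0) (at_right 0)"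
    unfolding a_def b_def a0_def b0_def diff_divide_distrib by (intro tendsto_diff lim)+
  have ap: "\<exists>p. 0 < p \<and> p < 1 \<and> 0 < b p \<and> c \<le> a p / b p" if "c < a0 / b0" for c
  proof -
    have "((\<lambda>p. (a p / p) / (b p / p)) \<longlongrightarrow> a0 / b0) (at_right 0)"
      using b0 by (intro tendsto_divide la lb) simp
    then have "\<forall>\<^sub>F p in at_right 0. c < (a p / p) / (b p / p)" by (rule order_tendstoD(1)) (rule that)
    moreover have "\<forall>\<^sub>F p in at_right 0. 0 < b p / p" by (rule order_tendstoD(1)[OF lb b0])
    moreover have "\<forall>\<^sub>F p in at_right 0. 0 < p \<and> p < (1 :: real)"
      unfolding eventually_at_right_field by (intro exI[of _ 1]) auto
    ultimately have "\<forall>\<^sub>F p in at_right 0. 0 < p \<and> p < 1 \<and> 0 < b p \<and> c \<le> a p / b p"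
      by eventually_elim (auto simp: zero_less_divide_iff)
    then show ?thesis by (rule eventually_happens'[OF trivial_limit_at_right_real])
  qed
  show ?thesis
  proof (rule exI[of _ "a0 / b0"], intro conjI allI impI)
    show "num dA dB N / den dA = ereal (a0 / b0)" using b0 by (simp add: num_eq den_eq)
    fix c assume "c < a0 / b0"
    then obtain p where p: "0 < p" "p < 1" "0 < b p" "c \<le> a p / b p" using ap by blast
    have "(ereal (a p), ereal (b p)) = cmi_pair dA dB N 2 dR (binary_cq (dR * dA) p \<rho> \<sigma>)"
      unfolding a_def b_def by (rule cmi_pair_binary_cq[OF ch d p(1,2), symmetric])
    moreover have "0 < ereal (b p)" "ereal (b p) < \<infinity>" "ereal c \<le> ereal (a p) / ereal (b p)"
      using p by simp_all
    ultimately show "\<exists>p num' den'. 0 < p \<and> p < 1 \<and>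
        (num', den') = cmi_pair dA dB N 2 dR (binary_cq (dR * dA) p \<rho> \<sigma>) \<and>
        0 < den' \<and> den' < \<infinity> \<and> ereal c \<le> num' / den'"
      using p(1,2) by blast
  qed
qed

theorem mainTheorem2:
  fixes dA dB :: nat and N :: "complex mat \<Rightarrow> complex mat"
  assumes "quantum_channel dA dB N"
  shows "eta_Delta dA dB N = eta_2cqCMI dA dB N
       \<and> eta_2cqCMI dA dB N = eta_cqCMI dA dB N
       \<and> eta_cqCMI dA dB N = eta_CMI dA dB N"
proof -
  let ?D = "{(rel_entropy (id_tensor dR dA dB N \<rho>) (id_tensor dR dA dB N \<sigma>)
         - rel_entropy (tr_snd dR dA \<rho>) (tr_snd dR dA \<sigma>),
       rel_entropy \<rho> \<sigma> - rel_entropy (tr_snd dR dA \<rho>) (tr_snd dR dA \<sigma>))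
      | dR \<rho> \<sigma>. density (dR * dA) \<rho> \<and> density (dR * dA) \<sigma>}"
  let ?C = "{cmi_pair dA dB N dC dR \<rho> | dC dR \<rho>. density (dC * dR * dA) \<rho>}"
  let ?cq = "{cmi_pair dA dB N dU dR \<rho> | dU dR \<rho>. cq_state dU (dR * dA) \<rho>}"
  let ?B = "{cmi_pair dA dB N 2 dR \<rho> | dR \<rho>. cq_state 2 (dR * dA) \<rho>}"
  have sub1: "?B \<subseteq> ?cq" by blast
  have sub2: "?cq \<subseteq> ?C" using cq_state_density by (fastforce simp: mult.assoc)
  have sub3: "?C \<subseteq> ?D"
  proof
    fix x assume "x \<in> ?C"
    then obtain dC dR \<rho> where x: "x = cmi_pair dA dB N dC dR \<rho>" and \<rho>: "density (dC * dR * dA) \<rho>" by blast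
    show "x \<in> ?D" unfolding x cmi_pair_eq(2)[OF assms \<rho>] using \<rho> cmi_pair_eq(1)[OF assms \<rho>] by blast
  qed
  have approx: "\<exists>x. num / den = ereal x \<and> (\<forall>c<x. \<exists>num' den'. (num', den') \<in> ?B \<and> 0 < den' \<and> den' < \<infinity> \<and> ereal c \<le> num' / den')"
    if mem: "(num, den) \<in> ?D" and den: "0 < den" "den < \<infinity>" for num den
  proof -
    obtain dR \<rho> \<sigma> where d: "density (dR * dA) \<rho>" "density (dR * dA) \<sigma>"
      and num: "num = rel_entropy (id_tensor dR dA dB N \<rho>) (id_tensor dR dA dB N \<sigma>)
         - rel_entropy (tr_snd dR dA \<rho>) (tr_snd dR dA \<sigma>)"
      and dn: "den = rel_entropy \<rho> \<sigma> - rel_entropy (tr_snd dR dA \<rho>) (tr_snd dR dA \<sigma>)"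
      using mem by blast
    obtain x where x: "num / den = ereal x" and ap: "\<And>c. c < x \<Longrightarrow> \<exists>p num' den'. 0 < p \<and> p < 1 \<and>
        (num', den') = cmi_pair dA dB N 2 dR (binary_cq (dR * dA) p \<rho> \<sigma>) \<and>
        0 < den' \<and> den' < \<infinity> \<and> ereal c \<le> num' / den'"
      using eta_Delta_ratio_approx[OF assms d den[unfolded dn]] unfolding num dn by blast
    have "\<exists>num' den'. (num', den') \<in> ?B \<and> 0 < den' \<and> den' < \<infinity> \<and> ereal c \<le> num' / den'" if c: "c < x" for c
    proof -
      obtain p num' den' where p: "0 < p" "p < 1"
        and pr: "(num', den') = cmi_pair dA dB N 2 dR (binary_cq (dR * dA) p \<rho> \<sigma>)"
        and ok: "0 < den'" "den' < \<infinity>" "ereal c \<le> num' / den'"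
        using ap[OF c] by blast
      have "cq_state 2 (dR * dA) (binary_cq (dR * dA) p \<rho> \<sigma>)" using p by (intro cq_state_binary_cq d) auto
      then have "(num', den') \<in> ?B" using pr by blast
      then show ?thesis using ok by blast
    qed
    then show ?thesis using x by blast
  qed
  \<comment> \<open>Each of the three smaller sets lies between \<open>?B\<close> and
    \<open>?D\<close>, so one approximation property serves all three equalities.\<close>
  have "sup_ratio ?B = sup_ratio ?D" "sup_ratio ?cq = sup_ratio ?D" "sup_ratio ?C = sup_ratio ?D"
    using sub1 sub2 sub3 by (intro sup_ratio_eqI[where S = ?B and T = ?D] approx; blast)+
  then show ?thesis
    unfolding eta_Delta_def eta_2cqCMI_def eta_cqCMI_def eta_CMI_def by simp
qed

end
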